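(* Given a generic $\alpha$, the part $\mathrm{Spec}_{t\alpha}(G)$, $t\in[0,\varepsilon)$, of the Bloch spectrum determines the length of the minimal periodic orbit(s) of each element of $H_1(G,\mathbb{Z})$. That is: let $G$ and $G'$ be quantum graphs, let $\alpha$ be a generic real $1$-form on $G$ and $\alpha'$ a generic real $1$-form on $G'$, and let $\varepsilon>0$. If $\mathrm{Spec}_{t\alpha}(G)=\mathrm{Spec}_{t\alpha'}(G')$ for all $t\in[0,\varepsilon)$, then there is a group isomorphism $\varphi:H_1(G,\mathbb{Z})\to H_1(G',\mathbb{Z})$ with $\int_{\varphi(c)}\alpha'=\int_c\alpha$ and $\ell_{G'}(\varphi(c))=\ell_G(c)$ for all $c\in H_1(G,\mathbb{Z})$.
   Context: Quantum graphs. A quantum graph $G$ is a finite connected graph (loops and multiple edges allowed, no vertices of degree $2$) with vertex set $V$ and edge set $E$, in which every edge $e$ has a length $L_e>0$ and is identified with the interval $[0,L_e]$. For a vertex $v$, $e\sim v$ ranges over the edges adjacent to $v$ (a loop at $v$ is counted once for each of its two ends), and $\nu_{v,e}$ is the outward unit normal of $e$ at $v$. A $0$-form is a continuous function $f$ on $G$ that is $C^\infty$ on each closed edge and satisfies $\sum_{e\sim v}\nu_{v,e}(f|_e)=0$ at every vertex $v$ (Kirchhoff condition). A $1$-form $\alpha$ consists of a smooth $1$-form $\alpha_e$ on each closed edge such that $\sum_{e\sim v}\alpha_e(\nu_{v,e})=0$ at every $v$. $H^1_{dR}(G,\mathbb{R})$ is the space of real $1$-forms modulo $d$ of real $0$-forms,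 and $H^1_{dR}(G,\mathbb{Z})$ is the subgroup of classes whose integrals over all closed walks are integers. Spectra. For a real $1$-form $\alpha$ put $d_\alpha f=df+2\pi i f\alpha$ and $\Delta_\alpha=d_\alpha^*d_\alpha$; explicitly, if $\alpha=a\,dx$ in the arc length coordinate on an edge, then $\Delta_\alpha f=-\left(\frac{d}{dx}+2\pi i a\right)^2 f$ on that edge. Its domain consists of the continuous $f$ that lie in the $L^2$-Sobolev space of order $2$ on each edge and satisfy the Kirchhoff condition at each vertex. $\mathrm{Spec}_\alpha(G)$ is the spectrum of $\Delta_\alpha$, with multiplicities. A real $1$-form $\alpha$ is generic if the image of the ray $t\alpha$ in the torus $H^1_{dR}(G,\mathbb{R})/H^1_{dR}(G,\mathbb{Z})$ is dense. A periodic orbit is an oriented closed walk in the graph; it is minimal if it has minimal length within its homology class. For $c\in H_1(G,\mathbb{Z})$, $\ell_G(c)$ denotes the length of the minimal periodic orbit(s) representing $c$ (with the convention $\ell_G(0)=0$, realized by a trivial closed walk). *)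

theory Defs
  imports
    "HOL-Analysis.Analysis"
    "HOL-Library.Function_Algebras"
    "HOL-Algebra.Group"
    "Graph_Theory.Digraph_Component"
begin

section \<open>Analysis on a closed interval\<close>

text \<open>
  \<open>C\<^sup>\<infinity>\<close> on the closed interval \<open>[0,l]\<close>: all derivatives exist, one-sided at the end points.
\<close>

definition smooth_on_interval :: "real \<Rightarrow> (real \<Rightarrow> real) \<Rightarrow> bool" where
  "smooth_on_interval l a \<longleftrightarrow>
     (\<exists>D :: nat \<Rightarrow> real \<Rightarrow> real. (\<forall>x\<in>{0..l}. D 0 x = a x) \<and>
        (\<forall>n. \<forall>x\<in>{0..l}. (D n has_real_derivative D (Suc n) x) (at x within {0..l})))"

definition square_integrable :: "real \<Rightarrow> (real \<Rightarrow> complex) \<Rightarrow> bool" where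
  "square_integrable l f \<longleftrightarrow>
     set_borel_measurable lborel {0..l} f \<and> set_integrable lborel {0..l} (\<lambda>x. (cmod (f x))\<^sup>2)"

text \<open>
  \<open>f\<close> is (the continuous representative of) an element of the \<open>L\<^sup>2\<close>-Sobolev space of order 1 on
  \<open>[0,l]\<close>, and \<open>h\<close> is a version of its weak derivative: \<open>h \<in> L\<^sup>2\<close> and \<open>f\<close> is a primitive of \<open>h\<close>.
  \<open>h\<close> is determined almost everywhere on \<open>[0,l]\<close>; if it is continuous there, it is determined
  everywhere.
\<close>

definition sobolev_deriv :: "real \<Rightarrow> (real \<Rightarrow> complex) \<Rightarrow> (real \<Rightarrow> complex) \<Rightarrow> bool" where
  "sobolev_deriv l f h \<longleftrightarrow>
     square_integrable l h \<and> (\<forall>x\<in>{0..l}. f x = f 0 + (LINT t:{0..x}|lborel. h t))"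

lemma vector_space_families:
  "vector_space (\<lambda>(c::complex) (f :: 'e \<Rightarrow> real \<Rightarrow> complex) e x. c * f e x)"
  by unfold_locales (simp_all add: fun_eq_iff algebra_simps)

section \<open>Quantum graphs\<close>

text \<open>
  The arc \<open>e\<close> is identified with \<open>[0, L e]\<close>, where \<open>0\<close> is glued to \<open>tail G e\<close> and \<open>L e\<close> to
  \<open>head G e\<close>. The direction of the arcs is only the choice of this identification: \<open>connected\<close>
  refers to the underlying undirected graph, and the degree of a vertex is the sum of its in-degree
  and its out-degree, so that a loop counts twice.

  Functions and 1-forms on the graph are families \<open>f e x\<close> with \<open>e \<in> arcs G\<close> and \<open>x \<in> [0, L e]\<close>,
  a 1-form \<open>a dx\<close> being represented by its coefficient \<open>a\<close>.
\<close>

locale quantum_graph = fin_digraph G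
  for G :: "('v, 'e) pre_digraph" (structure) +
  fixes L :: "'e \<Rightarrow> real"
  assumes connected: "Digraph_Component.connected G"
    and no_degree_2: "v \<in> verts G \<Longrightarrow> in_degree G v + out_degree G v \<noteq> 2"
    and length_pos: "e \<in> arcs G \<Longrightarrow> L e > 0"
begin

definition continuous_at_vertices :: "('e \<Rightarrow> real \<Rightarrow> 'a) \<Rightarrow> bool" where
  "continuous_at_vertices f \<longleftrightarrow>
     (\<exists>val. \<forall>e\<in>arcs G. f e 0 = val (tail G e) \<and> f e (L e) = val (head G e))"

text \<open>
  The outward unit normal of \<open>e\<close> is \<open>d/dx\<close> at the end \<open>x = L e\<close> and \<open>-d/dx\<close> at the end \<open>x = 0\<close>.
  A 1-form is inserted by its coefficient, a function by its derivative.
\<close>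

definition kirchhoff :: "('e \<Rightarrow> real \<Rightarrow> 'a::ab_group_add) \<Rightarrow> bool" where
  "kirchhoff a \<longleftrightarrow>
     (\<forall>v\<in>verts G. (\<Sum>e\<in>in_arcs G v. a e (L e)) + (\<Sum>e\<in>out_arcs G v. - a e 0) = 0)"

subsection \<open>De Rham cohomology\<close>

definition is_differential :: "('e \<Rightarrow> real \<Rightarrow> real) \<Rightarrow> ('e \<Rightarrow> real \<Rightarrow> real) \<Rightarrow> bool" where
  "is_differential f a \<longleftrightarrow>
     (\<forall>e\<in>arcs G. \<forall>x\<in>{0..L e}. (f e has_real_derivative a e x) (at x within {0..L e}))"

definition zero_forms :: "('e \<Rightarrow> real \<Rightarrow> real) set" where
  "zero_forms = {f. continuous_at_vertices f \<and> (\<forall>e\<in>arcs G. smooth_on_interval (L e) (f e)) \<and>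
     (\<exists>a. is_differential f a \<and> kirchhoff a)}"

definition one_forms :: "('e \<Rightarrow> real \<Rightarrow> real) set" where
  "one_forms = {\<alpha>. (\<forall>e\<in>arcs G. smooth_on_interval (L e) (\<alpha> e)) \<and> kirchhoff \<alpha>}"

definition cohomologous :: "(('e \<Rightarrow> real \<Rightarrow> real) \<times> ('e \<Rightarrow> real \<Rightarrow> real)) set" where
  "cohomologous = {(\<alpha>, \<beta>). \<alpha> \<in> one_forms \<and> \<beta> \<in> one_forms \<and>
     (\<exists>f\<in>zero_forms. is_differential f (\<lambda>e x. \<alpha> e x - \<beta> e x))}"

definition H1dR :: "('e \<Rightarrow> real \<Rightarrow> real) set set" where
  "H1dR = one_forms // cohomologous"

definition dR_class :: "('e \<Rightarrow> real \<Rightarrow> real) \<Rightarrow> ('e \<Rightarrow> real \<Rightarrow> real) set" where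
  "dR_class \<alpha> = cohomologous `` {\<alpha>}"

subsection \<open>Closed walks and homology\<close>

text \<open>
  An oriented edge is a pair of an arc and a flag, \<open>True\<close> if the arc is traversed from its tail to
  its head. A closed walk is a cyclic sequence of such; the empty list is the trivial closed walk.
\<close>

definition start_vertex :: "'e \<times> bool \<Rightarrow> 'v" where
  "start_vertex d = (if snd d then tail G (fst d) else head G (fst d))"

definition end_vertex :: "'e \<times> bool \<Rightarrow> 'v" where
  "end_vertex d = (if snd d then head G (fst d) else tail G (fst d))"

definition closed_walk :: "('e \<times> bool) list \<Rightarrow> bool" where
  "closed_walk w \<longleftrightarrow> fst ` set w \<subseteq> arcs G \<and>
     (\<forall>i<length w. end_vertex (w ! i) = start_vertex (w ! (Suc i mod length w)))"

definition walk_length :: "('e \<times> bool) list \<Rightarrow> real" where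
  "walk_length w = (\<Sum>d\<leftarrow>w. L (fst d))"

definition walk_integral :: "('e \<Rightarrow> real \<Rightarrow> real) \<Rightarrow> ('e \<times> bool) list \<Rightarrow> real" where
  "walk_integral \<alpha> w =
     (\<Sum>d\<leftarrow>w. (if snd d then 1 else -1) * integral {0..L (fst d)} (\<alpha> (fst d)))"

text \<open>
  A graph has no 2-cells, so its first homology is the group of 1-cycles, i.e. the kernel of the
  boundary map on integral 1-chains.
\<close>

definition H1 :: "('e \<Rightarrow> int) monoid" where
  "H1 = \<lparr>carrier = {c. (\<forall>e. e \<notin> arcs G \<longrightarrow> c e = 0) \<and>
                      (\<forall>v\<in>verts G. (\<Sum>e\<in>in_arcs G v. c e) - (\<Sum>e\<in>out_arcs G v. c e) = 0)},
         mult = (\<lambda>c d e. c e + d e), one = (\<lambda>e. 0)\<rparr>"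

definition walk_class :: "('e \<times> bool) list \<Rightarrow> 'e \<Rightarrow> int" where
  "walk_class w = (\<lambda>e. \<Sum>d\<leftarrow>w. if fst d = e then (if snd d then 1 else -1) else 0)"

definition class_integral :: "('e \<Rightarrow> real \<Rightarrow> real) \<Rightarrow> ('e \<Rightarrow> int) \<Rightarrow> real" where
  "class_integral \<alpha> c = (\<Sum>e\<in>arcs G. of_int (c e) * integral {0..L e} (\<alpha> e))"

definition minimal_periodic_orbit :: "('e \<times> bool) list \<Rightarrow> bool" where
  "minimal_periodic_orbit w \<longleftrightarrow> closed_walk w \<and>
     (\<forall>w'. closed_walk w' \<and> walk_class w' = walk_class w \<longrightarrow> walk_length w \<le> walk_length w')"

definition minimal_length :: "('e \<Rightarrow> int) \<Rightarrow> real" where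
  "minimal_length c =
     (THE l. \<exists>w. minimal_periodic_orbit w \<and> walk_class w = c \<and> walk_length w = l)"

subsection \<open>Generic 1-forms\<close>

definition H1dR_int :: "('e \<Rightarrow> real \<Rightarrow> real) set set" where
  "H1dR_int = {C \<in> H1dR. \<forall>\<alpha>\<in>C. \<forall>w. closed_walk w \<longrightarrow> walk_integral \<alpha> w \<in> \<int>}"

text \<open>
  \<open>H1dR\<close> is a finite-dimensional real vector space. Its canonical topology is the coarsest one
  that makes all linear functionals continuous.
\<close>

definition linear_functional :: "(('e \<Rightarrow> real \<Rightarrow> real) set \<Rightarrow> real) \<Rightarrow> bool" where
  "linear_functional \<phi> \<longleftrightarrow> (\<forall>\<alpha>\<in>one_forms. \<forall>\<beta>\<in>one_forms. \<forall>s t :: real.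
     \<phi> (dR_class (\<lambda>e x. s * \<alpha> e x + t * \<beta> e x)) = s * \<phi> (dR_class \<alpha>) + t * \<phi> (dR_class \<beta>))"

definition H1dR_topology :: "('e \<Rightarrow> real \<Rightarrow> real) set topology" where
  "H1dR_topology = topology_generated_by
     {{C \<in> H1dR. \<phi> C \<in> U} | \<phi> U. linear_functional \<phi> \<and> open U}"

definition torus_rel :: "(('e \<Rightarrow> real \<Rightarrow> real) set \<times> ('e \<Rightarrow> real \<Rightarrow> real) set) set" where
  "torus_rel = {(dR_class \<alpha>, dR_class \<beta>) | \<alpha> \<beta>. \<alpha> \<in> one_forms \<and> \<beta> \<in> one_forms \<and>
     dR_class (\<lambda>e x. \<alpha> e x - \<beta> e x) \<in> H1dR_int}"

definition torus :: "('e \<Rightarrow> real \<Rightarrow> real) set set set" where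
  "torus = H1dR // torus_rel"

definition torus_proj :: "('e \<Rightarrow> real \<Rightarrow> real) set \<Rightarrow> ('e \<Rightarrow> real \<Rightarrow> real) set set" where
  "torus_proj C = torus_rel `` {C}"

definition torus_topology :: "('e \<Rightarrow> real \<Rightarrow> real) set set topology" where
  "torus_topology =
     topology (\<lambda>U. U \<subseteq> torus \<and> openin H1dR_topology {C \<in> H1dR. torus_proj C \<in> U})"

definition generic :: "('e \<Rightarrow> real \<Rightarrow> real) \<Rightarrow> bool" where
  "generic \<alpha> \<longleftrightarrow> \<alpha> \<in> one_forms \<and>
     torus_topology closure_of {torus_proj (dR_class (\<lambda>e x. t * \<alpha> e x)) | t. t \<ge> 0} = torus"

lemma topspace_H1dR_topology [simp]: "topspace H1dR_topology = H1dR"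
proof -
  have "linear_functional (\<lambda>_. 0)"
    by (simp add: linear_functional_def)
  then have "\<exists>\<phi> U. H1dR = {C \<in> H1dR. \<phi> C \<in> U} \<and> linear_functional \<phi> \<and> open (U :: real set)"
    by (intro exI[of _ "\<lambda>_. 0"] exI[of _ UNIV]) simp
  then have "H1dR \<in> {{C \<in> H1dR. \<phi> C \<in> U} | \<phi> U. linear_functional \<phi> \<and> open U}"
    by (rule CollectI)
  then have "H1dR \<subseteq> \<Union> {{C \<in> H1dR. \<phi> C \<in> U} | \<phi> U. linear_functional \<phi> \<and> open U}"
    by (rule Union_upper)
  moreover have "\<Union> {{C \<in> H1dR. \<phi> C \<in> U} | \<phi> U. linear_functional \<phi> \<and> open U} \<subseteq> H1dR"
    by (rule Union_least) (elim CollectE exE conjE, simp)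
  ultimately show ?thesis
    unfolding H1dR_topology_def topology_generated_by_topspace by (rule subset_antisym[rotated])
qed

lemma openin_torus_topology:
  "openin torus_topology U \<longleftrightarrow>
     U \<subseteq> torus \<and> openin H1dR_topology {C \<in> H1dR. torus_proj C \<in> U}"
proof -
  have "istopology (\<lambda>U. U \<subseteq> torus \<and> openin H1dR_topology {C \<in> H1dR. torus_proj C \<in> U})"
    unfolding istopology_def
  proof (intro conjI allI impI)
    fix S T
    assume S: "S \<subseteq> torus \<and> openin H1dR_topology {C \<in> H1dR. torus_proj C \<in> S}"
      and T: "T \<subseteq> torus \<and> openin H1dR_topology {C \<in> H1dR. torus_proj C \<in> T}"
    have eq: "{C \<in> H1dR. torus_proj C \<in> S \<inter> T} =
        {C \<in> H1dR. torus_proj C \<in> S} \<inter> {C \<in> H1dR. torus_proj C \<in> T}"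
      by blast
    show "openin H1dR_topology {C \<in> H1dR. torus_proj C \<in> S \<inter> T}"
      unfolding eq by (rule openin_Int[OF conjunct2[OF S] conjunct2[OF T]])
    show "S \<inter> T \<subseteq> torus"
      by (rule le_infI1[OF conjunct1[OF S]])
  next
    fix \<K>
    assume K: "\<forall>K\<in>\<K>. K \<subseteq> torus \<and> openin H1dR_topology {C \<in> H1dR. torus_proj C \<in> K}"
    have eq: "{C \<in> H1dR. torus_proj C \<in> \<Union>\<K>} = \<Union> ((\<lambda>K. {C \<in> H1dR. torus_proj C \<in> K}) ` \<K>)"
      by blast
    show "openin H1dR_topology {C \<in> H1dR. torus_proj C \<in> \<Union>\<K>}"
      unfolding eq by (rule openin_Union) (use K in blast)
    show "\<Union>\<K> \<subseteq> torus"
      by (rule Union_least) (use K in blast)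
  qed
  from topology_inverse'[OF this] show ?thesis
    unfolding torus_topology_def by (rule fun_cong)
qed

lemma quotient_map_torus: "quotient_map H1dR_topology torus_topology torus_proj"
proof -
  have img: "torus_proj ` H1dR = torus"
    unfolding torus_def torus_proj_def quotient_def by blast
  have "{C \<in> H1dR. torus_proj C \<in> torus} = topspace H1dR_topology"
    unfolding topspace_H1dR_topology using img by blast
  then have "openin torus_topology torus"
    unfolding openin_torus_topology using openin_topspace[of H1dR_topology] by simp
  moreover have "U \<subseteq> torus" if "openin torus_topology U" for U
    using that unfolding openin_torus_topology by (rule conjunct1)
  ultimately have top: "topspace torus_topology = torus"
    by (intro subset_antisym openin_subset) simp_all
  show ?thesis
    unfolding quotient_map_def top topspace_H1dR_topology openin_torus_topology
    using img by blast
qed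

subsection \<open>The Laplacian and its spectrum\<close>

text \<open>
  Elements of the domain vanish off the edges, so that a function on the graph is represented by
  exactly one family. The function \<open>f' e\<close> is a primitive, hence continuous, so the values of
  \<open>f'\<close> at the end points are well defined.
\<close>

definition laplacian_domain :: "('e \<Rightarrow> real \<Rightarrow> complex) set" where
  "laplacian_domain =
     {f. (\<forall>e x. \<not> (e \<in> arcs G \<and> x \<in> {0..L e}) \<longrightarrow> f e x = 0) \<and>
         continuous_at_vertices f \<and>
         (\<exists>f' f''. (\<forall>e\<in>arcs G. sobolev_deriv (L e) (f e) (f' e) \<and> sobolev_deriv (L e) (f' e) (f'' e)) \<and>
            kirchhoff f')}"

text \<open>
  \<open>is_laplacian \<alpha> f u\<close> says that \<open>u = \<Delta>\<^sub>\<alpha> f\<close> almost everywhere on every edge. Here \<open>g\<close> is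
  \<open>(d/dx + 2 \<pi> i a) f\<close>, where \<open>a\<close> is the coefficient of \<open>\<alpha>\<close>.
\<close>

definition is_laplacian ::
  "('e \<Rightarrow> real \<Rightarrow> real) \<Rightarrow> ('e \<Rightarrow> real \<Rightarrow> complex) \<Rightarrow> ('e \<Rightarrow> real \<Rightarrow> complex) \<Rightarrow> bool" where
  "is_laplacian \<alpha> f u \<longleftrightarrow>
     (\<forall>e\<in>arcs G. \<exists>f' g g'.
        sobolev_deriv (L e) (f e) f' \<and>
        (\<forall>x\<in>{0..L e}. g x = f' x + 2 * of_real pi * \<i> * of_real (\<alpha> e x) * f e x) \<and>
        sobolev_deriv (L e) g g' \<and>
        (AE x in lborel. x \<in> {0..L e} \<longrightarrow>
           u e x = - (g' x + 2 * of_real pi * \<i> * of_real (\<alpha> e x) * g x)))"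

definition L2_functions :: "('e \<Rightarrow> real \<Rightarrow> complex) set" where
  "L2_functions = {g. \<forall>e\<in>arcs G. square_integrable (L e) (g e)}"

definition L2_norm :: "('e \<Rightarrow> real \<Rightarrow> complex) \<Rightarrow> real" where
  "L2_norm g = sqrt (\<Sum>e\<in>arcs G. LINT x:{0..L e}|lborel. (cmod (g e x))\<^sup>2)"

text \<open>\<open>\<Delta>\<^sub>\<alpha> - z\<close> maps its domain bijectively onto \<open>L\<^sup>2\<close>, with bounded inverse.\<close>

definition resolvent_set :: "('e \<Rightarrow> real \<Rightarrow> real) \<Rightarrow> complex set" where
  "resolvent_set \<alpha> =
     {z. (\<forall>g\<in>L2_functions. \<exists>!f. f \<in> laplacian_domain \<and> is_laplacian \<alpha> f (\<lambda>e x. z * f e x + g e x)) \<and>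
         (\<exists>C. \<forall>g\<in>L2_functions. \<forall>f\<in>laplacian_domain.
            is_laplacian \<alpha> f (\<lambda>e x. z * f e x + g e x) \<longrightarrow> L2_norm f \<le> C * L2_norm g)}"

definition multiplicity :: "('e \<Rightarrow> real \<Rightarrow> real) \<Rightarrow> complex \<Rightarrow> nat" where
  "multiplicity \<alpha> z = vector_space.dim (\<lambda>(c::complex) f e x. c * f e x)
     {f \<in> laplacian_domain. is_laplacian \<alpha> f (\<lambda>e x. z * f e x)}"

text \<open>The spectrum with multiplicities, as a set of pairs of a spectral value and its multiplicity.\<close>

definition Spec :: "('e \<Rightarrow> real \<Rightarrow> real) \<Rightarrow> (complex \<times> nat) set" where
  "Spec \<alpha> = {(z, multiplicity \<alpha> z) | z. z \<notin> resolvent_set \<alpha>}"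

end

end

theory Submission
  imports
    Defs
    "HOL-Complex_Analysis.Complex_Analysis"
    "HOL-Real_Asymp.Real_Asymp"
    "Jordan_Normal_Form.Determinant"
begin

text \<open>
  The spectrum of a quantum graph is encoded in a finite matrix. On an edge an eigenfunction with
  eigenvalue \<open>k\<^sup>2\<close> is a superposition of two travelling waves, one for each of the two oriented edges
  (bonds) \<open>d\<close>, and continuity and the Kirchhoff condition at the vertices say that the vector of the
  amplitudes is fixed by \<open>U k = S D\<close>. Here \<open>S\<close> is the vertex scattering matrix, a real isometry with
  entries \<open>2 / deg v\<close> (transmission) and \<open>2 / deg v - 1\<close> (reflection), and \<open>D\<close> is the diagonal matrix
  of the factors \<open>exp (\<i> k L)\<close> times a phase given by the integral of the 1-form. So for real
  \<open>k \<noteq> 0\<close> the multiplicity of \<open>k\<^sup>2\<close> is the dimension of the kernel of \<open>1 - U k\<close>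
  (\<open>multiplicity_eq_dim_wave_space\<close>).

  These dimensions determine the function
  \<open>R z = tr ((1 - U z)\<^sup>-\<^sup>1 U z \<L>)\<close>, where \<open>\<L>\<close> is the diagonal matrix of the lengths
  (\<open>resolvent_trace_eqI\<close>). It is the logarithmic derivative of the secular determinant
  \<open>det (1 - U z)\<close> up to a constant. It is meromorphic with at most simple poles, all of them real; the
  leading coefficient at \<open>k\<close> is \<open>\<i>\<close> times the dimension of the kernel at \<open>k\<close>, because
  \<open>y (1 - U (k + \<i> y))\<^sup>-\<^sup>1 \<L>\<close> tends to a projection onto the kernel. Since \<open>U\<close> contracts above the
  real axis and expands below it, \<open>R\<close> is bounded by a multiple of \<open>1 + 1 / \<bar>Im z\<bar>\<close>. If two graphs have
  the same dimensions for all real \<open>k \<noteq> 0\<close>, the difference of their functions therefore extends to an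
  entire function after multiplication by \<open>z\<close>, grows at most linearly, and decays along the imaginary
  axis; so it vanishes (\<open>meromorphic_eq_0_of_growth\<close>).

  High above the real axis the Neumann series turns \<open>R\<close> into a sum over closed paths of bonds
  (\<open>trace_formula\<close>). This is a Dirichlet series whose frequencies are the lengths of the paths, and
  its coefficients are trigonometric polynomials in the parameter \<open>t\<close> whose frequencies are the
  integrals of \<open>\<alpha>\<close>. Uniqueness of the coefficients of both kinds of series shows that the spectra for
  \<open>t\<close> in an interval determine, for every length \<open>x\<close> and every integral \<open>v\<close>, the sum
  \<open>orbit_sum \<alpha> x (- (2 * pi * v))\<close> of the amplitudes of all based closed walks of length \<open>x\<close> with integral \<open>v\<close>,
  weighted with the length of the first edge (\<open>orbit_sum_determined\<close>).

  For a generic form \<open>\<alpha>\<close> a homology class is determined by its integral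
  (\<open>generic_periods_injective\<close>). Hence, if \<open>x\<close> is the length of the minimal periodic orbits in a class
  \<open>c \<noteq> 0\<close> and \<open>v\<close> is its integral, only minimal periodic orbits contribute to the sum. They do not
  backtrack, so their amplitudes are products of the positive numbers \<open>2 / deg v\<close> and cannot cancel
  (\<open>orbit_sum_minimal_nonzero\<close>). So \<open>x\<close> is the smallest length for which the sum does not vanish, and the
  values of \<open>v\<close> that occur for some length form, together with \<open>0\<close>, the group of periods of \<open>\<alpha>\<close>. The
  isomorphism sends a class to the class with the same integral.
\<close>

section \<open>Matrices over a finite index set\<close>

lemma holomorphic_on_det:
  assumes "\<And>z. M z \<in> carrier_mat n n"
    and "\<And>i j. i < n \<Longrightarrow> j < n \<Longrightarrow> (\<lambda>z. M z $$ (i, j)) holomorphic_on A"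
  shows "(\<lambda>z. Determinant.det (M z)) holomorphic_on A"
proof -
  have "(\<lambda>z. \<Sum>p\<in>{p. p permutes {0..<n}}. signof p * (\<Prod>i = 0..<n. M z $$ (i, p i))) holomorphic_on A"
    by (intro holomorphic_intros assms(2)) (auto dest: permutes_in_image)
  then show ?thesis
    by (subst det_def'[OF assms(1)])
qed

text \<open>
  Cramer's rule. It exhibits the inverse of a matrix depending holomorphically on a parameter as a
  quotient of entire functions, so that the inverse is meromorphic and its poles lie where the matrix is
  singular.
\<close>
lemma holomorphic_adjugate:
  fixes A :: "complex \<Rightarrow> 'i \<Rightarrow> 'i \<Rightarrow> complex"
  assumes fin: "finite I"
    and hol: "\<And>i j. i \<in> I \<Longrightarrow> j \<in> I \<Longrightarrow> (\<lambda>z. A z i j) holomorphic_on UNIV"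
  shows "\<exists>\<delta> adj. \<delta> holomorphic_on UNIV \<and>
    (\<forall>i\<in>I. \<forall>j\<in>I. (\<lambda>z. adj z i j) holomorphic_on UNIV) \<and>
    (\<forall>z. \<forall>i\<in>I. \<forall>j\<in>I. (\<Sum>l\<in>I. A z i l * adj z l j) = (if i = j then \<delta> z else 0)) \<and>
    (\<forall>z. \<delta> z = 0 \<longrightarrow> (\<exists>x. (\<exists>i\<in>I. x i \<noteq> 0) \<and> (\<forall>i\<in>I. (\<Sum>j\<in>I. A z i j * x j) = 0)))"
proof -
  define n where "n = card I"
  obtain h where h: "bij_betw h {0..<n} I"
    using ex_bij_betw_nat_finite[OF fin] unfolding n_def by blast
  define g where "g = the_inv_into {0..<n} h"
  have g: "g i < n" "h (g i) = i" if "i \<in> I" for i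
    using that h the_inv_into_into[of h "{0..<n}" i "{0..<n}"] f_the_inv_into_f[of h "{0..<n}" i]
    unfolding g_def bij_betw_def by auto
  have hI: "h k \<in> I" if "k < n" for k
    using that h by (auto simp: bij_betw_def)
  have gh: "g (h k) = k" if "k < n" for k
    using that h by (auto simp: bij_betw_def g_def the_inv_into_f_f)
  have sum_h: "(\<Sum>k = 0..<n. F (h k)) = sum F I" for F :: "'i \<Rightarrow> complex"
    by (rule sum.reindex_bij_betw[OF h])
  define M where "M z = mat n n (\<lambda>(i, j). A z (h i) (h j))" for z
  have M: "M z \<in> carrier_mat n n" for z
    by (simp add: M_def)
  have holM: "(\<lambda>z. M z $$ (i, j)) holomorphic_on UNIV" if "i < n" "j < n" for i j
    using hol[OF hI hI] that by (simp add: M_def)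
  show ?thesis
  proof (intro exI[of _ "\<lambda>z. Determinant.det (M z)"] exI[of _ "\<lambda>z i j. adj_mat (M z) $$ (g i, g j)"]
      conjI allI ballI impI)
    show "(\<lambda>z. Determinant.det (M z)) holomorphic_on UNIV"
      by (rule holomorphic_on_det[OF M holM])
  next
    fix i j assume ij: "i \<in> I" "j \<in> I"
    have "(\<lambda>z. Determinant.det (mat_delete (M z) (g j) (g i))) holomorphic_on UNIV"
    proof (rule holomorphic_on_det[where n = "n - 1"])
      show "mat_delete (M z) (g j) (g i) \<in> carrier_mat (n - 1) (n - 1)" for z
        by (simp add: mat_delete_def M_def)
      fix a b assume "a < n - 1" "b < n - 1"
      then show "(\<lambda>z. mat_delete (M z) (g j) (g i) $$ (a, b)) holomorphic_on UNIV"
        by (auto simp: mat_delete_def M_def insert_index_def intro!: hol hI)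
    qed
    then show "(\<lambda>z. adj_mat (M z) $$ (g i, g j)) holomorphic_on UNIV"
      using g ij by (simp add: adj_mat_def cofactor_def M_def holomorphic_on_mult)
  next
    fix z i j assume ij: "i \<in> I" "j \<in> I"
    have "(M z * adj_mat (M z)) $$ (g i, g j) = (\<Sum>k = 0..<n. A z i (h k) * adj_mat (M z) $$ (g (h k), g j))"
      using g ij adj_mat(1)[OF M, of z] unfolding times_mat_def scalar_prod_def
      by (auto simp: M_def gh intro!: sum.cong)
    also have "\<dots> = (\<Sum>l\<in>I. A z i l * adj_mat (M z) $$ (g l, g j))"
      by (rule sum_h)
    moreover have "g i = g j \<longleftrightarrow> i = j"
      using g[OF ij(1)] g[OF ij(2)] by metis
    ultimately show "(\<Sum>l\<in>I. A z i l * adj_mat (M z) $$ (g l, g j)) = (if i = j then Determinant.det (M z) else 0)"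
      unfolding adj_mat(2)[OF M] using g[OF ij(1)] g[OF ij(2)] M[of z] by (auto simp: one_mat_def)
  next
    fix z assume "Determinant.det (M z) = 0"
    then obtain v where v: "v \<in> carrier_vec n" "v \<noteq> 0\<^sub>v n" "M z *\<^sub>v v = 0\<^sub>v n"
      using det_0_iff_vec_prod_zero_field[OF M] by blast
    from v(1,2) obtain k where k: "k < n" "v $ k \<noteq> 0"
      by (auto simp: vec_eq_iff)
    have "(\<Sum>j\<in>I. A z i j * v $ g j) = 0" if i: "i \<in> I" for i
    proof -
      have "(M z *\<^sub>v v) $ g i = (\<Sum>k = 0..<n. A z i (h k) * v $ g (h k))"
        using g[OF i] v(1) by (auto simp: scalar_prod_def M_def gh intro!: sum.cong)
      then show ?thesis
        using v(3) g[OF i] sum_h[of "\<lambda>j. A z i j * v $ g j"] by simp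
    qed
    then show "\<exists>x. (\<exists>i\<in>I. x i \<noteq> 0) \<and> (\<forall>i\<in>I. (\<Sum>j\<in>I. A z i j * x j) = 0)"
      using k hI gh by (intro exI[of _ "\<lambda>i. v $ g i"]) force
  qed
qed

definition l2_norm :: "'i set \<Rightarrow> ('i \<Rightarrow> complex) \<Rightarrow> real" where
  "l2_norm I x = L2_set (\<lambda>i. cmod (x i)) I"

lemma l2_norm_nonneg [simp]: "0 \<le> l2_norm I x"
  by (simp add: l2_norm_def)

lemma l2_norm_triangle: "l2_norm I (\<lambda>i. x i + y i) \<le> l2_norm I x + l2_norm I y"
proof -
  have "l2_norm I (\<lambda>i. x i + y i) \<le> L2_set (\<lambda>i. cmod (x i) + cmod (y i)) I"
    unfolding l2_norm_def by (intro L2_set_mono norm_triangle_ineq) auto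
  also have "\<dots> \<le> l2_norm I x + l2_norm I y"
    unfolding l2_norm_def by (rule L2_set_triangle_ineq)
  finally show ?thesis .
qed

lemma l2_norm_cong: "(\<And>i. i \<in> I \<Longrightarrow> cmod (x i) = cmod (y i)) \<Longrightarrow> l2_norm I x = l2_norm I y"
  unfolding l2_norm_def by (intro L2_set_cong) auto

lemma l2_norm_mono: "(\<And>i. i \<in> I \<Longrightarrow> cmod (x i) \<le> cmod (y i)) \<Longrightarrow> l2_norm I x \<le> l2_norm I y"
  unfolding l2_norm_def by (intro L2_set_mono) auto

lemma l2_norm_scale: "0 \<le> c \<Longrightarrow> l2_norm I (\<lambda>i. of_real c * x i) = c * l2_norm I x"
  unfolding l2_norm_def by (simp add: L2_set_right_distrib norm_mult)

lemma cmod_le_l2_norm: "finite I \<Longrightarrow> i \<in> I \<Longrightarrow> cmod (x i) \<le> l2_norm I x"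
  unfolding l2_norm_def by (rule member_le_L2_set)

lemma l2_norm_unit: 
  assumes "finite I" "j \<in> I" shows "l2_norm I (\<lambda>i. if i = j then 1 else 0) = 1"
proof -
  have "(\<Sum>i\<in>I. (cmod (if i = j then 1 else 0))\<^sup>2) = (\<Sum>i\<in>I. if i = j then 1 else 0)"
    by (intro sum.cong) auto
  then show ?thesis
    using assms by (simp add: l2_norm_def L2_set_def)
qed

text \<open>
  A constant of its own, so that the simplification rules of the vector space below do not have the
  bare pattern \<open>\<lambda>i. c * v i\<close> as their left-hand side.
\<close>
definition cscale :: "complex \<Rightarrow> ('i \<Rightarrow> complex) \<Rightarrow> 'i \<Rightarrow> complex" where
  "cscale c v = (\<lambda>i. c * v i)"

lemma cscale_apply [simp]: "cscale c v i = c * v i"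
  by (simp add: cscale_def)

interpretation cfun: vector_space cscale
  by unfold_locales (simp_all add: fun_eq_iff algebra_simps)

lemma sum_fun_apply: "(\<Sum>a\<in>A. f a) x = (\<Sum>a\<in>A. f a x)"
  by (induction A rule: infinite_finite_induct) auto

lemma finite_independent_supported:
  fixes B :: "('i \<Rightarrow> complex) set"
  assumes "finite I" "cfun.independent B" "\<And>b i. b \<in> B \<Longrightarrow> i \<notin> I \<Longrightarrow> b i = 0"
  shows "finite B"
proof -
  let ?E = "(\<lambda>i k. if k = i then 1 else 0 :: complex) ` I"
  have "B \<subseteq> cfun.span ?E"
  proof
    fix b assume b: "b \<in> B"
    have "b = (\<Sum>i\<in>I. cscale (b i) (\<lambda>k. if k = i then 1 else 0))"
      using assms(1) assms(3)[OF b]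
      by (auto simp: fun_eq_iff sum_fun_apply if_distrib[of "\<lambda>c. _ * c"] cong: if_cong)
    also have "\<dots> \<in> cfun.span ?E"
      by (intro cfun.span_sum cfun.span_scale cfun.span_base) auto
    finally show "b \<in> cfun.span ?E" .
  qed
  then show ?thesis
    using cfun.independent_span_bound[of ?E B] assms by auto
qed

text \<open>
  If the columns of \<open>V\<close> are a basis of \<open>K\<close>, then \<open>P = V C\<close> for some \<open>C\<close>, because \<open>P\<close> maps into \<open>K\<close>;
  and \<open>C V = 1\<close>, because \<open>P\<close> is the identity on \<open>K\<close>. So \<open>tr P = tr (C V) = dim K\<close>.
\<close>
lemma trace_projection:
  fixes P :: "'i \<Rightarrow> 'i \<Rightarrow> complex"
  assumes fin: "finite I" and sub: "cfun.subspace K"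
    and supp: "\<And>v i. v \<in> K \<Longrightarrow> i \<notin> I \<Longrightarrow> v i = 0"
    and col: "\<And>j. j \<in> I \<Longrightarrow> (\<lambda>i. if i \<in> I then P i j else 0) \<in> K"
    and proj: "\<And>v i. v \<in> K \<Longrightarrow> i \<in> I \<Longrightarrow> (\<Sum>j\<in>I. P i j * v j) = v i"
  shows "(\<Sum>i\<in>I. P i i) = of_nat (cfun.dim K)"
proof -
  obtain B where B: "B \<subseteq> K" "cfun.independent B" "K \<subseteq> cfun.span B" "card B = cfun.dim K"
    by (rule cfun.basis_exists)
  have finB: "finite B"
    using finite_independent_supported[OF fin B(2)] supp B(1) by blast
  have "\<exists>u. (\<lambda>i. if i \<in> I then P i j else 0) = (\<Sum>b\<in>B. cscale (u b) b)" if "j \<in> I" for j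
    using col[OF that] B(3) unfolding cfun.span_finite[OF finB] by auto
  then obtain C where C: "\<And>j. j \<in> I \<Longrightarrow> (\<lambda>i. if i \<in> I then P i j else 0) = (\<Sum>b\<in>B. cscale (C j b) b)"
    by metis
  have P: "P i j = (\<Sum>b\<in>B. C j b * b i)" if "i \<in> I" "j \<in> I" for i j
    using fun_cong[OF C[OF that(2)], of i] that by (simp add: sum_fun_apply)
  have dual: "(\<Sum>j\<in>I. C j b * b0 j) = (if b = b0 then 1 else 0)" if "b \<in> B" and b0: "b0 \<in> B" for b b0
  proof -
    have eq1: "b0 i = (\<Sum>b\<in>B. (\<Sum>j\<in>I. C j b * b0 j) * b i)" for i
    proof (cases "i \<in> I")
      case True
      have "b0 i = (\<Sum>j\<in>I. P i j * b0 j)"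
        using proj[of b0 i] B(1) b0 True by auto
      also have "\<dots> = (\<Sum>j\<in>I. \<Sum>b\<in>B. C j b * b0 j * b i)"
        using True by (intro sum.cong refl) (simp add: P sum_distrib_left mult_ac)
      also have "\<dots> = (\<Sum>b\<in>B. (\<Sum>j\<in>I. C j b * b0 j) * b i)"
        unfolding sum_distrib_right by (rule sum.swap)
      finally show ?thesis .
    next
      case False
      then have "b i = 0" if "b \<in> B" for b
        using supp B(1) that by blast
      then show ?thesis
        using b0 by (simp add: sum.neutral)
    qed
    have eq2: "b0 i = (\<Sum>b\<in>B. (if b = b0 then 1 else 0) * b i)" for i
    proof -
      have "(\<Sum>b\<in>B. (if b = b0 then 1 else 0) * b i) = (\<Sum>b\<in>B. if b = b0 then b i else 0)"
        by (intro sum.cong) auto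
      then show ?thesis
        using b0 finB by simp
    qed
    have "(\<Sum>b\<in>B. ((\<Sum>j\<in>I. C j b * b0 j) - (if b = b0 then 1 else 0)) * b i) = 0" for i
      using trans[OF eq1[symmetric] eq2, of i] by (simp add: left_diff_distrib sum_subtractf)
    then have "(\<Sum>b\<in>B. cscale ((\<Sum>j\<in>I. C j b * b0 j) - (if b = b0 then 1 else 0)) b) = 0"
      by (simp add: fun_eq_iff sum_fun_apply)
    from cfun.independentD[OF B(2) finB subset_refl this that(1)] show ?thesis
      by simp
  qed
  have "(\<Sum>i\<in>I. P i i) = (\<Sum>i\<in>I. \<Sum>b\<in>B. C i b * b i)"
    by (intro sum.cong) (auto simp: P)
  also have "\<dots> = (\<Sum>b\<in>B. \<Sum>i\<in>I. C i b * b i)"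
    by (rule sum.swap)
  also have "\<dots> = of_nat (card B)"
    using dual by simp
  finally show ?thesis
    using B(4) by simp
qed

lemma bounded_family_convergent_subsequence:
  fixes f :: "nat \<Rightarrow> 'p \<Rightarrow> complex"
  assumes "finite P" and "\<And>p. p \<in> P \<Longrightarrow> bounded (range (\<lambda>n. f n p))"
  shows "\<exists>r l. strict_mono r \<and> (\<forall>p\<in>P. (\<lambda>n. f (r n) p) \<longlonglongrightarrow> l p)"
  using assms
proof (induction P)
  case empty
  show ?case by (auto intro: exI[of _ id] strict_mono_id)
next
  case (insert q P)
  then obtain r l where r: "strict_mono r" "\<And>p. p \<in> P \<Longrightarrow> (\<lambda>n. f (r n) p) \<longlonglongrightarrow> l p"
    by auto
  have "bounded (range (\<lambda>n. f (r n) q))"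
    by (rule bounded_subset[OF insert.prems[of q]]) auto
  then obtain c s where s: "strict_mono s" "((\<lambda>n. f (r n) q) \<circ> s) \<longlonglongrightarrow> c"
    using bounded_imp_convergent_subsequence[of "\<lambda>n. f (r n) q"] by metis
  have "(\<lambda>n. f (r (s n)) p) \<longlonglongrightarrow> (l(q := c)) p" if "p \<in> insert q P" for p
  proof (cases "p = q")
    case False
    then have "((\<lambda>n. f (r n) p) \<circ> s) \<longlonglongrightarrow> l p"
      using that r(2) s(1) by (intro LIMSEQ_subseq_LIMSEQ) auto
    then show ?thesis using False by (simp add: o_def)
  qed (use s(2) in \<open>simp add: o_def\<close>)
  then have "\<forall>p\<in>insert q P. (\<lambda>n. f (r (s n)) p) \<longlonglongrightarrow> (l(q := c)) p"
    by blast
  moreover have "strict_mono (\<lambda>n. r (s n))"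
    using strict_mono_o[OF r(1) s(1)] by (simp add: o_def)
  ultimately show ?case
    by (intro exI conjI)
qed

section \<open>Meromorphic functions with real poles\<close>

text \<open>
  A pole at a real point would make the reciprocal vanish there to first order at least, so the
  quotient would be at least of order \<open>1 / y\<close> at height \<open>y\<close>; the assumption excludes this along a sequence.
\<close>
lemma holomorphic_quotient_extends:
  fixes N \<delta> :: "complex \<Rightarrow> complex"
  assumes N: "N holomorphic_on UNIV" and \<delta>: "\<delta> holomorphic_on UNIV"
    and nz: "\<And>z. Im z \<noteq> 0 \<Longrightarrow> \<delta> z \<noteq> 0"
    and no_pole: "\<And>k :: real. \<exists>y. (\<forall>n. y n > 0) \<and> y \<longlonglongrightarrow> 0 \<and>
      (\<lambda>n. of_real (y n) * (N (Complex k (y n)) / \<delta> (Complex k (y n)))) \<longlonglongrightarrow> 0"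
  obtains H where "H holomorphic_on UNIV" "\<And>z. Im z \<noteq> 0 \<Longrightarrow> H z = N z / \<delta> z"
proof -
  define f where "f z = N z / \<delta> z" for z
  have ana: "N analytic_on {z}" "\<delta> analytic_on {z}" for z
    using N \<delta> by (auto intro: holomorphic_on_imp_analytic_at)
  have f_ana: "f analytic_on {z}" if "Im z \<noteq> 0" for z
    unfolding f_def using ana nz[OF that] by (intro analytic_intros) auto
  have "remove_sings f analytic_on {z}" for z
  proof (cases "Im z = 0")
    case False
    then show ?thesis
      using f_ana remove_sings_analytic_on by blast
  next
    case True
    have iso: "isolated_singularity_at f z"
      unfolding f_def
      by (intro singularity_intros isolated_singularity_at_analytic ana not_essential_analytic)
    have ess: "not_essential f z"
      unfolding f_def
      by (intro singularity_intros isolated_singularity_at_analytic ana not_essential_analytic)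
    obtain y where y: "\<And>n. y n > 0" "y \<longlonglongrightarrow> 0"
      "(\<lambda>n. of_real (y n) * f (Complex (Re z) (y n))) \<longlonglongrightarrow> 0"
      using no_pole[of "Re z"] unfolding f_def by blast
    define w where "w n = Complex (Re z) (y n)" for n
    have w_eq: "w n = z + \<i> * of_real (y n)" for n
      using True by (simp add: w_def complex_eq_iff)
    have w: "w \<longlonglongrightarrow> z"
      unfolding w_eq using y(2) by (auto intro!: tendsto_eq_intros)
    have w_ne: "w n \<noteq> z" for n
      using y(1)[of n] by (simp add: w_eq)
    have w_filt: "filterlim w (at z) sequentially"
      using w w_ne by (auto simp: filterlim_at)
    have "\<not> is_pole f z"
    proof
      assume pole: "is_pole f z"
      \<comment> \<open>\<open>1/f\<close> extends to an analytic function vanishing at \<open>z\<close>, so it is \<open>O(y)\<close> above \<open>z\<close>.\<close>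
      define g where "g u = (if u = z then 0 else inverse (f u))" for u
      have nz_near: "\<forall>\<^sub>F u in at z. f u \<noteq> 0"
        using pole by (rule non_zero_neighbour_pole)
      then obtain d where d: "d > 0" "\<And>u. u \<noteq> z \<Longrightarrow> dist u z < d \<Longrightarrow> f u \<noteq> 0"
        by (auto simp: eventually_at)
      obtain r where r: "r > 0" "f analytic_on ball z r - {z}"
        using iso by (auto simp: isolated_singularity_at_def)
      have "g holomorphic_on ball z (min d r)"
        unfolding g_def
      proof (rule is_pole_inverse_holomorphic[OF _ _ pole])
        show "f holomorphic_on ball z (min d r) - {z}"
          by (rule holomorphic_on_subset[OF analytic_imp_holomorphic[OF r(2)]]) auto
        show "\<forall>u\<in>ball z (min d r) - {z}. f u \<noteq> 0"
          using d(2) by (auto simp: dist_commute)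
      qed simp
      then have "g analytic_on {z}"
        using d(1) r(1) by (intro holomorphic_on_imp_analytic_at) auto
      then have "(\<lambda>u. (g u - g z) / (u - z)) \<midarrow>z\<rightarrow> deriv g z"
        unfolding has_field_derivative_iff[symmetric] DERIV_deriv_iff_field_differentiable
        by (rule analytic_on_imp_differentiable_at) simp
      then have "(\<lambda>n. (g (w n) - g z) / (w n - z)) \<longlonglongrightarrow> deriv g z"
        by (rule filterlim_compose[OF _ w_filt])
      moreover have "(\<lambda>n. \<i> * (of_real (y n) * f (w n))) \<longlonglongrightarrow> 0"
        using tendsto_mult_left[OF y(3), of \<i>] by (simp add: w_def)
      ultimately have lim: "(\<lambda>n. (g (w n) - g z) / (w n - z) * (\<i> * (of_real (y n) * f (w n)))) \<longlonglongrightarrow> deriv g z * 0"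
        by (rule tendsto_mult)
      have "\<forall>\<^sub>F n in sequentially. f (w n) \<noteq> 0"
        using nz_near w_filt by (rule eventually_compose_filterlim)
      then have "\<forall>\<^sub>F n in sequentially. (g (w n) - g z) / (w n - z) * (\<i> * (of_real (y n) * f (w n))) = 1"
      proof eventually_elim
        case (elim n)
        then show ?case
          using w_ne[of n] y(1)[of n] by (simp add: g_def) (simp add: w_eq field_simps)
      qed
      from Lim_transform_eventually[OF lim this] show False
        by (simp add: LIMSEQ_const_iff)
    qed
    then obtain c where "f \<midarrow>z\<rightarrow> c"
      using ess by (auto simp: not_essential_def)
    with iso show ?thesis
      by (rule remove_sings_analytic_at)
  qed
  then have "remove_sings f holomorphic_on UNIV"
    using analytic_on_analytic_at analytic_imp_holomorphic by blast
  moreover have "remove_sings f z = N z / \<delta> z" if "Im z \<noteq> 0" for z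
    using remove_sings_at_analytic[OF f_ana[OF that]] by (simp add: f_def)
  ultimately show thesis
    by (rule that)
qed

text \<open>
  The bound is useless near the real axis. On the circle of radius \<open>\<rho>\<close> the factor \<open>z\<^sup>2 - \<rho>\<^sup>2\<close> has modulus
  \<open>2 \<rho> \<bar>Im z\<bar>\<close> and compensates for it; the maximum principle does the rest.
\<close>
lemma entire_bounded_off_real_axis:
  fixes H :: "complex \<Rightarrow> complex"
  assumes H: "H holomorphic_on UNIV"
    and bound: "\<And>z. Im z \<noteq> 0 \<Longrightarrow> cmod (H z) \<le> C * cmod z * (1 + 1 / \<bar>Im z\<bar>)"
    and "C \<ge> 0" "\<rho> \<ge> 1" and z: "cmod z \<le> \<rho> / 2"
  shows "cmod (H z) \<le> 6 * C * \<rho>"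
proof -
  define F where "F u = H u * (u\<^sup>2 - of_real (\<rho>\<^sup>2))" for u
  have circle: "cmod (F u) \<le> 2 * C * \<rho>\<^sup>2 * (\<rho> + 1)" if u: "cmod u = \<rho>" for u
  proof -
    have sq: "(Re u)\<^sup>2 + (Im u)\<^sup>2 = \<rho>\<^sup>2"
      using u cmod_power2[of u] by simp
    have eq: "u\<^sup>2 - of_real (\<rho>\<^sup>2) = 2 * \<i> * of_real (Im u) * u"
      unfolding sq[symmetric] by (simp add: complex_eq_iff power2_eq_square algebra_simps)
    have n: "cmod (F u) = cmod (H u) * (2 * \<bar>Im u\<bar> * \<rho>)"
      unfolding F_def eq using u by (simp add: norm_mult)
    show ?thesis
    proof (cases "Im u = 0")
      case True
      then show ?thesis unfolding n using \<open>C \<ge> 0\<close> \<open>\<rho> \<ge> 1\<close> by simp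
    next
      case False
      have "cmod (F u) \<le> C * \<rho> * (1 + 1 / \<bar>Im u\<bar>) * (2 * \<bar>Im u\<bar> * \<rho>)"
        unfolding n using bound[OF False] u \<open>\<rho> \<ge> 1\<close> by (intro mult_right_mono) auto
      also have "\<dots> = 2 * C * \<rho>\<^sup>2 * (\<bar>Im u\<bar> + 1)"
        using False by (simp add: field_simps power2_eq_square)
      also have "\<dots> \<le> 2 * C * \<rho>\<^sup>2 * (\<rho> + 1)"
        using abs_Im_le_cmod[of u] u \<open>C \<ge> 0\<close> by (intro mult_left_mono) auto
      finally show ?thesis .
    qed
  qed
  have F: "F holomorphic_on UNIV"
    unfolding F_def by (intro holomorphic_intros H)
  have le: "cmod (F z) \<le> 2 * C * \<rho>\<^sup>2 * (\<rho> + 1)"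
  proof (rule maximum_modulus_frontier[of F "ball 0 \<rho>"])
    show "F holomorphic_on interior (ball 0 \<rho>)"
      using F holomorphic_on_subset by blast
    show "continuous_on (closure (ball 0 \<rho>)) F"
      using F holomorphic_on_imp_continuous_on continuous_on_subset by blast
    show "cmod (F u) \<le> 2 * C * \<rho>\<^sup>2 * (\<rho> + 1)" if "u \<in> frontier (ball 0 \<rho>)" for u
      using that \<open>\<rho> \<ge> 1\<close> circle by simp
    show "z \<in> ball 0 \<rho>"
      using z \<open>\<rho> \<ge> 1\<close> by simp
  qed simp
  have "(cmod z)\<^sup>2 \<le> (\<rho> / 2)\<^sup>2"
    using z by (intro power_mono) auto
  moreover have "\<rho>\<^sup>2 - (cmod z)\<^sup>2 \<le> cmod (z\<^sup>2 - of_real (\<rho>\<^sup>2))"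
    using norm_triangle_ineq2[of "of_real (\<rho>\<^sup>2)" "z\<^sup>2"] by (simp add: norm_power norm_minus_commute)
  ultimately have "3 / 4 * \<rho>\<^sup>2 \<le> cmod (z\<^sup>2 - of_real (\<rho>\<^sup>2))"
    by (simp add: power_divide)
  then have "cmod (H z) * (3 / 4 * \<rho>\<^sup>2) \<le> cmod (F z)"
    unfolding F_def norm_mult by (intro mult_left_mono) auto
  also note le
  also have "2 * C * \<rho>\<^sup>2 * (\<rho> + 1) \<le> 2 * C * \<rho>\<^sup>2 * (2 * \<rho>)"
    using \<open>C \<ge> 0\<close> \<open>\<rho> \<ge> 1\<close> by (intro mult_left_mono) auto
  finally have "cmod (H z) * (3 / 4) \<le> 4 * C * \<rho>"
    using \<open>\<rho> \<ge> 1\<close> by (simp add: field_simps)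
  then show ?thesis
    using mult_nonneg_nonneg[OF \<open>C \<ge> 0\<close>, of \<rho>] \<open>\<rho> \<ge> 1\<close> by (simp add: mult.assoc)
qed

text \<open>
  The function \<open>z h z\<close> extends to an entire function of linear growth, that is, to an affine function, and
  it tends to zero along the imaginary axis.
\<close>
lemma meromorphic_eq_0_of_growth:
  fixes h N \<delta> :: "complex \<Rightarrow> complex"
  assumes N: "N holomorphic_on UNIV" and \<delta>: "\<delta> holomorphic_on UNIV"
    and nz: "\<And>z. Im z \<noteq> 0 \<Longrightarrow> \<delta> z \<noteq> 0"
    and h: "\<And>z. Im z \<noteq> 0 \<Longrightarrow> h z = N z / \<delta> z"
    and "C \<ge> 0" and bound: "\<And>z. Im z \<noteq> 0 \<Longrightarrow> cmod (h z) \<le> C * (1 + 1 / \<bar>Im z\<bar>)"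
    and no_pole: "\<And>k :: real. k \<noteq> 0 \<Longrightarrow> \<exists>y. (\<forall>n. y n > 0) \<and> y \<longlonglongrightarrow> 0 \<and>
      (\<lambda>n. of_real (y n) * h (Complex k (y n))) \<longlonglongrightarrow> 0"
    and decay: "(\<lambda>n. of_nat n * h (Complex 0 (of_nat n))) \<longlonglongrightarrow> 0"
    and z: "Im z \<noteq> 0"
  shows "h z = 0"
proof -
  \<comment> \<open>at the origin the factor \<open>z\<close> cancels a possible simple pole\<close>
  have ext: "\<exists>y. (\<forall>n. y n > 0) \<and> y \<longlonglongrightarrow> 0 \<and>
      (\<lambda>n. of_real (y n) * (Complex k (y n) * N (Complex k (y n)) / \<delta> (Complex k (y n)))) \<longlonglongrightarrow> 0" for k
  proof (cases "k = 0")
    case False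
    then obtain y where y: "\<And>n. y n > 0" "y \<longlonglongrightarrow> 0" "(\<lambda>n. of_real (y n) * h (Complex k (y n))) \<longlonglongrightarrow> 0"
      using no_pole by blast
    have "(\<lambda>n. Complex k (y n)) \<longlonglongrightarrow> Complex k 0"
      by (intro tendsto_intros y)
    from tendsto_mult[OF this y(3)]
    have "(\<lambda>n. of_real (y n) * (Complex k (y n) * h (Complex k (y n)))) \<longlonglongrightarrow> 0"
      by (simp add: mult_ac)
    moreover have "Complex k (y n) * h (Complex k (y n)) = Complex k (y n) * N (Complex k (y n)) / \<delta> (Complex k (y n))" for n
      using h[of "Complex k (y n)"] y(1)[of n] by simp
    ultimately show ?thesis
      using y(1,2) by (intro exI[of _ y] conjI allI) simp_all
  next
    case True
    define y :: "nat \<Rightarrow> real" where "y n = inverse (of_nat (Suc n))" for n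
    have y: "\<And>n. y n > 0" "y \<longlonglongrightarrow> 0"
      unfolding y_def using LIMSEQ_inverse_real_of_nat by auto
    have "(\<lambda>n. C * (y n * (y n + 1))) \<longlonglongrightarrow> C * (0 * (0 + 1))"
      by (intro tendsto_intros y)
    then have lim: "(\<lambda>n. C * (y n * (y n + 1))) \<longlonglongrightarrow> 0"
      by simp
    have "(\<lambda>n. of_real (y n) * (Complex k (y n) * N (Complex k (y n)) / \<delta> (Complex k (y n)))) \<longlonglongrightarrow> 0"
    proof (rule Lim_null_comparison[OF _ lim], rule always_eventually, rule allI)
      fix n
      have "cmod (Complex 0 (y n)) = y n"
        using y(1)[of n] by (simp add: cmod_def)
      moreover have "cmod (h (Complex 0 (y n))) \<le> C * (1 + 1 / y n)"
        using bound[of "Complex 0 (y n)"] y(1)[of n] by simp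
      then have "y n * (y n * cmod (h (Complex 0 (y n)))) \<le> y n * (y n * (C * (1 + 1 / y n)))"
        using y(1)[of n] by (intro mult_left_mono) auto
      moreover have "y n * (y n * (C * (1 + 1 / y n))) = C * (y n * (y n + 1))"
        using y(1)[of n] by (simp add: field_simps)
      ultimately show "cmod (of_real (y n) * (Complex k (y n) * N (Complex k (y n)) / \<delta> (Complex k (y n)))) \<le> C * (y n * (y n + 1))"
        using h[of "Complex 0 (y n)"] y(1)[of n] True by (simp add: norm_mult norm_divide)
    qed
    with y show ?thesis by (intro exI[of _ y] conjI allI) simp_all
  qed
  have "(\<lambda>z. z * N z) holomorphic_on UNIV"
    by (intro holomorphic_intros N)
  from holomorphic_quotient_extends[OF this \<delta> nz ext]
  obtain H where H: "H holomorphic_on UNIV" and "\<And>z. Im z \<noteq> 0 \<Longrightarrow> H z = z * N z / \<delta> z"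
    by metis
  then have Heq: "H z = z * h z" if "Im z \<noteq> 0" for z
    using h[OF that] that by simp
  have Hb: "cmod (H z) \<le> C * cmod z * (1 + 1 / \<bar>Im z\<bar>)" if "Im z \<noteq> 0" for z
    using mult_left_mono[OF bound[OF that], of "cmod z"] Heq[OF that] by (simp add: norm_mult mult_ac)
  have growth: "cmod (H z) \<le> (12 * C) * cmod z ^ 1" if "1 \<le> cmod z" for z
    using entire_bounded_off_real_axis[OF H Hb \<open>C \<ge> 0\<close>, of "2 * cmod z" z] that by simp
  have affine: "H u = H 0 + deriv H 0 * u" for u
    using Liouville_polynomial[OF H growth, where \<xi> = u] by simp
  have lim: "(\<lambda>n. H (Complex 0 (of_nat n))) \<longlonglongrightarrow> 0"
  proof -
    have "(\<lambda>n. \<i> * (of_nat n * h (Complex 0 (of_nat n)))) \<longlonglongrightarrow> \<i> * 0"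
      by (intro tendsto_intros decay)
    moreover have "\<forall>\<^sub>F n in sequentially. \<i> * (of_nat n * h (Complex 0 (of_nat n))) = H (Complex 0 (of_nat n))"
      using eventually_gt_at_top[of 0]
    proof eventually_elim
      case (elim n)
      have "Complex 0 (of_nat n) = \<i> * of_nat n"
        by (simp add: complex_eq_iff)
      with elim show ?case
        using Heq[of "Complex 0 (of_nat n)"] by simp
    qed
    ultimately have "(\<lambda>n. H (Complex 0 (of_nat n))) \<longlonglongrightarrow> \<i> * 0"
      by (rule Lim_transform_eventually)
    then show ?thesis by simp
  qed
  have "(\<lambda>n. H (Complex 0 (of_nat (Suc n))) - H (Complex 0 (of_nat n))) \<longlonglongrightarrow> 0 - 0"
    by (intro tendsto_diff lim LIMSEQ_Suc[OF lim])
  moreover have "H (Complex 0 (of_nat (Suc n))) - H (Complex 0 (of_nat n)) = deriv H 0 * \<i>" for n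
    unfolding affine[of "Complex 0 _"] by (simp add: complex_eq_iff algebra_simps)
  ultimately have "deriv H 0 = 0"
    by (simp add: LIMSEQ_const_iff)
  then have const: "H u = H 0" for u
    using affine[of u] by simp
  have "(\<lambda>n::nat. H 0) \<longlonglongrightarrow> 0"
    using lim unfolding const[of "Complex _ _"] .
  then have "H 0 = 0"
    by (simp add: LIMSEQ_const_iff)
  then have "z * h z = 0"
    by (rule trans[OF trans[OF Heq[OF z, symmetric] const]])
  moreover have "z \<noteq> 0"
    using z by (metis complex_eq_iff zero_complex.simps(2))
  ultimately show ?thesis
    by (metis mult_eq_0_iff)
qed

section \<open>Scattering matrices\<close>

lemma nat_times_exp_decay: "a > 0 \<Longrightarrow> (\<lambda>n. real n * exp (- (real n * a))) \<longlonglongrightarrow> 0" for a :: real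
  by real_asymp

lemma exp_difference_quotient: "((\<lambda>t. (1 - exp (- (t * a))) / t) \<longlongrightarrow> a) (at_right 0)" for a :: real
  by real_asymp

text \<open>
  Waves on finitely many directed bonds: a wave of wave number \<open>z\<close> gains the factor \<open>propagation z j\<close> along
  the bond \<open>j\<close> and is then scattered into the bonds \<open>i\<close> with the amplitudes \<open>S i j\<close>. The isometry of \<open>S\<close> is
  the conservation of the current.
\<close>
locale scattering =
  fixes I :: "'i set" and S :: "'i \<Rightarrow> 'i \<Rightarrow> complex" and len phase :: "'i \<Rightarrow> real"
  assumes finite_I: "finite I"
    and len_pos: "i \<in> I \<Longrightarrow> 0 < len i"
    and isometry: "l2_norm I (\<lambda>i. \<Sum>j\<in>I. S i j * x j) = l2_norm I x"
begin

definition propagation :: "complex \<Rightarrow> 'i \<Rightarrow> complex" where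
  "propagation z j = exp (\<i> * (z * of_real (len j) + of_real (phase j)))"

definition U :: "complex \<Rightarrow> 'i \<Rightarrow> 'i \<Rightarrow> complex" where
  "U z i j = S i j * propagation z j"

text \<open>
  The number \<open>1\<close> keeps the minimum meaningful if there are no bonds.
\<close>
definition min_len :: real where
  "min_len = Min (insert 1 (len ` I))"

lemma min_len_pos: "0 < min_len"
  using finite_I len_pos by (auto simp: min_len_def)

lemma min_len_le: "i \<in> I \<Longrightarrow> min_len \<le> len i"
  using finite_I by (auto simp: min_len_def)

lemma cmod_propagation: "cmod (propagation z j) = exp (- (Im z * len j))"
  by (simp add: propagation_def algebra_simps)

lemma l2_norm_U: "l2_norm I (\<lambda>i. \<Sum>j\<in>I. U z i j * x j) = l2_norm I (\<lambda>j. propagation z j * x j)"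
  using isometry[of "\<lambda>j. propagation z j * x j"] by (simp add: U_def mult_ac)

lemma U_contracts:
  assumes "Im z \<ge> 0"
  shows "l2_norm I (\<lambda>i. \<Sum>j\<in>I. U z i j * x j) \<le> exp (- (Im z * min_len)) * l2_norm I x"
proof -
  have "l2_norm I (\<lambda>j. propagation z j * x j) \<le> l2_norm I (\<lambda>j. of_real (exp (- (Im z * min_len))) * x j)"
  proof (rule l2_norm_mono)
    fix i assume "i \<in> I"
    then have "Im z * min_len \<le> Im z * len i"
      using assms min_len_le by (intro mult_left_mono) auto
    then show "cmod (propagation z i * x i) \<le> cmod (of_real (exp (- (Im z * min_len))) * x i)"
      by (simp add: norm_mult cmod_propagation mult_right_mono)
  qed
  then show ?thesis
    by (simp add: l2_norm_U l2_norm_scale)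
qed

lemma U_expands:
  assumes "Im z \<le> 0"
  shows "exp (- (Im z * min_len)) * l2_norm I x \<le> l2_norm I (\<lambda>i. \<Sum>j\<in>I. U z i j * x j)"
proof -
  have "l2_norm I (\<lambda>j. of_real (exp (- (Im z * min_len))) * x j) \<le> l2_norm I (\<lambda>j. propagation z j * x j)"
  proof (rule l2_norm_mono)
    fix i assume "i \<in> I"
    then have "Im z * len i \<le> Im z * min_len"
      using assms min_len_le by (intro mult_left_mono_neg) auto
    then show "cmod (of_real (exp (- (Im z * min_len))) * x i) \<le> cmod (propagation z i * x i)"
      by (simp add: norm_mult cmod_propagation mult_right_mono)
  qed
  then show ?thesis
    by (simp add: l2_norm_U l2_norm_scale)
qed

definition inv_bound :: "real \<Rightarrow> real" where
  "inv_bound y = 1 + 1 / (min_len * \<bar>y\<bar>)"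

text \<open>
  Above the real axis \<open>U\<close> is a contraction and below it \<open>U\<close> is expanding, in both cases by the factor
  \<open>exp (- Im z * min_len)\<close> at least, so \<open>1 - U\<close> is bounded below.
\<close>
lemma inverse_bound:
  assumes z: "Im z \<noteq> 0"
    and w: "\<And>i. i \<in> I \<Longrightarrow> w i = x i - (\<Sum>j\<in>I. U z i j * x j)"
  shows "l2_norm I x \<le> inv_bound (Im z) * l2_norm I w"
proof -
  define u where "u = (\<lambda>i. \<Sum>j\<in>I. U z i j * x j)"
  define t where "t = min_len * \<bar>Im z\<bar>"
  have t: "t > 0"
    using min_len_pos z by (simp add: t_def)
  show ?thesis
  proof (cases "Im z > 0")
    case True
    have "l2_norm I x \<le> l2_norm I w + l2_norm I u"
      using l2_norm_triangle[of I w u] by (simp add: w u_def cong: l2_norm_cong)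
    moreover have "l2_norm I u \<le> exp (- t) * l2_norm I x"
      using U_contracts[of z x, folded u_def] True by (simp add: t_def mult.commute)
    ultimately have le: "(1 - exp (- t)) * l2_norm I x \<le> l2_norm I w"
      by (simp add: algebra_simps)
    have "1 + t \<le> exp t"
      by (rule exp_ge_add_one_self)
    then have "1 \<le> (1 + 1 / t) * (1 - exp (- t))"
      using t by (simp add: field_simps exp_minus)
    then have "1 * l2_norm I x \<le> ((1 + 1 / t) * (1 - exp (- t))) * l2_norm I x"
      by (intro mult_right_mono) auto
    also have "\<dots> \<le> (1 + 1 / t) * l2_norm I w"
      using le t by (simp add: mult.assoc mult_left_mono)
    finally show ?thesis
      by (simp add: inv_bound_def t_def)
  next
    case False
    have "l2_norm I u \<le> l2_norm I x + l2_norm I (\<lambda>i. - w i)"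
      using l2_norm_triangle[of I x "\<lambda>i. - w i"] by (simp add: w u_def cong: l2_norm_cong)
    moreover have "l2_norm I (\<lambda>i. - w i) = l2_norm I w"
      by (rule l2_norm_cong) simp
    moreover have "exp t * l2_norm I x \<le> l2_norm I u"
      using U_expands[of z x, folded u_def] False by (simp add: t_def mult.commute)
    moreover have "(1 + t) * l2_norm I x \<le> exp t * l2_norm I x"
      by (intro mult_right_mono exp_ge_add_one_self) auto
    ultimately have "t * l2_norm I x \<le> l2_norm I w"
      by (simp add: algebra_simps)
    then have "l2_norm I x \<le> 1 / t * l2_norm I w"
      using t by (simp add: field_simps)
    also have "\<dots> \<le> (1 + 1 / t) * l2_norm I w"
      by (intro mult_right_mono) auto
    finally show ?thesis
      by (simp add: inv_bound_def t_def)
  qed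
qed

lemma sum_one_minus_U:
  "i \<in> I \<Longrightarrow> (\<Sum>j\<in>I. ((if i = j then 1 else 0) - U z i j) * x j) = x i - (\<Sum>j\<in>I. U z i j * x j)"
  using finite_I by (simp add: left_diff_distrib sum_subtractf if_distrib[of "\<lambda>c. c * _"] cong: if_cong)

text \<open>
  The inverse of \<open>1 - U z\<close>, which exists for nonreal \<open>z\<close>.
\<close>
definition green :: "complex \<Rightarrow> 'i \<Rightarrow> 'i \<Rightarrow> complex" where
  "green z = (SOME Y. \<forall>i\<in>I. \<forall>j\<in>I. Y i j - (\<Sum>l\<in>I. U z i l * Y l j) = (if i = j then 1 else 0))"

text \<open>
  The diagonal entries of \<open>(1 - U)\<^sup>-\<^sup>1 U = (1 - U)\<^sup>-\<^sup>1 - 1\<close>, weighted with the lengths. Since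
  \<open>U' = \<i> U \<L>\<close> with the diagonal matrix \<open>\<L>\<close> of the lengths, this is \<open>\<i>\<close> times the logarithmic
  derivative of \<open>det (1 - U z)\<close>.
\<close>
definition resolvent_trace :: "complex \<Rightarrow> complex" where
  "resolvent_trace z = (\<Sum>i\<in>I. of_real (len i) * (green z i i - 1))"

lemma U_holomorphic: "(\<lambda>z. U z i j) holomorphic_on UNIV"
  unfolding U_def propagation_def by (intro holomorphic_intros)

lemma unique_solution:
  assumes z: "Im z \<noteq> 0" and "i \<in> I"
    and "\<And>i. i \<in> I \<Longrightarrow> x i - (\<Sum>j\<in>I. U z i j * x j) = y i - (\<Sum>j\<in>I. U z i j * y j)"
  shows "x i = y i"
proof -
  have "l2_norm I (\<lambda>i. x i - y i) \<le> inv_bound (Im z) * l2_norm I (\<lambda>i. 0)"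
  proof (rule inverse_bound[OF z])
    fix i assume "i \<in> I"
    from assms(3)[OF this] show "0 = x i - y i - (\<Sum>j\<in>I. U z i j * (x j - y j))"
      by (simp add: algebra_simps sum_subtractf)
  qed
  also have "l2_norm I (\<lambda>i. 0) = 0"
    by (simp add: l2_norm_def L2_set_def)
  finally have "l2_norm I (\<lambda>i. x i - y i) \<le> 0"
    by simp
  from order_trans[OF cmod_le_l2_norm[OF finite_I assms(2), of "\<lambda>i. x i - y i"] this]
  show ?thesis
    by simp
qed

lemma resolvent_entries_meromorphic:
  "\<exists>\<delta> adj. \<delta> holomorphic_on UNIV \<and>
    (\<forall>i\<in>I. \<forall>j\<in>I. (\<lambda>z. adj z i j) holomorphic_on UNIV) \<and>
    (\<forall>z. Im z \<noteq> 0 \<longrightarrow> \<delta> z \<noteq> 0) \<and>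
    (\<forall>z. Im z \<noteq> 0 \<longrightarrow> (\<forall>i\<in>I. \<forall>j\<in>I.
      adj z i j / \<delta> z - (\<Sum>l\<in>I. U z i l * (adj z l j / \<delta> z)) = (if i = j then 1 else 0)))"
proof -
  define A where "A z i j = (if i = j then 1 else 0) - U z i j" for z i j
  have hol: "(\<lambda>z. A z i j) holomorphic_on UNIV" for i j
    unfolding A_def by (intro holomorphic_intros U_holomorphic)
  have A: "(\<Sum>j\<in>I. A z i j * x j) = x i - (\<Sum>j\<in>I. U z i j * x j)" if "i \<in> I" for z i x
    unfolding A_def by (rule sum_one_minus_U[OF that])
  from holomorphic_adjugate[of I A, OF finite_I hol]
  obtain \<delta> adj where *: "\<delta> holomorphic_on UNIV"
    "\<forall>i\<in>I. \<forall>j\<in>I. (\<lambda>z. adj z i j) holomorphic_on UNIV"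
    "\<forall>z. \<forall>i\<in>I. \<forall>j\<in>I. (\<Sum>l\<in>I. A z i l * adj z l j) = (if i = j then \<delta> z else 0)"
    "\<forall>z. \<delta> z = 0 \<longrightarrow> (\<exists>x. (\<exists>i\<in>I. x i \<noteq> 0) \<and> (\<forall>i\<in>I. (\<Sum>j\<in>I. A z i j * x j) = 0))"
    by (elim exE conjE) (rule that)
  have nz: "\<delta> z \<noteq> 0" if z: "Im z \<noteq> 0" for z
  proof
    assume "\<delta> z = 0"
    with *(4) have "\<exists>x. (\<exists>i\<in>I. x i \<noteq> 0) \<and> (\<forall>i\<in>I. (\<Sum>j\<in>I. A z i j * x j) = 0)"
      by (elim allE impE)
    then obtain x i where i: "i \<in> I" "x i \<noteq> 0" and x: "\<And>i. i \<in> I \<Longrightarrow> (\<Sum>j\<in>I. A z i j * x j) = 0"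
      by auto
    have "x i = 0"
      using unique_solution[OF z i(1), of x "\<lambda>_. 0"] x A by simp
    with i(2) show False by simp
  qed
  have "adj z i j / \<delta> z - (\<Sum>l\<in>I. U z i l * (adj z l j / \<delta> z)) = (if i = j then 1 else 0)"
    if z: "Im z \<noteq> 0" and ij: "i \<in> I" "j \<in> I" for z i j
  proof -
    have "(\<Sum>l\<in>I. A z i l * adj z l j) = (if i = j then \<delta> z else 0)"
      using *(3) ij by simp
    then have "adj z i j - (\<Sum>l\<in>I. U z i l * adj z l j) = (if i = j then \<delta> z else 0)"
      using A[OF ij(1)] by simp
    then have "(adj z i j - (\<Sum>l\<in>I. U z i l * adj z l j)) / \<delta> z = (if i = j then 1 else 0)"
      using nz[OF z] by simp
    then show ?thesis
      by (simp add: diff_divide_distrib sum_divide_distrib)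
  qed
  with * nz show ?thesis
    by (intro exI[of _ \<delta>] exI[of _ adj] conjI allI ballI impI) blast+
qed

lemma green:
  assumes "Im z \<noteq> 0" "i \<in> I" "j \<in> I"
  shows "green z i j - (\<Sum>l\<in>I. U z i l * green z l j) = (if i = j then 1 else 0)"
proof -
  from resolvent_entries_meromorphic
  obtain \<delta> adj where "\<forall>z. Im z \<noteq> 0 \<longrightarrow> (\<forall>i\<in>I. \<forall>j\<in>I.
      adj z i j / \<delta> z - (\<Sum>l\<in>I. U z i l * (adj z l j / \<delta> z)) = (if i = j then 1 else 0))"
    by (elim exE conjE) (rule that)
  then have "\<forall>i\<in>I. \<forall>j\<in>I. adj z i j / \<delta> z - (\<Sum>l\<in>I. U z i l * (adj z l j / \<delta> z)) = (if i = j then 1 else 0)"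
    using assms(1) by simp
  from someI[of "\<lambda>Y. \<forall>i\<in>I. \<forall>j\<in>I. Y i j - (\<Sum>l\<in>I. U z i l * Y l j) = (if i = j then 1 else 0)"
      "\<lambda>i j. adj z i j / \<delta> z", OF this]
  show ?thesis
    using assms unfolding green_def by simp
qed

lemma green_solves:
  assumes z: "Im z \<noteq> 0" and i: "i \<in> I"
    and w: "\<And>i. i \<in> I \<Longrightarrow> x i - (\<Sum>j\<in>I. U z i j * x j) = w i"
  shows "x i = (\<Sum>j\<in>I. green z i j * w j)"
proof (rule unique_solution[OF z i])
  fix i assume i: "i \<in> I"
  have "(\<Sum>j\<in>I. green z i j * w j) - (\<Sum>l\<in>I. U z i l * (\<Sum>j\<in>I. green z l j * w j)) =
      (\<Sum>j\<in>I. (green z i j - (\<Sum>l\<in>I. U z i l * green z l j)) * w j)"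
    unfolding sum_distrib_left by (subst sum.swap) 
      (simp add: left_diff_distrib sum_subtractf sum_distrib_right mult.assoc)
  also have "\<dots> = (\<Sum>j\<in>I. if i = j then w j else 0)"
    using green[OF z i] by (intro sum.cong) auto
  also have "\<dots> = w i"
    using i finite_I by simp
  finally show "x i - (\<Sum>j\<in>I. U z i j * x j) =
      (\<Sum>j\<in>I. green z i j * w j) - (\<Sum>l\<in>I. U z i l * (\<Sum>j\<in>I. green z l j * w j))"
    using w[OF i] by simp
qed

lemma green_left_inverse:
  assumes z: "Im z \<noteq> 0" and i: "i \<in> I" and m: "m \<in> I"
  shows "green z i m - (\<Sum>j\<in>I. green z i j * U z j m) = (if i = m then 1 else 0)"
proof -
  have eq: "(if i = m then 1 else 0) = (\<Sum>j\<in>I. green z i j * ((if j = m then 1 else 0) - U z j m))"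
  proof (rule green_solves[OF z i, where x = "\<lambda>i. if i = m then 1 else 0"])
    fix i assume "i \<in> I"
    show "(if i = m then 1 else 0) - (\<Sum>j\<in>I. U z i j * (if j = m then 1 else 0)) = (if i = m then 1 else 0) - U z i m"
      using m finite_I by (simp add: if_distrib[of "\<lambda>c. _ * c"] cong: if_cong)
  qed
  show ?thesis
    unfolding eq using m finite_I
    by (simp add: right_diff_distrib sum_subtractf if_distrib[of "\<lambda>c. _ * c"] cong: if_cong)
qed

lemma green_column_norm:
  assumes z: "Im z \<noteq> 0" and j: "j \<in> I"
  shows "l2_norm I (\<lambda>i. green z i j) \<le> inv_bound (Im z)"
proof -
  have "l2_norm I (\<lambda>i. green z i j) \<le> inv_bound (Im z) * l2_norm I (\<lambda>i. if i = j then 1 else 0)"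
    using green[OF z _ j] by (intro inverse_bound[OF z]) simp
  then show ?thesis
    by (simp add: l2_norm_unit[OF finite_I j])
qed

lemma cmod_green_le: "Im z \<noteq> 0 \<Longrightarrow> i \<in> I \<Longrightarrow> j \<in> I \<Longrightarrow> cmod (green z i j) \<le> inv_bound (Im z)"
  using green_column_norm cmod_le_l2_norm[OF finite_I, of i "\<lambda>i. green z i j"] by fastforce

lemma resolvent_trace_meromorphic:
  obtains N \<delta> where "N holomorphic_on UNIV" "\<delta> holomorphic_on UNIV"
    "\<And>z. Im z \<noteq> 0 \<Longrightarrow> \<delta> z \<noteq> 0" "\<And>z. Im z \<noteq> 0 \<Longrightarrow> resolvent_trace z = N z / \<delta> z"
proof -
  from resolvent_entries_meromorphic
  obtain \<delta> adj where *: "\<delta> holomorphic_on UNIV"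
    "\<forall>i\<in>I. \<forall>j\<in>I. (\<lambda>z. adj z i j) holomorphic_on UNIV"
    "\<forall>z. Im z \<noteq> 0 \<longrightarrow> \<delta> z \<noteq> 0"
    "\<forall>z. Im z \<noteq> 0 \<longrightarrow> (\<forall>i\<in>I. \<forall>j\<in>I.
      adj z i j / \<delta> z - (\<Sum>l\<in>I. U z i l * (adj z l j / \<delta> z)) = (if i = j then 1 else 0))"
    by (elim exE conjE) (rule that)
  have "green z i i = adj z i i / \<delta> z" if z: "Im z \<noteq> 0" and i: "i \<in> I" for z i
    using unique_solution[OF z i, of "\<lambda>l. green z l i" "\<lambda>l. adj z l i / \<delta> z"] green[OF z _ i] *(4) z i
    by simp
  then have eq: "resolvent_trace z = (\<Sum>i\<in>I. of_real (len i) * (adj z i i - \<delta> z)) / \<delta> z" if "Im z \<noteq> 0" for z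
  proof -
    have nz: "\<delta> z \<noteq> 0"
      using *(3) that by blast
    show ?thesis
      unfolding resolvent_trace_def sum_divide_distrib
    proof (rule sum.cong[OF refl])
      fix i assume i: "i \<in> I"
      show "of_real (len i) * (green z i i - 1) = of_real (len i) * (adj z i i - \<delta> z) / \<delta> z"
        unfolding \<open>\<And>z i. Im z \<noteq> 0 \<Longrightarrow> i \<in> I \<Longrightarrow> green z i i = adj z i i / \<delta> z\<close>[OF that i]
        using nz by (simp add: field_simps)
    qed
  qed
  show thesis
  proof (rule that[OF _ *(1) _ eq])
    show "\<delta> z \<noteq> 0" if "Im z \<noteq> 0" for z
      using *(3) that by blast
    show "(\<lambda>z. \<Sum>i\<in>I. of_real (len i) * (adj z i i - \<delta> z)) holomorphic_on UNIV"
      using * by (intro holomorphic_intros) auto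
  qed
qed

lemma resolvent_trace_bound:
  obtains C where "C \<ge> 0" "\<And>z. Im z \<noteq> 0 \<Longrightarrow> cmod (resolvent_trace z) \<le> C * (1 + 1 / \<bar>Im z\<bar>)"
proof (rule that[of "(2 + 1 / min_len) * (\<Sum>i\<in>I. len i)"])
  have len: "0 \<le> len i" if "i \<in> I" for i
    using len_pos[OF that] by simp
  show "0 \<le> (2 + 1 / min_len) * (\<Sum>i\<in>I. len i)"
    using min_len_pos len by (intro mult_nonneg_nonneg sum_nonneg) auto
  fix z assume z: "Im z \<noteq> 0"
  have "cmod (resolvent_trace z) \<le> (\<Sum>i\<in>I. len i * ((2 + 1 / min_len) * (1 + 1 / \<bar>Im z\<bar>)))"
    unfolding resolvent_trace_def
  proof (rule sum_norm_le)
    fix i assume i: "i \<in> I"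
    have "cmod (green z i i - 1) \<le> inv_bound (Im z) + 1"
      using norm_triangle_ineq4[of "green z i i" 1] cmod_green_le[OF z i i] by simp
    also have "\<dots> \<le> (2 + 1 / min_len) * (1 + 1 / \<bar>Im z\<bar>)"
      using min_len_pos z by (simp add: inv_bound_def field_simps)
    finally show "cmod (of_real (len i) * (green z i i - 1)) \<le> len i * ((2 + 1 / min_len) * (1 + 1 / \<bar>Im z\<bar>))"
      using len[OF i] by (simp add: norm_mult mult_left_mono)
  qed
  then show "cmod (resolvent_trace z) \<le> (2 + 1 / min_len) * (\<Sum>i\<in>I. len i) * (1 + 1 / \<bar>Im z\<bar>)"
    by (simp add: sum_distrib_right[symmetric] mult_ac)
qed

lemma resolvent_trace_decay:
  "(\<lambda>n. of_nat n * resolvent_trace (Complex 0 (of_nat n))) \<longlonglongrightarrow> 0"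
proof -
  have "(\<lambda>n. of_nat n * (green (Complex 0 (of_nat n)) i i - 1)) \<longlonglongrightarrow> 0" if i: "i \<in> I" for i
  proof (rule Lim_null_comparison)
    show "\<forall>\<^sub>F n in sequentially. cmod (of_nat n * (green (Complex 0 (of_nat n)) i i - 1)) \<le>
        real n * exp (- (real n * min_len)) * (1 + 1 / min_len)"
      using eventually_gt_at_top[of 0]
    proof eventually_elim
      case (elim n)
      define z where "z = Complex 0 (of_nat n)"
      have z: "Im z = real n" "Im z \<noteq> 0"
        using elim by (auto simp: z_def)
      have eq: "green z i i - 1 = (\<Sum>l\<in>I. U z i l * green z l i)"
        using green[OF z(2) i i] by (simp add: diff_eq_eq add.commute)
      have "cmod (green z i i - 1) \<le> l2_norm I (\<lambda>k. \<Sum>l\<in>I. U z k l * green z l i)"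
        unfolding eq
        by (rule cmod_le_l2_norm[OF finite_I i, of "\<lambda>k. \<Sum>l\<in>I. U z k l * green z l i"])
      also have "\<dots> \<le> exp (- (real n * min_len)) * l2_norm I (\<lambda>l. green z l i)"
        using U_contracts[of z] z by simp
      also have "\<dots> \<le> exp (- (real n * min_len)) * inv_bound (Im z)"
        using green_column_norm[OF z(2) i] by (intro mult_left_mono) auto
      also have "inv_bound (Im z) \<le> 1 + 1 / min_len"
        using elim min_len_pos by (simp add: inv_bound_def z field_simps)
      finally show ?case
        by (simp add: norm_mult z_def mult_left_mono mult.assoc)
    qed
    have "(\<lambda>n. real n * exp (- (real n * min_len))) \<longlonglongrightarrow> 0"
      using min_len_pos by (rule nat_times_exp_decay)
    from tendsto_mult_left[OF this, of "1 + 1 / min_len"]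
    show "(\<lambda>n. real n * exp (- (real n * min_len)) * (1 + 1 / min_len)) \<longlonglongrightarrow> 0"
      by (simp add: mult_ac)
  qed
  then have "(\<lambda>n. \<Sum>i\<in>I. of_real (len i) * (of_nat n * (green (Complex 0 (of_nat n)) i i - 1))) \<longlonglongrightarrow> (\<Sum>i\<in>I. of_real (len i) * 0)"
    by (intro tendsto_intros)
  then show ?thesis
    by (simp add: resolvent_trace_def sum_distrib_left mult_ac)
qed

text \<open>
  The kernel of \<open>1 - U z\<close>. Vectors vanish off \<open>I\<close>, so that the dimension is the expected one.
\<close>
definition bound_states :: "complex \<Rightarrow> ('i \<Rightarrow> complex) set" where
  "bound_states z = {v. (\<forall>i. i \<notin> I \<longrightarrow> v i = 0) \<and> (\<forall>i\<in>I. v i = (\<Sum>j\<in>I. U z i j * v j))}"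

lemma subspace_bound_states: "cfun.subspace (bound_states z)"
  unfolding cfun.subspace_def bound_states_def
  by (auto simp: sum.distrib distrib_left sum_distrib_left mult_ac)

lemma U_above_real_axis: "U (Complex k y) i j = U (of_real k) i j * of_real (exp (- (y * len j)))"
proof -
  have "\<i> * (Complex k y * of_real (len j) + of_real (phase j)) =
      \<i> * (of_real k * of_real (len j) + of_real (phase j)) + of_real (- (y * len j))"
    by (simp add: complex_eq_iff)
  then show ?thesis
    unfolding U_def propagation_def by (simp only: exp_add exp_of_real mult.assoc)
qed

text \<open>
  Let \<open>B\<close> be a limit of \<open>y (1 - U (k + \<i> y))\<^sup>-\<^sup>1\<close> as \<open>y\<close> tends to zero; the bound on the inverse provides
  one. Passing to the limit in \<open>(1 - U) G = y\<close> and in \<open>G (1 - U) = y\<close> shows that \<open>B\<close> maps into the kernel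
  of \<open>1 - U k\<close> and that \<open>B (U k) = B\<close>. A vector \<open>v\<close> of this kernel satisfies
  \<open>(1 - U (k + \<i> y)) v = y (U k) \<L> v + o(y)\<close>, where \<open>\<L>\<close> is the diagonal matrix of the lengths, hence
  \<open>v = B (U k) \<L> v = B \<L> v\<close>. So \<open>B \<L>\<close> is a projection onto the kernel, and its trace is the limit in
  question.
\<close>
lemma resolvent_trace_near_real_axis:
  assumes y: "\<And>n. y n > 0" "y \<longlonglongrightarrow> 0"
  shows "\<exists>r. strict_mono r \<and> (\<lambda>n. of_real (y (r n)) * resolvent_trace (Complex k (y (r n)))) \<longlonglongrightarrow>
    of_nat (cfun.dim (bound_states (of_real k)))"
proof -
  define G where "G n i j = of_real (y n) * green (Complex k (y n)) i j" for n i j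
  obtain Y where Y: "\<And>n. y n \<le> Y"
    using convergent_imp_bounded[OF y(2)] unfolding bounded_real
    by (metis abs_le_D1 rangeI)
  have bound: "cmod (G n i j) \<le> Y + 1 / min_len" if ij: "i \<in> I" "j \<in> I" for n i j
  proof -
    have "cmod (G n i j) \<le> y n * inv_bound (y n)"
      unfolding G_def using cmod_green_le[OF _ ij, of "Complex k (y n)"] y(1)[of n]
      by (simp add: norm_mult mult_left_mono)
    also have "\<dots> = y n + 1 / min_len"
      using y(1)[of n] min_len_pos by (simp add: inv_bound_def field_simps)
    finally show ?thesis
      using Y[of n] by simp
  qed
  have "bounded (range (\<lambda>n. G n (fst p) (snd p)))" if "p \<in> I \<times> I" for p
    unfolding bounded_iff
    using bound[of "fst p" "snd p"] that by (intro exI[of _ "Y + 1 / min_len"]) auto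
  from bounded_family_convergent_subsequence[of "I \<times> I" "\<lambda>n p. G n (fst p) (snd p)", OF _ this]
  obtain r l where r: "strict_mono r"
    and l: "\<forall>p\<in>I \<times> I. (\<lambda>n. G (r n) (fst p) (snd p)) \<longlonglongrightarrow> l p"
    using finite_I by (auto simp del: split_paired_All split_paired_Ex)
  define B where "B i j = l (i, j)" for i j
  have B: "(\<lambda>n. G (r n) i j) \<longlonglongrightarrow> B i j" if "i \<in> I" "j \<in> I" for i j
    using bspec[OF l, of "(i, j)"] that by (simp add: B_def)
  define z where "z n = Complex k (y (r n))" for n
  have z: "Im (z n) \<noteq> 0" for n
    using y(1)[of "r n"] by (simp add: z_def)
  have yr: "(\<lambda>n. y (r n)) \<longlonglongrightarrow> 0"
    using LIMSEQ_subseq_LIMSEQ[OF y(2) r] by (simp add: o_def)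
  then have yr_c: "(\<lambda>n. complex_of_real (y (r n))) \<longlonglongrightarrow> 0"
    using tendsto_of_real[OF yr] by simp
  define K where "K i j = U (of_real k) i j" for i j
  have Uz: "U (z n) i j = K i j * of_real (exp (- (y (r n) * len j)))" for n i j
    by (simp add: z_def K_def U_above_real_axis)
  have U_lim: "(\<lambda>n. U (z n) i j) \<longlonglongrightarrow> K i j" for i j
  proof -
    have "(\<lambda>n. K i j * of_real (exp (- (y (r n) * len j)))) \<longlonglongrightarrow> K i j * of_real (exp (- (0 * len j)))"
      by (intro tendsto_intros yr)
    then show ?thesis
      by (simp add: Uz)
  qed
  have quot_lim: "(\<lambda>n. (K i j - U (z n) i j) / of_real (y (r n))) \<longlonglongrightarrow> K i j * of_real (len j)" for i j
  proof -
    have at0: "((\<lambda>t. (1 - exp (- (t * len j))) / t) \<longlongrightarrow> len j) (at_right 0)"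
      by (rule exp_difference_quotient)
    have "filterlim (\<lambda>n. y (r n)) (at_right 0) sequentially"
      using yr y(1) less_imp_neq[OF y(1), symmetric] by (auto simp: filterlim_at intro!: always_eventually)
    from filterlim_compose[OF at0 this]
    have "(\<lambda>n. K i j * of_real ((1 - exp (- (y (r n) * len j))) / y (r n))) \<longlonglongrightarrow> K i j * of_real (len j)"
      by (intro tendsto_intros)
    then show ?thesis
      by (simp add: Uz algebra_simps diff_divide_distrib)
  qed
  have G_eq: "G (r n) i j - (\<Sum>l\<in>I. U (z n) i l * G (r n) l j) = of_real (y (r n)) * (if i = j then 1 else 0)"
    if "i \<in> I" "j \<in> I" for n i j
    using arg_cong[OF green[OF z that, of n], of "\<lambda>u. of_real (y (r n)) * u"]
    unfolding G_def z_def[symmetric] right_diff_distrib sum_distrib_left by (simp only: mult_ac)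
  have G_eq': "G (r n) i j - (\<Sum>l\<in>I. G (r n) i l * U (z n) l j) = of_real (y (r n)) * (if i = j then 1 else 0)"
    if "i \<in> I" "j \<in> I" for n i j
    using arg_cong[OF green_left_inverse[OF z that, of n], of "\<lambda>u. of_real (y (r n)) * u"]
    unfolding G_def z_def[symmetric] right_diff_distrib sum_distrib_left by (simp only: mult_ac)
  \<comment> \<open>the limit of \<open>(1 - U) G = y\<close>\<close>
  have B_col: "B i j = (\<Sum>l\<in>I. K i l * B l j)" if ij: "i \<in> I" "j \<in> I" for i j
  proof -
    have "(\<lambda>n. G (r n) i j - (\<Sum>l\<in>I. U (z n) i l * G (r n) l j)) \<longlonglongrightarrow> B i j - (\<Sum>l\<in>I. K i l * B l j)"
      using ij by (intro tendsto_intros U_lim B) auto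
    moreover have "(\<lambda>n. of_real (y (r n)) * (if i = j then 1 else 0) :: complex) \<longlonglongrightarrow> 0 * (if i = j then 1 else 0)"
      by (intro tendsto_intros yr_c)
    ultimately have "B i j - (\<Sum>l\<in>I. K i l * B l j) = 0 * (if i = j then 1 else 0)"
      unfolding G_eq[OF ij] by (rule LIMSEQ_unique)
    then show ?thesis by simp
  qed
  \<comment> \<open>the limit of \<open>G (1 - U) = y\<close>\<close>
  have B_row: "B i j = (\<Sum>l\<in>I. B i l * K l j)" if ij: "i \<in> I" "j \<in> I" for i j
  proof -
    have "(\<lambda>n. G (r n) i j - (\<Sum>l\<in>I. G (r n) i l * U (z n) l j)) \<longlonglongrightarrow> B i j - (\<Sum>l\<in>I. B i l * K l j)"
      using ij by (intro tendsto_intros U_lim B) auto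
    moreover have "(\<lambda>n. of_real (y (r n)) * (if i = j then 1 else 0) :: complex) \<longlonglongrightarrow> 0 * (if i = j then 1 else 0)"
      by (intro tendsto_intros yr_c)
    ultimately have "B i j - (\<Sum>l\<in>I. B i l * K l j) = 0 * (if i = j then 1 else 0)"
      unfolding G_eq'[OF ij] by (rule LIMSEQ_unique)
    then show ?thesis by simp
  qed
  have repro: "(\<Sum>j\<in>I. B i j * of_real (len j) * v j) = v i"
    if v: "v \<in> bound_states (of_real k)" and i: "i \<in> I" for v i
  proof -
    \<comment> \<open>\<open>(1 - U (z n)) v\<close>, divided by the height\<close>
    define w where "w n j = (\<Sum>m\<in>I. (K j m - U (z n) j m) / of_real (y (r n)) * v m)" for n j
    have "v i = (\<Sum>j\<in>I. G (r n) i j * w n j)" for n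
    proof -
      have "v i = (\<Sum>j\<in>I. green (z n) i j * (of_real (y (r n)) * w n j))"
      proof (rule green_solves[OF z i])
        fix j assume j: "j \<in> I"
        have "v j = (\<Sum>m\<in>I. K j m * v m)"
          using v j by (simp add: bound_states_def K_def)
        moreover have "of_real (y (r n)) * w n j = (\<Sum>m\<in>I. (K j m - U (z n) j m) * v m)"
          using y(1)[of "r n"] by (simp add: w_def sum_distrib_left)
        ultimately show "v j - (\<Sum>m\<in>I. U (z n) j m * v m) = of_real (y (r n)) * w n j"
          by (simp add: left_diff_distrib sum_subtractf)
      qed
      then show ?thesis
        by (simp add: G_def z_def mult_ac)
    qed
    moreover have "(\<lambda>n. \<Sum>j\<in>I. G (r n) i j * w n j) \<longlonglongrightarrow>
        (\<Sum>j\<in>I. B i j * (\<Sum>m\<in>I. K j m * of_real (len m) * v m))"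
      unfolding w_def using i by (intro tendsto_intros quot_lim B) auto
    ultimately have "(\<lambda>n. v i) \<longlonglongrightarrow> (\<Sum>j\<in>I. B i j * (\<Sum>m\<in>I. K j m * of_real (len m) * v m))"
      by simp
    then have "v i = (\<Sum>j\<in>I. B i j * (\<Sum>m\<in>I. K j m * of_real (len m) * v m))"
      by (simp add: LIMSEQ_const_iff)
    also have "\<dots> = (\<Sum>m\<in>I. (\<Sum>j\<in>I. B i j * K j m) * of_real (len m) * v m)"
      unfolding sum_distrib_left sum_distrib_right by (subst sum.swap) (simp add: mult_ac)
    also have "\<dots> = (\<Sum>m\<in>I. B i m * of_real (len m) * v m)"
      using B_row[OF i] by simp
    finally show ?thesis by simp
  qed
  have trace: "(\<Sum>i\<in>I. B i i * of_real (len i)) = of_nat (cfun.dim (bound_states (of_real k)))"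
  proof (rule trace_projection[OF finite_I subspace_bound_states, of _ "\<lambda>i j. B i j * of_real (len j)"])
    fix j assume j: "j \<in> I"
    have "B i j * of_real (len j) = (\<Sum>l\<in>I. K i l * (B l j * of_real (len j)))" if "i \<in> I" for i
      unfolding mult.assoc[symmetric] sum_distrib_right[symmetric] B_col[OF that j, symmetric] ..
    then show "(\<lambda>i. if i \<in> I then B i j * of_real (len j) else 0) \<in> bound_states (of_real k)"
      by (simp add: bound_states_def K_def cong: sum.cong)
  qed (auto simp: repro, simp add: bound_states_def)
  have "of_real (y (r n)) * resolvent_trace (z n) = (\<Sum>i\<in>I. (G (r n) i i - of_real (y (r n))) * of_real (len i))" for n
    by (simp add: resolvent_trace_def G_def z_def sum_distrib_left algebra_simps)
  moreover have "(\<lambda>n. \<Sum>i\<in>I. (G (r n) i i - of_real (y (r n))) * of_real (len i)) \<longlonglongrightarrow>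
      (\<Sum>i\<in>I. (B i i - 0) * of_real (len i))"
    by (intro tendsto_intros B yr_c) auto
  ultimately show ?thesis
    using r trace by (intro exI[of _ r]) (simp add: z_def)
qed

end

text \<open>
  The dimensions are the residues at the points other than the origin, up to a constant, so the difference
  of the two functions has no pole there. At the origin the decay along the imaginary axis rules out a
  pole.
\<close>
lemma resolvent_trace_eqI:
  assumes "scattering I S l" and "scattering I' S' l'"
    and dims: "\<And>k :: real. k \<noteq> 0 \<Longrightarrow> cfun.dim (scattering.bound_states I S l p (of_real k)) =
      cfun.dim (scattering.bound_states I' S' l' p' (of_real k))"
    and z: "Im z \<noteq> 0"
  shows "scattering.resolvent_trace I S l p z = scattering.resolvent_trace I' S' l' p' z"
proof -
  interpret A: scattering I S l p by fact
  interpret B: scattering I' S' l' p' by fact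
  obtain N \<delta> where A: "N holomorphic_on UNIV" "\<delta> holomorphic_on UNIV"
    "\<And>z. Im z \<noteq> 0 \<Longrightarrow> \<delta> z \<noteq> 0" "\<And>z. Im z \<noteq> 0 \<Longrightarrow> A.resolvent_trace z = N z / \<delta> z"
    by (rule A.resolvent_trace_meromorphic) (rule that)
  obtain N' \<delta>' where B: "N' holomorphic_on UNIV" "\<delta>' holomorphic_on UNIV"
    "\<And>z. Im z \<noteq> 0 \<Longrightarrow> \<delta>' z \<noteq> 0" "\<And>z. Im z \<noteq> 0 \<Longrightarrow> B.resolvent_trace z = N' z / \<delta>' z"
    by (rule B.resolvent_trace_meromorphic) (rule that)
  obtain C where C: "C \<ge> 0" "\<And>z. Im z \<noteq> 0 \<Longrightarrow> cmod (A.resolvent_trace z) \<le> C * (1 + 1 / \<bar>Im z\<bar>)"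
    by (rule A.resolvent_trace_bound) (rule that)
  obtain C' where C': "C' \<ge> 0" "\<And>z. Im z \<noteq> 0 \<Longrightarrow> cmod (B.resolvent_trace z) \<le> C' * (1 + 1 / \<bar>Im z\<bar>)"
    by (rule B.resolvent_trace_bound) (rule that)
  have "A.resolvent_trace z - B.resolvent_trace z = 0"
  proof (rule meromorphic_eq_0_of_growth[where N = "\<lambda>z. N z * \<delta>' z - N' z * \<delta> z" and \<delta> = "\<lambda>z. \<delta> z * \<delta>' z"
        and h = "\<lambda>z. A.resolvent_trace z - B.resolvent_trace z" and C = "C + C'"])
    show "(\<lambda>z. N z * \<delta>' z - N' z * \<delta> z) holomorphic_on UNIV" "(\<lambda>z. \<delta> z * \<delta>' z) holomorphic_on UNIV"
      by (intro holomorphic_intros A B)+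
    fix z :: complex assume z: "Im z \<noteq> 0"
    show "\<delta> z * \<delta>' z \<noteq> 0"
      using A(3)[OF z] B(3)[OF z] by simp
    show "A.resolvent_trace z - B.resolvent_trace z = (N z * \<delta>' z - N' z * \<delta> z) / (\<delta> z * \<delta>' z)"
      unfolding A(4)[OF z] B(4)[OF z] using A(3)[OF z] B(3)[OF z] by (simp add: field_simps)
    show "cmod (A.resolvent_trace z - B.resolvent_trace z) \<le> (C + C') * (1 + 1 / \<bar>Im z\<bar>)"
      using norm_triangle_ineq4[of "A.resolvent_trace z" "B.resolvent_trace z"] C(2)[OF z] C'(2)[OF z]
      by (simp add: distrib_right)
  next
    show "(\<lambda>n. of_nat n * (A.resolvent_trace (Complex 0 (of_nat n)) - B.resolvent_trace (Complex 0 (of_nat n)))) \<longlonglongrightarrow> 0"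
      using tendsto_diff[OF A.resolvent_trace_decay B.resolvent_trace_decay] by (simp add: right_diff_distrib)
  next
    fix k :: real assume k: "k \<noteq> 0"
    define y :: "nat \<Rightarrow> real" where "y n = inverse (of_nat (Suc n))" for n
    have y: "\<And>n. y n > 0" "y \<longlonglongrightarrow> 0"
      unfolding y_def using LIMSEQ_inverse_real_of_nat by auto
    obtain r where r: "strict_mono r" "(\<lambda>n. of_real (y (r n)) * A.resolvent_trace (Complex k (y (r n)))) \<longlonglongrightarrow>
        of_nat (cfun.dim (A.bound_states (of_real k)))"
      using A.resolvent_trace_near_real_axis[of y k, OF y] by blast
    have yr: "\<And>n. y (r n) > 0" "(\<lambda>n. y (r n)) \<longlonglongrightarrow> 0"
      using y LIMSEQ_subseq_LIMSEQ[OF y(2) r(1)] by (auto simp: o_def)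
    obtain s where s: "strict_mono s" "(\<lambda>n. of_real (y (r (s n))) * B.resolvent_trace (Complex k (y (r (s n))))) \<longlonglongrightarrow>
        of_nat (cfun.dim (B.bound_states (of_real k)))"
      using B.resolvent_trace_near_real_axis[of "\<lambda>n. y (r n)" k, OF yr] by blast
    have yrs: "\<And>n. y (r (s n)) > 0" "(\<lambda>n. y (r (s n))) \<longlonglongrightarrow> 0"
      using y LIMSEQ_subseq_LIMSEQ[OF yr(2) s(1)] by (auto simp: o_def)
    have "(\<lambda>n. of_real (y (r (s n))) * A.resolvent_trace (Complex k (y (r (s n))))) \<longlonglongrightarrow>
        of_nat (cfun.dim (A.bound_states (of_real k)))"
      using LIMSEQ_subseq_LIMSEQ[OF r(2) s(1)] by (simp add: o_def)
    from tendsto_diff[OF this s(2)]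
    have "(\<lambda>n. of_real (y (r (s n))) * (A.resolvent_trace (Complex k (y (r (s n)))) - B.resolvent_trace (Complex k (y (r (s n)))))) \<longlonglongrightarrow> 0"
      by (simp add: dims[OF k] right_diff_distrib)
    with yrs show "\<exists>y. (\<forall>n. 0 < y n) \<and> y \<longlonglongrightarrow> 0 \<and>
        (\<lambda>n. of_real (y n) * (A.resolvent_trace (Complex k (y n)) - B.resolvent_trace (Complex k (y n)))) \<longlonglongrightarrow> 0"
      by (intro exI[of _ "\<lambda>n. y (r (s n))"] conjI allI)
  qed (use C(1) C'(1) z in auto)
  then show ?thesis by simp
qed

section \<open>Uniqueness of generalised Dirichlet series\<close>

lemma sum_eq_regrouped:
  fixes f :: "'a \<Rightarrow> complex" and g :: "'a \<Rightarrow> real"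
  assumes "finite E" "finite A" "g ` E \<subseteq> A"
  shows "(\<Sum>w\<in>E. f w * h (g w)) = (\<Sum>v\<in>A. (\<Sum>w\<in>{w\<in>E. g w = v}. f w) * h v)"
proof -
  have "(\<Sum>w\<in>E. f w * h (g w)) = (\<Sum>v\<in>A. \<Sum>w\<in>{w\<in>E. g w = v}. f w * h (g w))"
    using sum.group[OF assms, of "\<lambda>w. f w * h (g w)"] by simp
  also have "\<dots> = (\<Sum>v\<in>A. (\<Sum>w\<in>{w\<in>E. g w = v}. f w) * h v)"
    unfolding sum_distrib_right by (intro sum.cong) auto
  finally show ?thesis .
qed

text \<open>
  Multiply by \<open>exp (y * x)\<close> and let \<open>y\<close> tend to infinity, where \<open>x\<close> is the smallest frequency whose coefficient
  is not yet known to vanish: the terms with larger frequencies decay uniformly, since the frequencies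
  do not accumulate, and the coefficient of \<open>x\<close> is left over.
\<close>
lemma dirichlet_series_unique:
  fixes b :: "'w \<Rightarrow> complex" and l :: "'w \<Rightarrow> real"
  assumes fin: "\<And>X. finite {w\<in>W. l w \<le> X}"
    and summable: "(\<lambda>w. cmod (b w) * exp (- (y0 * l w))) summable_on W"
    and zero: "\<And>y. y \<ge> y0 \<Longrightarrow> (\<Sum>\<^sub>\<infinity>w\<in>W. b w * of_real (exp (- (y * l w)))) = 0"
  shows "(\<Sum>w\<in>{w\<in>W. l w = x}. b w) = 0"
proof (induction "card (l ` {w\<in>W. l w < x})" arbitrary: x rule: less_induct)
  case less
  have fin_lt: "finite {w\<in>W. l w < x}"
    by (rule finite_subset[OF _ fin[of x]]) auto
  define E where "E = {w\<in>W. l w = x}"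
  define T where "T = {w\<in>W. l w > x}"
  define P where "P = {w\<in>W. l w < x}"
  have finE: "finite E"
    unfolding E_def by (rule finite_subset[OF _ fin[of x]]) auto
  have W: "W = P \<union> E \<union> T" "P \<inter> E = {}" "(P \<union> E) \<inter> T = {}"
    by (auto simp: E_def T_def P_def)
  have IH: "(\<Sum>w\<in>{w\<in>W. l w = v}. b w) = 0" if "v \<in> l ` P" for v
  proof (rule less.hyps)
    have v: "v < x" "v \<in> l ` {w \<in> W. l w < x}"
      using that by (auto simp: P_def)
    then have "l ` {w \<in> W. l w < v} \<subseteq> l ` {w \<in> W. l w < x}"
      by auto
    moreover have "v \<notin> l ` {w \<in> W. l w < v}"
      by auto
    ultimately have "l ` {w \<in> W. l w < v} \<subset> l ` {w \<in> W. l w < x}"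
      using v(2) by blast
    then show "card (l ` {w \<in> W. l w < v}) < card (l ` {w \<in> W. l w < x})"
      using fin_lt by (intro psubset_card_mono) auto
  qed
  obtain d where d: "d > 0" "\<And>w. w \<in> T \<Longrightarrow> x + d \<le> l w"
  proof -
    define D where "D = insert 1 ((\<lambda>w. l w - x) ` {w\<in>T. l w \<le> x + 1})"
    have finD: "finite D"
      unfolding D_def by (auto intro!: finite_subset[OF _ fin[of "x + 1"]] simp: T_def)
    have "Min D > 0"
      using finD by (subst Min_gr_iff) (auto simp: D_def T_def)
    moreover have "x + Min D \<le> l w" if w: "w \<in> T" for w
    proof (cases "l w \<le> x + 1")
      case True
      then have "Min D \<le> l w - x"
        using w finD by (intro Min_le) (auto simp: D_def)
      then show ?thesis by simp
    next
      case False
      moreover have "Min D \<le> 1"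
        using finD by (intro Min_le) (auto simp: D_def)
      ultimately show ?thesis by simp
    qed
    ultimately show thesis by (rule that)
  qed
  define K where "K = (\<Sum>\<^sub>\<infinity>w\<in>T. cmod (b w) * exp (- (y0 * (l w - x))))"
  have "(\<lambda>w. (cmod (b w) * exp (- (y0 * l w))) * exp (y0 * x)) summable_on T"
    using summable by (intro summable_on_cmult_left) (auto elim!: summable_on_subset_banach simp: T_def)
  then have sumT: "(\<lambda>w. cmod (b w) * exp (- (y0 * (l w - x)))) summable_on T"
    by (simp add: right_diff_distrib exp_diff exp_minus field_simps)
  have bound: "cmod (\<Sum>w\<in>E. b w) \<le> exp (- ((y - y0) * d)) * K" if y: "y \<ge> y0" for y
  proof -
    define f where "f w = b w * of_real (exp (- (y * (l w - x))))" for w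
    have le: "cmod (f w) \<le> exp (- ((y - y0) * d)) * (cmod (b w) * exp (- (y0 * (l w - x))))" if "w \<in> T" for w
    proof -
      have "(y - y0) * d \<le> (y - y0) * (l w - x)"
        using d(2)[OF that] y by (intro mult_left_mono) auto
      then have "exp (- (y * (l w - x))) \<le> exp (- ((y - y0) * d) + - (y0 * (l w - x)))"
        by (subst exp_le_cancel_iff) (simp add: algebra_simps)
      then have "cmod (b w) * exp (- (y * (l w - x))) \<le> cmod (b w) * (exp (- ((y - y0) * d)) * exp (- (y0 * (l w - x))))"
        unfolding exp_add by (intro mult_left_mono) auto
      then show ?thesis
        by (simp add: f_def norm_mult mult_ac)
    qed
    have sum_bound: "(\<lambda>w. exp (- ((y - y0) * d)) * (cmod (b w) * exp (- (y0 * (l w - x))))) summable_on T"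
      by (intro summable_on_cmult_right sumT)
    have absT: "(\<lambda>w. cmod (f w)) summable_on T"
      by (rule summable_on_comparison_test[OF sum_bound le]) auto
    then have fT: "f summable_on T"
      by (rule abs_summable_summable)
    have "(\<Sum>\<^sub>\<infinity>w\<in>W. f w) = of_real (exp (y * x)) * (\<Sum>\<^sub>\<infinity>w\<in>W. b w * of_real (exp (- (y * l w))))"
      unfolding f_def infsum_cmult_right'[symmetric]
      by (intro infsum_cong) (simp add: right_diff_distrib exp_diff exp_minus field_simps)
    then have "0 = (\<Sum>\<^sub>\<infinity>w\<in>W. f w)"
      using zero[OF y] by simp
    also have "\<dots> = (\<Sum>\<^sub>\<infinity>w\<in>P \<union> E. f w) + (\<Sum>\<^sub>\<infinity>w\<in>T. f w)"
      unfolding W(1) using fT fin_lt finE W(3) by (intro infsum_Un_disjoint) (auto simp: P_def)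
    also have "(\<Sum>\<^sub>\<infinity>w\<in>P \<union> E. f w) = (\<Sum>w\<in>P. f w) + (\<Sum>w\<in>E. f w)"
      using fin_lt finE W(2) by (simp add: sum.union_disjoint P_def)
    also have "(\<Sum>w\<in>E. f w) = (\<Sum>w\<in>E. b w)"
      by (intro sum.cong) (auto simp: f_def E_def)
    also have "(\<Sum>w\<in>P. f w) = 0"
    proof -
      have "(\<Sum>w\<in>{w\<in>P. l w = v}. f w) = 0" if v: "v \<in> l ` P" for v
      proof -
        have "{w\<in>P. l w = v} = {w\<in>W. l w = v}"
          using v by (auto simp: P_def)
        moreover have "(\<Sum>w\<in>{w\<in>W. l w = v}. f w) = (\<Sum>w\<in>{w\<in>W. l w = v}. b w) * of_real (exp (- (y * (v - x))))"
          unfolding sum_distrib_right by (intro sum.cong) (auto simp: f_def)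
        ultimately show ?thesis
          using IH[OF v] by simp
      qed
      then show ?thesis
        using sum_eq_regrouped[of P "l ` P" l f "\<lambda>_. 1"] fin_lt by (simp add: P_def)
    qed
    finally have "(\<Sum>w\<in>E. b w) = - (\<Sum>\<^sub>\<infinity>w\<in>T. f w)"
      by (simp add: eq_neg_iff_add_eq_0)
    then have "cmod (\<Sum>w\<in>E. b w) = cmod (\<Sum>\<^sub>\<infinity>w\<in>T. f w)"
      by simp
    also have "\<dots> \<le> (\<Sum>\<^sub>\<infinity>w\<in>T. cmod (f w))"
      using absT by (rule norm_infsum_bound)
    also have "\<dots> \<le> (\<Sum>\<^sub>\<infinity>w\<in>T. exp (- ((y - y0) * d)) * (cmod (b w) * exp (- (y0 * (l w - x)))))"
      using absT sum_bound le by (rule infsum_mono)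
    also have "\<dots> = exp (- ((y - y0) * d)) * K"
      unfolding K_def by (rule infsum_cmult_right')
    finally show ?thesis .
  qed
  have "((\<lambda>y. exp (- ((y - y0) * d))) \<longlongrightarrow> 0) at_top"
    using d(1) by real_asymp
  then have "((\<lambda>y. exp (- ((y - y0) * d)) * K) \<longlongrightarrow> 0 * K) at_top"
    by (intro tendsto_intros)
  then have "cmod (\<Sum>w\<in>E. b w) \<le> 0 * K"
    by (rule tendsto_lowerbound) (auto intro!: eventually_mono[OF eventually_ge_at_top[of y0]] bound)
  then show ?case
    by (simp add: E_def)
qed

text \<open>
  If finitely many exponentials with different frequencies satisfy a linear relation on
  \<open>[0,\<epsilon>)\<close>, evaluating at the multiples of a small step turns it into a relation between powers of
  distinct numbers.
\<close>
lemma exponentials_independent: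
  fixes c :: "real \<Rightarrow> complex"
  assumes A: "finite A" and "\<epsilon> > 0"
    and zero: "\<And>t. 0 \<le> t \<Longrightarrow> t < \<epsilon> \<Longrightarrow> (\<Sum>a\<in>A. c a * exp (\<i> * of_real (t * a))) = 0"
    and a0: "a0 \<in> A"
  shows "c a0 = 0"
proof -
  define M where "M = 1 + (\<Sum>a\<in>A. \<bar>a\<bar>)"
  have M: "M > 0" and aM: "\<bar>a\<bar> < M" if "a \<in> A" for a
    using member_le_sum[of a A abs] that A by (auto simp: M_def sum_nonneg add_pos_nonneg)
  have M: "M > 0"
    by (auto simp: M_def sum_nonneg add_pos_nonneg)
  \<comment> \<open>small enough that the sample points lie in \<open>[0,\<epsilon>)\<close> and that the numbers \<open>x a\<close> below are distinct\<close>
  define \<delta> where "\<delta> = min (\<epsilon> / (2 * (real (card A) + 1))) (1 / M)"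
  have \<delta>: "\<delta> > 0" "\<delta> \<le> 1 / M" "\<delta> * (real (card A) + 1) < \<epsilon>"
  proof -
    show "\<delta> > 0" "\<delta> \<le> 1 / M"
      using \<open>\<epsilon> > 0\<close> M by (auto simp: \<delta>_def)
    have "\<delta> * (real (card A) + 1) \<le> \<epsilon> / (2 * (real (card A) + 1)) * (real (card A) + 1)"
      by (intro mult_right_mono) (auto simp: \<delta>_def)
    also have "\<dots> = \<epsilon> / 2"
      by (simp add: field_simps add_eq_0_iff)
    finally show "\<delta> * (real (card A) + 1) < \<epsilon>"
      using \<open>\<epsilon> > 0\<close> by simp
  qed
  define x where "x a = exp (\<i> * of_real (\<delta> * a))" for a
  have inj: "a = b" if "a \<in> A" "b \<in> A" "x a = x b" for a b
  proof -
    have small: "\<bar>\<delta> * a\<bar> < pi" if "a \<in> A" for a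
    proof -
      have "\<bar>\<delta> * a\<bar> \<le> 1 / M * \<bar>a\<bar>"
        unfolding abs_mult using \<delta> by (intro mult_right_mono) auto
      also have "\<dots> < 1"
        using aM[OF that] M by (simp add: field_simps)
      finally show ?thesis
        using pi_gt3 by simp
    qed
    have "\<i> * of_real (\<delta> * a) = \<i> * of_real (\<delta> * b)"
    proof (rule exp_complex_eqI)
      show "\<bar>Im (\<i> * of_real (\<delta> * a)) - Im (\<i> * of_real (\<delta> * b))\<bar> < 2 * pi"
        using small[OF that(1)] small[OF that(2)] by simp
      show "exp (\<i> * of_real (\<delta> * a)) = exp (\<i> * of_real (\<delta> * b))"
        using that(3) by (simp only: x_def)
    qed
    then have "\<delta> * a = \<delta> * b"
      by (simp only: mult_cancel_left of_real_eq_iff) simp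
    then show ?thesis
      using \<delta> by simp
  qed
  have powers: "(\<Sum>a\<in>A. c a * x a ^ n) = 0" if n: "n \<le> card A" for n
  proof -
    have "\<delta> * real n \<le> \<delta> * (real (card A) + 1)"
      using \<delta> n by (intro mult_left_mono) auto
    with \<delta>(3) have "\<delta> * real n < \<epsilon>"
      by linarith
    then have "(\<Sum>a\<in>A. c a * exp (\<i> * of_real ((\<delta> * real n) * a))) = 0"
      using \<delta> by (intro zero) auto
    moreover have "x a ^ n = exp (\<i> * of_real ((\<delta> * real n) * a))" for a
      unfolding x_def exp_of_nat_mult[symmetric] by (simp add: mult_ac)
    ultimately show ?thesis by simp
  qed
  \<comment> \<open>applying the linear relations to the coefficients of this polynomial keeps only the frequency \<open>a0\<close>\<close>
  define p where "p = (\<Prod>a\<in>A - {a0}. [:- x a, 1:])"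
  have "degree p \<le> (\<Sum>a\<in>A - {a0}. 1)"
    unfolding p_def by (rule order_trans[OF degree_prod_sum_le]) (use A in auto)
  also have "\<dots> \<le> card A"
    using A by (simp add: card_Diff_subset_Int)
  finally have deg: "degree p \<le> card A" .
  have "0 = (\<Sum>n\<le>degree p. coeff p n * (\<Sum>a\<in>A. c a * x a ^ n))"
    using deg powers by (intro sum.neutral[symmetric]) auto
  also have "\<dots> = (\<Sum>a\<in>A. c a * poly p (x a))"
    unfolding poly_altdef sum_distrib_left by (subst sum.swap) (simp add: mult_ac)
  also have "\<dots> = (\<Sum>a\<in>A. if a = a0 then c a0 * poly p (x a0) else 0)"
  proof (rule sum.cong[OF refl])
    fix a assume a: "a \<in> A"
    have "poly p (x a) = 0" if "a \<noteq> a0"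
      using that a A by (auto simp: p_def poly_prod)
    then show "c a * poly p (x a) = (if a = a0 then c a0 * poly p (x a0) else 0)"
      by auto
  qed
  also have "\<dots> = c a0 * poly p (x a0)"
    using A a0 by simp
  finally have "c a0 * poly p (x a0) = 0"
    by simp
  moreover have "poly p (x a0) \<noteq> 0"
    using inj a0 A by (auto simp: p_def poly_prod)
  ultimately show ?thesis
    by simp
qed

section \<open>The trace formula\<close>

text \<open>
  There are \<open>card I ^ n\<close> lists of length \<open>n\<close>, so the sum is dominated by a geometric series.
\<close>
lemma summable_on_lists_geometric:
  fixes q :: real
  assumes "finite I" "q \<ge> 0" "real (card I) * q \<le> 1 / 2"
  shows "(\<lambda>xs. q ^ length xs) summable_on lists I"
proof (rule nonneg_bdd_above_summable_on)
  show "bdd_above (sum (\<lambda>xs. q ^ length xs) ` {F. F \<subseteq> lists I \<and> finite F})"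
  proof (rule bdd_aboveI2)
    fix F assume "F \<in> {F. F \<subseteq> lists I \<and> finite F}"
    then have F: "F \<subseteq> lists I" "finite F" by auto
    define N where "N = Max (insert 0 (length ` F))"
    have N: "length xs \<le> N" if "xs \<in> F" for xs
      using that F(2) unfolding N_def by (intro Max_ge) auto
    define Q where "Q n = {xs. set xs \<subseteq> I \<and> length xs = n}" for n
    have finQ: "finite (Q n)" for n
      unfolding Q_def using finite_lists_length_eq[OF assms(1)] by simp
    have "F \<subseteq> (\<Union>n\<in>{..N}. Q n)"
      using F(1) N by (auto simp: Q_def lists_eq_set)
    then have "(\<Sum>xs\<in>F. q ^ length xs) \<le> (\<Sum>xs\<in>(\<Union>n\<in>{..N}. Q n). q ^ length xs)"
      using finQ assms(2) by (intro sum_mono2) auto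
    also have "\<dots> = (\<Sum>n\<le>N. \<Sum>xs\<in>Q n. q ^ length xs)"
      using finQ by (intro sum.UNION_disjoint) (auto simp: Q_def)
    also have "\<dots> = (\<Sum>n\<le>N. (real (card I) * q) ^ n)"
    proof (rule sum.cong[OF refl])
      fix n
      have "(\<Sum>xs\<in>Q n. q ^ length xs) = (\<Sum>xs\<in>Q n. q ^ n)"
        by (intro sum.cong) (auto simp: Q_def)
      then show "(\<Sum>xs\<in>Q n. q ^ length xs) = (real (card I) * q) ^ n"
        using card_lists_length_eq[OF assms(1), of n] by (simp add: Q_def power_mult_distrib)
    qed
    also have "\<dots> \<le> (\<Sum>n\<le>N. (1 / 2) ^ n)"
      using assms by (intro sum_mono power_mono) auto
    also have "\<dots> \<le> (\<Sum>n. (1 / 2) ^ n)"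
      by (intro sum_le_suminf summable_geometric) auto
    also have "\<dots> = 2"
      by (subst suminf_geometric) auto
    finally show "(\<Sum>xs\<in>F. q ^ length xs) \<le> 2" .
  qed
qed (use assms in auto)

context scattering
begin

text \<open>
  For a path that traverses \<open>i\<close> and the bonds in \<open>xs\<close> and then enters \<open>j\<close>.
\<close>
definition path_amplitude :: "'i \<Rightarrow> 'i list \<Rightarrow> 'i \<Rightarrow> complex" where
  "path_amplitude i xs j = (\<Prod>(a, b)\<leftarrow>zip (i # xs) (xs @ [j]). S b a)"

definition path_weight :: "complex \<Rightarrow> 'i \<Rightarrow> 'i list \<Rightarrow> 'i \<Rightarrow> complex" where
  "path_weight z i xs j = (\<Prod>(a, b)\<leftarrow>zip (i # xs) (xs @ [j]). U z b a)"

lemma path_weight_Nil [simp]: "path_weight z i [] j = U z j i"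
  and path_weight_Cons [simp]: "path_weight z i (x # xs) j = U z x i * path_weight z x xs j"
  by (simp_all add: path_weight_def)

lemma path_amplitude_Nil [simp]: "path_amplitude i [] j = S j i"
  and path_amplitude_Cons [simp]: "path_amplitude i (x # xs) j = S x i * path_amplitude x xs j"
  by (simp_all add: path_amplitude_def)

lemma path_weight_eq:
  "path_weight z i xs j = path_amplitude i xs j *
     exp (\<i> * (z * of_real (\<Sum>a\<leftarrow>i # xs. len a) + of_real (\<Sum>a\<leftarrow>i # xs. phase a)))"
proof (induction xs arbitrary: i)
  case (Cons x xs)
  show ?case
    unfolding path_weight_Cons Cons.IH U_def propagation_def path_amplitude_Cons
    by (simp add: exp_add[symmetric] algebra_simps flip: exp_add)
qed (simp add: U_def propagation_def)

lemma cmod_S_le: "i \<in> I \<Longrightarrow> j \<in> I \<Longrightarrow> cmod (S i j) \<le> 1"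
proof -
  assume ij: "i \<in> I" "j \<in> I"
  have "(\<lambda>i. \<Sum>m\<in>I. S i m * (if m = j then 1 else 0)) = (\<lambda>i. S i j)"
    using ij finite_I by (simp add: if_distrib[of "\<lambda>c. _ * c"] cong: if_cong)
  then have "l2_norm I (\<lambda>i. S i j) = 1"
    using isometry[of "\<lambda>i. if i = j then 1 else 0"] l2_norm_unit[OF finite_I ij(2)] by simp
  then show ?thesis
    using cmod_le_l2_norm[OF finite_I ij(1), of "\<lambda>i. S i j"] by simp
qed

lemma cmod_U_le:
  assumes "Im z \<ge> 0" "i \<in> I" "j \<in> I"
  shows "cmod (U z i j) \<le> exp (- (Im z * min_len))"
proof -
  have "cmod (U z i j) \<le> 1 * exp (- (Im z * len j))"
    unfolding U_def norm_mult cmod_propagation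
    using cmod_S_le[OF assms(2,3)] by (intro mult_right_mono) auto
  also have "\<dots> \<le> exp (- (Im z * min_len))"
    using assms(1) min_len_le[OF assms(3)] by (simp add: mult_left_mono)
  finally show ?thesis .
qed

lemma cmod_path_weight_le:
  assumes "Im z \<ge> 0" "i \<in> I" "j \<in> I" "xs \<in> lists I"
  shows "cmod (path_weight z i xs j) \<le> exp (- (Im z * min_len)) ^ Suc (length xs)"
  using assms(2,4)
proof (induction xs arbitrary: i)
  case Nil
  then show ?case
    using cmod_U_le[OF assms(1,3)] by simp
next
  case (Cons x xs)
  then have "cmod (path_weight z x xs j) \<le> exp (- (Im z * min_len)) ^ Suc (length xs)" "x \<in> I"
    by auto
  moreover from this have "cmod (U z x i) \<le> exp (- (Im z * min_len))"
    using cmod_U_le[OF assms(1)] Cons.prems by blast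
  ultimately show ?case
    unfolding path_weight_Cons norm_mult length_Cons power_Suc[of _ "Suc (length xs)"]
    by (intro mult_mono) auto
qed

text \<open>
  At this height above the real axis the number of paths grows more slowly than their weights decay.
\<close>
definition large_height :: "real \<Rightarrow> bool" where
  "large_height y \<longleftrightarrow> y > 0 \<and> real (card I) * exp (- (y * min_len)) \<le> 1 / 2"

lemma eventually_large_height: "\<exists>y0>0. \<forall>y\<ge>y0. large_height y"
proof -
  define y0 where "y0 = ln (2 * real (card I) + 2) / min_len"
  have pos: "y0 > 0"
    using min_len_pos by (simp add: y0_def)
  have "large_height y" if y: "y \<ge> y0" for y
  proof -
    have "exp (- (y * min_len)) \<le> exp (- ln (2 * real (card I) + 2))"
      using y min_len_pos by (simp add: y0_def field_simps)
    also have "\<dots> = 1 / (2 * real (card I) + 2)"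
      by (simp add: exp_minus field_simps)
    finally have "real (card I) * exp (- (y * min_len)) \<le> real (card I) * (1 / (2 * real (card I) + 2))"
      by (intro mult_left_mono) auto
    also have "\<dots> \<le> 1 / 2"
      by (simp add: field_simps)
    finally show ?thesis
      using pos y by (simp add: large_height_def)
  qed
  with pos show ?thesis by blast
qed

lemma path_weight_summable:
  assumes z: "large_height (Im z)" and ij: "i \<in> I" "j \<in> I"
  shows "(\<lambda>xs. cmod (path_weight z i xs j)) summable_on lists I"
proof (rule summable_on_comparison_test)
  define q where "q = exp (- (Im z * min_len))"
  show "(\<lambda>xs. q * q ^ length xs) summable_on lists I"
    using z by (intro summable_on_cmult_right summable_on_lists_geometric finite_I)
      (auto simp: large_height_def q_def)
  show "cmod (path_weight z i xs j) \<le> q * q ^ length xs" if "xs \<in> lists I" for xs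
    using cmod_path_weight_le[of z i j xs] ij that z by (simp add: q_def large_height_def)
qed auto

lemma path_sum_recursion:
  assumes z: "large_height (Im z)" and ij: "i \<in> I" "j \<in> I"
  shows "(\<Sum>\<^sub>\<infinity>xs\<in>lists I. path_weight z i xs j) =
    U z j i + (\<Sum>x\<in>I. U z x i * (\<Sum>\<^sub>\<infinity>xs\<in>lists I. path_weight z x xs j))"
proof -
  let ?f = "\<lambda>xs. path_weight z i xs j"
  have f: "?f summable_on lists I"
    by (rule abs_summable_summable[OF path_weight_summable[OF assms]])
  define h :: "'i \<times> 'i list \<Rightarrow> 'i list" where "h = (\<lambda>(x, xs). x # xs)"
  have h: "inj_on h (I \<times> lists I)"
    by (auto simp: inj_on_def h_def)
  have split: "lists I = {[]} \<union> h ` (I \<times> lists I)"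
  proof (rule Set.set_eqI)
    fix xs show "xs \<in> lists I \<longleftrightarrow> xs \<in> {[]} \<union> h ` (I \<times> lists I)"
      by (cases xs) (auto simp: h_def image_iff)
  qed
  have fh: "?f summable_on h ` (I \<times> lists I)"
    using f by (rule summable_on_subset_banach) (subst (2) split, blast)
  then have fh': "(\<lambda>(x, xs). U z x i * path_weight z x xs j) summable_on I \<times> lists I"
    unfolding summable_on_reindex[OF h] by (simp add: o_def h_def case_prod_unfold)
  have "infsum ?f (lists I) = infsum ?f {[]} + infsum ?f (h ` (I \<times> lists I))"
    by (subst split) (rule infsum_Un_disjoint[OF _ fh], auto simp: h_def)
  also have "infsum ?f (h ` (I \<times> lists I)) = (\<Sum>\<^sub>\<infinity>(x, xs)\<in>I \<times> lists I. U z x i * path_weight z x xs j)"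
    unfolding infsum_reindex[OF h] by (simp add: o_def h_def case_prod_unfold)
  also have "\<dots> = (\<Sum>\<^sub>\<infinity>x\<in>I. \<Sum>\<^sub>\<infinity>xs\<in>lists I. U z x i * path_weight z x xs j)"
    by (rule infsum_Sigma'_banach[OF fh', symmetric])
  also have "\<dots> = (\<Sum>x\<in>I. U z x i * (\<Sum>\<^sub>\<infinity>xs\<in>lists I. path_weight z x xs j))"
    using finite_I by (simp add: infsum_cmult_right')
  finally show ?thesis
    by simp
qed

text \<open>
  The Neumann series of \<open>(1 - U)\<^sup>-\<^sup>1\<close>. Splitting off the first step of the paths shows that the sum on the
  right is a left inverse of \<open>1 - U\<close>.
\<close>
lemma green_eq_path_sum:
  assumes z: "large_height (Im z)" and j: "j \<in> I" and m: "m \<in> I"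
  shows "green z j m = (if j = m then 1 else 0) + (\<Sum>\<^sub>\<infinity>xs\<in>lists I. path_weight z m xs j)"
proof -
  have z0: "Im z \<noteq> 0"
    using z by (simp add: large_height_def)
  define r where "r i = (if j = i then 1 else 0) + (\<Sum>\<^sub>\<infinity>xs\<in>lists I. path_weight z i xs j)" for i
  have r: "r i - (\<Sum>x\<in>I. r x * U z x i) = (if j = i then 1 else 0)" if i: "i \<in> I" for i
  proof -
    have "(\<Sum>x\<in>I. r x * U z x i) = (\<Sum>x\<in>I. (if j = x then U z x i else 0)) +
        (\<Sum>x\<in>I. U z x i * (\<Sum>\<^sub>\<infinity>xs\<in>lists I. path_weight z x xs j))"
      unfolding sum.distrib[symmetric] by (intro sum.cong) (auto simp: r_def algebra_simps)
    also have "\<dots> = (\<Sum>\<^sub>\<infinity>xs\<in>lists I. path_weight z i xs j)"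
      using path_sum_recursion[OF z i j] j finite_I by simp
    finally show ?thesis
      by (simp add: r_def)
  qed
  have "r m = (\<Sum>i\<in>I. r i * (green z i m - (\<Sum>l\<in>I. U z i l * green z l m)))"
    using green[OF z0 _ m] finite_I m by (simp add: if_distrib[of "\<lambda>c. _ * c"] cong: if_cong sum.cong)
  also have "\<dots> = (\<Sum>i\<in>I. r i * green z i m) - (\<Sum>l\<in>I. (\<Sum>i\<in>I. r i * U z i l) * green z l m)"
    unfolding right_diff_distrib sum_subtractf sum_distrib_left sum_distrib_right
    by (subst sum.swap) (simp add: mult.assoc)
  also have "\<dots> = (\<Sum>l\<in>I. (r l - (\<Sum>i\<in>I. r i * U z i l)) * green z l m)"
    by (simp add: left_diff_distrib sum_subtractf)
  also have "\<dots> = (\<Sum>l\<in>I. if j = l then green z l m else 0)"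
    by (intro sum.cong) (auto simp: r)
  also have "\<dots> = green z j m"
    using j finite_I by simp
  finally show ?thesis
    by (simp add: r_def)
qed

text \<open>
  A closed path \<open>i # xs\<close>, returning to \<open>i\<close>. The base point \<open>i\<close> is part of the data.
\<close>
definition loops :: "('i \<times> 'i list) set" where
  "loops = I \<times> lists I"

definition loop_coeff :: "'i \<times> 'i list \<Rightarrow> complex" where
  "loop_coeff = (\<lambda>(i, xs). of_real (len i) * path_amplitude i xs i)"

definition loop_len :: "'i \<times> 'i list \<Rightarrow> real" where
  "loop_len = (\<lambda>(i, xs). \<Sum>a\<leftarrow>i # xs. len a)"

definition loop_phase :: "'i \<times> 'i list \<Rightarrow> real" where
  "loop_phase = (\<lambda>(i, xs). \<Sum>a\<leftarrow>i # xs. phase a)"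

lemma loop_weight_eq:
  "loop_coeff w * exp (\<i> * of_real (loop_phase w)) * of_real (exp (- (y * loop_len w))) =
    (case w of (i, xs) \<Rightarrow> of_real (len i) * path_weight (Complex 0 y) i xs i)"
proof -
  obtain i xs where w: "w = (i, xs)" by force
  have "\<i> * (Complex 0 y * of_real (loop_len w) + of_real (loop_phase w)) =
      \<i> * of_real (loop_phase w) + of_real (- (y * loop_len w))"
    by (simp add: complex_eq_iff)
  moreover have "loop_len w = (\<Sum>a\<leftarrow>i # xs. len a)" "loop_phase w = (\<Sum>a\<leftarrow>i # xs. phase a)"
    by (simp_all only: w loop_len_def loop_phase_def case_prod_conv)
  ultimately have "path_weight (Complex 0 y) i xs i =
      path_amplitude i xs i * (exp (\<i> * of_real (loop_phase w)) * of_real (exp (- (y * loop_len w))))"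
    by (simp only: path_weight_eq exp_add exp_of_real)
  then show ?thesis
    by (simp add: w loop_coeff_def mult.assoc)
qed

theorem trace_formula:
  assumes y: "large_height y"
  shows "(\<lambda>w. cmod (loop_coeff w) * exp (- (y * loop_len w))) summable_on loops"
    and "resolvent_trace (Complex 0 y) =
      (\<Sum>\<^sub>\<infinity>w\<in>loops. loop_coeff w * exp (\<i> * of_real (loop_phase w)) * of_real (exp (- (y * loop_len w))))"
proof -
  define F where "F = (\<lambda>(i, xs). of_real (len i) * path_weight (Complex 0 y) i xs i)"
  have z: "large_height (Im (Complex 0 y))"
    using y by simp
  have F_eq: "F w = loop_coeff w * exp (\<i> * of_real (loop_phase w)) * of_real (exp (- (y * loop_len w)))" for w
    unfolding loop_weight_eq F_def by simp
  have "(\<lambda>w. cmod (F w)) summable_on (SIGMA i:I. lists I)"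
  proof (rule summable_on_SigmaI)
    show "((\<lambda>xs. cmod (F (i, xs))) has_sum (\<Sum>\<^sub>\<infinity>xs\<in>lists I. cmod (F (i, xs)))) (lists I)" if "i \<in> I" for i
      using summable_on_cmult_right[OF path_weight_summable[OF z that that], of "\<bar>len i\<bar>"]
      by (intro has_sum_infsum) (simp add: F_def norm_mult)
  qed (use finite_I in auto)
  then have absF: "(\<lambda>w. cmod (F w)) summable_on loops"
    by (simp add: loops_def)
  then show "(\<lambda>w. cmod (loop_coeff w) * exp (- (y * loop_len w))) summable_on loops"
    by (simp add: F_eq norm_mult)
  from absF have "F summable_on I \<times> lists I"
    unfolding loops_def by (rule abs_summable_summable)
  then have "(\<Sum>\<^sub>\<infinity>w\<in>loops. F w) = (\<Sum>\<^sub>\<infinity>i\<in>I. \<Sum>\<^sub>\<infinity>xs\<in>lists I. of_real (len i) * path_weight (Complex 0 y) i xs i)"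
    unfolding loops_def F_def by (rule infsum_Sigma'_banach[symmetric])
  also have "\<dots> = resolvent_trace (Complex 0 y)"
    using finite_I green_eq_path_sum[OF z] by (simp add: resolvent_trace_def infsum_cmult_right')
  finally show "resolvent_trace (Complex 0 y) =
      (\<Sum>\<^sub>\<infinity>w\<in>loops. loop_coeff w * exp (\<i> * of_real (loop_phase w)) * of_real (exp (- (y * loop_len w))))"
    by (simp add: F_eq)
qed

lemma finite_short_loops: "finite {w \<in> loops. loop_len w \<le> X}"
proof -
  define N where "N = nat \<lceil>X / min_len\<rceil>"
  have "{w \<in> loops. loop_len w \<le> X} \<subseteq> I \<times> {xs. set xs \<subseteq> I \<and> length xs \<le> N}"
  proof
    fix w assume "w \<in> {w \<in> loops. loop_len w \<le> X}"
    then obtain i xs where w: "w = (i, xs)" "i \<in> I" "set xs \<subseteq> I" "(\<Sum>a\<leftarrow>i # xs. len a) \<le> X"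
      by (auto simp: loops_def loop_len_def)
    have "real (length xs) * min_len = (\<Sum>a\<leftarrow>xs. min_len)"
      by (simp add: sum_list_triv)
    also have "\<dots> \<le> (\<Sum>a\<leftarrow>xs. len a)"
      using w min_len_le by (intro sum_list_mono) auto
    also have "\<dots> \<le> X"
      using w len_pos[of i] by simp
    finally have "real (length xs) \<le> X / min_len"
      using min_len_pos by (simp add: field_simps)
    then have "length xs \<le> N"
      unfolding N_def by linarith
    with w show "w \<in> I \<times> {xs. set xs \<subseteq> I \<and> length xs \<le> N}"
      by simp
  qed
  then show ?thesis
    by (rule finite_subset) (intro finite_cartesian_product finite_I finite_lists_length_le)
qed

end

section \<open>Spectral determination of the loop sums\<close>

text \<open>
  Equality of the dimensions for all wave numbers gives equality of the two trace formulas. Comparing them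
  as Dirichlet series in the height \<open>y\<close> isolates the loops of length \<open>x\<close>, and the resulting relation between
  exponentials in \<open>t\<close> isolates those of phase \<open>v\<close>.
\<close>
lemma loop_sums_determined:
  fixes I :: "'i set" and I' :: "'j set" and a :: "'i \<Rightarrow> real" and a' :: "'j \<Rightarrow> real"
  assumes sc: "scattering I S l" "scattering I' S' l'" and "\<epsilon> > 0"
    and dims: "\<And>t k :: real. 0 \<le> t \<Longrightarrow> t < \<epsilon> \<Longrightarrow> k \<noteq> 0 \<Longrightarrow>
      cfun.dim (scattering.bound_states I S l (\<lambda>i. t * a i) (of_real k)) =
      cfun.dim (scattering.bound_states I' S' l' (\<lambda>i. t * a' i) (of_real k))"
  shows "(\<Sum>w\<in>{w\<in>scattering.loops I. scattering.loop_len l w = x \<and> scattering.loop_phase a w = v}.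
            scattering.loop_coeff S l w) =
         (\<Sum>w\<in>{w\<in>scattering.loops I'. scattering.loop_len l' w = x \<and> scattering.loop_phase a' w = v}.
            scattering.loop_coeff S' l' w)"
proof -
  interpret A: scattering I S l a by fact
  interpret B: scattering I' S' l' a' by fact
  define E where "E = {w\<in>A.loops. A.loop_len w = x}"
  define E' where "E' = {w\<in>B.loops. B.loop_len w = x}"
  have finE: "finite E" "finite E'"
    unfolding E_def E'_def
    by (rule finite_subset[OF _ A.finite_short_loops[of x]], auto)
      (rule finite_subset[OF _ B.finite_short_loops[of x]], auto)
  obtain y1 where y1: "y1 > 0" "\<And>y. y \<ge> y1 \<Longrightarrow> A.large_height y"
    using A.eventually_large_height by blast
  obtain y2 where y2: "y2 > 0" "\<And>y. y \<ge> y2 \<Longrightarrow> B.large_height y"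
    using B.eventually_large_height by blast
  define y0 where "y0 = max y1 y2"
  have relation: "(\<Sum>w\<in>E. A.loop_coeff w * exp (\<i> * of_real (t * A.loop_phase w))) =
      (\<Sum>w\<in>E'. B.loop_coeff w * exp (\<i> * of_real (t * B.loop_phase w)))" if t: "0 \<le> t" "t < \<epsilon>" for t
  proof -
    interpret At: scattering I S l "\<lambda>i. t * a i" by fact
    interpret Bt: scattering I' S' l' "\<lambda>i. t * a' i" by fact
    have phase: "At.loop_phase w = t * A.loop_phase w" "Bt.loop_phase w' = t * B.loop_phase w'" for w w'
      by (auto simp: At.loop_phase_def A.loop_phase_def Bt.loop_phase_def B.loop_phase_def
          sum_list_const_mult distrib_left split: prod.split)
    define b :: "('i \<times> 'i list) + ('j \<times> 'j list) \<Rightarrow> complex" where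
      "b = case_sum (\<lambda>w. A.loop_coeff w * exp (\<i> * of_real (t * A.loop_phase w)))
        (\<lambda>w. - (B.loop_coeff w * exp (\<i> * of_real (t * B.loop_phase w))))"
    define m :: "('i \<times> 'i list) + ('j \<times> 'j list) \<Rightarrow> real" where "m = case_sum A.loop_len B.loop_len"
    define W where "W = Inl ` A.loops \<union> Inr ` B.loops"
    have disj: "Inl ` A.loops \<inter> Inr ` B.loops = {}"
      by auto
    have "(\<Sum>w\<in>{w\<in>W. m w = x}. b w) = 0"
    proof (rule dirichlet_series_unique[where ?y0.0 = y0])
      fix X
      have "{w\<in>W. m w \<le> X} = Inl ` {w\<in>A.loops. A.loop_len w \<le> X} \<union> Inr ` {w\<in>B.loops. B.loop_len w \<le> X}"
        by (auto simp: W_def m_def)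
      then show "finite {w\<in>W. m w \<le> X}"
        using A.finite_short_loops[of X] B.finite_short_loops[of X] by simp
    next
      fix y assume y: "y \<ge> y0"
      have y': "A.large_height y" "B.large_height y" "y > 0"
        using y y1 y2 by (auto simp: y0_def)
      define F where "F w = b w * of_real (exp (- (y * m w)))" for w
      have sA: "(\<lambda>w. F (Inl w)) summable_on A.loops"
        by (rule abs_summable_summable) (use A.trace_formula(1)[OF y'(1)] in \<open>simp add: F_def b_def m_def norm_mult\<close>)
      have sB: "(\<lambda>w. F (Inr w)) summable_on B.loops"
        by (rule abs_summable_summable) (use B.trace_formula(1)[OF y'(2)] in \<open>simp add: F_def b_def m_def norm_mult\<close>)
      have "(\<Sum>\<^sub>\<infinity>w\<in>W. F w) = (\<Sum>\<^sub>\<infinity>w\<in>Inl ` A.loops. F w) + (\<Sum>\<^sub>\<infinity>w\<in>Inr ` B.loops. F w)"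
        unfolding W_def using sA sB
        by (intro infsum_Un_disjoint disj) (simp_all add: summable_on_reindex o_def)
      also have "(\<Sum>\<^sub>\<infinity>w\<in>Inl ` A.loops. F w) = At.resolvent_trace (Complex 0 y)"
        unfolding At.trace_formula(2)[OF y'(1)] phase
        by (simp add: infsum_reindex o_def F_def b_def m_def)
      also have "(\<Sum>\<^sub>\<infinity>w\<in>Inr ` B.loops. F w) = - Bt.resolvent_trace (Complex 0 y)"
        unfolding Bt.trace_formula(2)[OF y'(2)] phase
        by (simp add: infsum_reindex o_def F_def b_def m_def infsum_uminus)
      also have "At.resolvent_trace (Complex 0 y) = Bt.resolvent_trace (Complex 0 y)"
        using y'(3) dims[OF t] by (intro resolvent_trace_eqI sc) auto
      finally show "(\<Sum>\<^sub>\<infinity>w\<in>W. b w * of_real (exp (- (y * m w)))) = 0"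
        by (simp add: F_def)
    next
      have y': "A.large_height y0" "B.large_height y0"
        using y1 y2 by (auto simp: y0_def)
      show "(\<lambda>w. cmod (b w) * exp (- (y0 * m w))) summable_on W"
        unfolding W_def using A.trace_formula(1)[OF y'(1)] B.trace_formula(1)[OF y'(2)]
        by (intro summable_on_Un_disjoint disj)
          (simp_all add: summable_on_reindex o_def b_def m_def norm_mult)
    qed
    moreover have "{w\<in>W. m w = x} = Inl ` E \<union> Inr ` E'"
      by (auto simp: W_def m_def E_def E'_def)
    moreover have "(\<Sum>w\<in>Inl ` E \<union> Inr ` E'. b w) = (\<Sum>w\<in>E. b (Inl w)) + (\<Sum>w\<in>E'. b (Inr w))"
      using finE by (subst sum.union_disjoint) (auto simp: sum.reindex)
    ultimately show ?thesis
      by (simp add: b_def sum_negf)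
  qed
  define V where "V = A.loop_phase ` E \<union> B.loop_phase ` E'"
  define c where "c u = (\<Sum>w\<in>{w\<in>E. A.loop_phase w = u}. A.loop_coeff w) -
      (\<Sum>w\<in>{w\<in>E'. B.loop_phase w = u}. B.loop_coeff w)" for u
  have V: "finite V"
    using finE by (simp add: V_def)
  have zero: "(\<Sum>u\<in>V. c u * exp (\<i> * of_real (t * u))) = 0" if "0 \<le> t" "t < \<epsilon>" for t
  proof -
    have "(\<Sum>u\<in>V. c u * exp (\<i> * of_real (t * u))) =
        (\<Sum>w\<in>E. A.loop_coeff w * exp (\<i> * of_real (t * A.loop_phase w))) -
        (\<Sum>w\<in>E'. B.loop_coeff w * exp (\<i> * of_real (t * B.loop_phase w)))"
      using sum_eq_regrouped[OF finE(1) V, of A.loop_phase A.loop_coeff "\<lambda>u. exp (\<i> * of_real (t * u))"]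
        sum_eq_regrouped[OF finE(2) V, of B.loop_phase B.loop_coeff "\<lambda>u. exp (\<i> * of_real (t * u))"]
      by (simp add: V_def c_def left_diff_distrib sum_subtractf)
    then show ?thesis
      using relation[OF that] by simp
  qed
  have "c v = 0"
  proof (cases "v \<in> V")
    case True
    then show ?thesis
      using exponentials_independent[OF V \<open>\<epsilon> > 0\<close> zero] by blast
  next
    case False
    then have empty: "{w\<in>E. A.loop_phase w = v} = {}" "{w\<in>E'. B.loop_phase w = v} = {}"
      by (auto simp: V_def)
    show ?thesis
      unfolding c_def empty by simp
  qed
  then show ?thesis
    by (simp add: c_def E_def E'_def conj_assoc)
qed

section \<open>The eigenvalue equation on an edge\<close>

lemma sobolev_deriv_cong:
  assumes "0 \<le> l" "\<And>x. x \<in> {0..l} \<Longrightarrow> f x = f2 x" "\<And>x. x \<in> {0..l} \<Longrightarrow> h x = h2 x"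
    and "sobolev_deriv l f h"
  shows "sobolev_deriv l f2 h2"
proof -
  have h: "(\<lambda>x. indicator {0..l} x *\<^sub>R h x) = (\<lambda>x. indicator {0..l} x *\<^sub>R h2 x)"
    using assms(3) by (intro ext) (simp split: split_indicator)
  have h': "(\<lambda>x. indicator {0..l} x *\<^sub>R (cmod (h x))\<^sup>2) = (\<lambda>x. indicator {0..l} x *\<^sub>R (cmod (h2 x))\<^sup>2)"
    using assms(3) by (intro ext) (simp split: split_indicator)
  have "square_integrable l h2"
    using assms(4) unfolding sobolev_deriv_def square_integrable_def set_borel_measurable_def set_integrable_def h h'
    by blast
  moreover have "f2 x = f2 0 + (LINT t:{0..x}|lborel. h2 t)" if x: "x \<in> {0..l}" for x
  proof -
    have "(LINT t:{0..x}|lborel. h2 t) = (LINT t:{0..x}|lborel. h t)"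
      using x assms(3) by (intro set_lebesgue_integral_cong) auto
    moreover have "f x = f 0 + (LINT t:{0..x}|lborel. h t)"
      using assms(4) x unfolding sobolev_deriv_def by blast
    ultimately show ?thesis
      using assms(2)[OF x] assms(2)[of 0] assms(1) by simp
  qed
  ultimately show ?thesis
    unfolding sobolev_deriv_def by blast
qed

lemma square_integrable_continuous:
  assumes "continuous_on {0..l} h"
  shows "square_integrable l h"
  unfolding square_integrable_def
proof
  show "set_borel_measurable lborel {0..l} h"
    using borel_measurable_continuous_on_indicator[OF _ assms] by (simp add: set_borel_measurable_def)
  show "set_integrable lborel {0..l} (\<lambda>x. (cmod (h x))\<^sup>2)"
    by (intro borel_integrable_atLeastAtMost' continuous_intros assms)
qed

lemma sobolev_deriv_of_C1:
  assumes der: "\<And>x. x \<in> {0..l} \<Longrightarrow> (f has_vector_derivative h x) (at x within {0..l})"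
    and cont: "continuous_on {0..l} h"
  shows "sobolev_deriv l f h"
  unfolding sobolev_deriv_def
proof (intro conjI ballI square_integrable_continuous cont)
  fix x assume x: "x \<in> {0..l}"
  have "(LINT t:{0..x}|lborel. h t) = f x - f 0"
    unfolding set_lebesgue_integral_def
  proof (rule integral_FTC_atLeastAtMost)
    show "continuous_on {0..x} h"
      using x by (intro continuous_on_subset[OF cont]) auto
    show "(f has_vector_derivative h t) (at t within {0..x})" if "0 \<le> t" "t \<le> x" for t
      using that x by (intro has_vector_derivative_within_subset[OF der]) auto
  qed (use x in auto)
  then show "f x = f 0 + (LINT t:{0..x}|lborel. h t)"
    by simp
qed

lemma square_integrable_imp_integrable:
  assumes "square_integrable l h"
  shows "set_integrable lborel {0..l} h"
  unfolding set_integrable_def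
proof (rule Bochner_Integration.integrable_bound)
  have "set_integrable lborel {0..l} (\<lambda>x. 1 + (cmod (h x))\<^sup>2)"
    using assms borel_integrable_atLeastAtMost'[of 0 l "\<lambda>_. 1 :: real"]
    by (intro set_integral_add) (auto simp: square_integrable_def)
  then show "integrable lborel (\<lambda>x. indicator {0..l} x *\<^sub>R (1 + (cmod (h x))\<^sup>2))"
    by (simp add: set_integrable_def)
  show "(\<lambda>x. indicator {0..l} x *\<^sub>R h x) \<in> borel_measurable lborel"
    using assms by (simp add: square_integrable_def set_borel_measurable_def)
  have "cmod u \<le> 1 + (cmod u)\<^sup>2" for u
  proof -
    have "2 * cmod u \<le> 1 + (cmod u)\<^sup>2"
      using zero_le_power2[of "cmod u - 1"] by (simp add: power2_diff)
    then show ?thesis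
      using norm_ge_zero[of u] zero_le_power2[of "cmod u"] by linarith
  qed
  then show "AE x in lborel. norm (indicator {0..l} x *\<^sub>R h x) \<le> norm (indicator {0..l} x *\<^sub>R (1 + (cmod (h x))\<^sup>2))"
    by (intro always_eventually allI) (auto simp: indicator_def abs_of_nonneg)
qed

lemma sobolev_integral:
  assumes "sobolev_deriv l f h" "x \<in> {0..l}"
  shows "f x = f 0 + integral {0..x} h" "h integrable_on {0..x}"
proof -
  have "set_integrable lborel {0..x} h"
    using square_integrable_imp_integrable[of l h] assms
    by (auto simp: sobolev_deriv_def intro: set_integrable_subset)
  note eq = set_borel_integral_eq_integral[OF this]
  then show "h integrable_on {0..x}"
    by blast
  have "f x = f 0 + (LINT t:{0..x}|lborel. h t)"
    using assms unfolding sobolev_deriv_def by blast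
  then show "f x = f 0 + integral {0..x} h"
    by (simp only: eq)
qed

lemma sobolev_continuous:
  assumes "sobolev_deriv l f h" "0 \<le> l"
  shows "continuous_on {0..l} f"
proof -
  have "continuous_on {0..l} (\<lambda>x. f 0 + integral {0..x} h)"
    using sobolev_integral(2)[OF assms(1), of l] assms(2)
    by (intro continuous_intros indefinite_integral_continuous_1) auto
  then show ?thesis
    by (rule continuous_on_eq) (simp only: sobolev_integral(1)[OF assms(1), symmetric])
qed

text \<open>
  Changing \<open>h\<close> on a null set does not affect its integrals, so \<open>f\<close> is a primitive of the continuous
  function \<open>h2\<close>.
\<close>
lemma sobolev_deriv_classical:
  assumes f: "sobolev_deriv l f h" and cont: "continuous_on {0..l} h2"
    and ae: "AE x in lborel. x \<in> {0..l} \<longrightarrow> h x = h2 x" and x: "x \<in> {0..l}"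
  shows "(f has_vector_derivative h2 x) (at x within {0..l})"
proof -
  have eq: "f u = f 0 + integral {0..u} h2" if u: "u \<in> {0..l}" for u
  proof -
    obtain N where N: "N \<in> null_sets lborel" "{x \<in> space lborel. \<not> (x \<in> {0..l} \<longrightarrow> h x = h2 x)} \<subseteq> N"
      using ae by (auto simp: eventually_ae_filter)
    have "negligible N"
      using N(1) by (simp add: negligible_iff_null_sets null_sets_completionI)
    then have "integral {0..u} h2 = integral {0..u} h"
      by (rule integral_spike) (use N(2) u in auto)
    then show ?thesis
      using sobolev_integral(1)[OF f u] by simp
  qed
  have "((\<lambda>u. f 0 + integral {0..u} h2) has_vector_derivative 0 + h2 x) (at x within {0..l})"
    by (intro has_vector_derivative_add has_vector_derivative_const integral_has_vector_derivative cont x)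
  from has_vector_derivative_transform[OF x eq this] show ?thesis
    by simp
qed

lemma has_vector_derivative_unique_Icc:
  assumes "0 < l" "x \<in> {0..l}"
    and "(f has_vector_derivative a) (at x within {0..l})" "(f has_vector_derivative b) (at x within {0..l})"
  shows "a = (b :: complex)"
  by (rule vector_derivative_unique_within_closed_interval[of 0 l x f]) (use assms in auto)

definition gauged_wave :: "(real \<Rightarrow> real) \<Rightarrow> real \<Rightarrow> complex \<Rightarrow> complex \<Rightarrow> real \<Rightarrow> complex" where
  "gauged_wave \<phi> k A B x =
     exp (- (\<i> * of_real (\<phi> x))) * (A * exp (\<i> * of_real (k * x)) + B * exp (- (\<i> * of_real (k * x))))"

text \<open>The covariant derivative of \<open>gauged_wave \<phi> k A B\<close>.\<close>
definition gauged_dwave :: "(real \<Rightarrow> real) \<Rightarrow> real \<Rightarrow> complex \<Rightarrow> complex \<Rightarrow> real \<Rightarrow> complex" where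
  "gauged_dwave \<phi> k A B x = \<i> * of_real k * (exp (- (\<i> * of_real (\<phi> x))) *
     (A * exp (\<i> * of_real (k * x)) - B * exp (- (\<i> * of_real (k * x)))))"

text \<open>
  A magnetic potential \<open>b\<close> on \<open>[0,l]\<close> with primitive \<open>\<phi>\<close>; the covariant derivative is
  \<open>d/dx + \<i> b\<close>, and multiplication by \<open>exp (\<i> \<phi>)\<close> turns it into \<open>d/dx\<close>.
\<close>
locale edge_potential =
  fixes l :: real and b b' \<phi> :: "real \<Rightarrow> real" and k :: real
  assumes l: "0 < l" and k: "k \<noteq> 0"
    and deriv_\<phi>: "x \<in> {0..l} \<Longrightarrow> (\<phi> has_real_derivative b x) (at x within {0..l})"
    and deriv_b: "x \<in> {0..l} \<Longrightarrow> (b has_real_derivative b' x) (at x within {0..l})"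
    and cont_b': "continuous_on {0..l} b'"
begin

lemma cont_b: "continuous_on {0..l} b"
  using deriv_b by (rule DERIV_continuous_on)

lemma cont_\<phi>: "continuous_on {0..l} \<phi>"
  using deriv_\<phi> by (rule DERIV_continuous_on)

abbreviation wave :: "complex \<Rightarrow> complex \<Rightarrow> real \<Rightarrow> complex" where
  "wave \<equiv> gauged_wave \<phi> k"

abbreviation dwave :: "complex \<Rightarrow> complex \<Rightarrow> real \<Rightarrow> complex" where
  "dwave \<equiv> gauged_dwave \<phi> k"

lemma exp_deriv:
  assumes x: "x \<in> {0..l}"
  shows "((\<lambda>x. exp (\<i> * of_real (c * \<phi> x + d * x))) has_vector_derivative
    (\<i> * of_real (c * b x + d) * exp (\<i> * of_real (c * \<phi> x + d * x)))) (at x within {0..l})"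
proof -
  have "((\<lambda>x. c * \<phi> x + d * x) has_real_derivative c * b x + d) (at x within {0..l})"
    by (intro DERIV_add DERIV_cmult deriv_\<phi> x DERIV_cmult_Id)
  then have "((\<lambda>x. \<i> * complex_of_real (c * \<phi> x + d * x)) has_vector_derivative \<i> * of_real (c * b x + d)) (at x within {0..l})"
    by (intro has_vector_derivative_mult_right has_vector_derivative_of_real)
  from field_vector_diff_chain_within[OF this, of exp "exp (\<i> * of_real (c * \<phi> x + d * x))"]
  show ?thesis
    by (simp add: o_def DERIV_exp has_field_derivative_at_within mult.commute)
qed

lemma wave_deriv:
  assumes x: "x \<in> {0..l}"
  shows "(wave A B has_vector_derivative dwave A B x - \<i> * of_real (b x) * wave A B x) (at x within {0..l})"
proof -
  have eq: "wave A B = (\<lambda>x. A * exp (\<i> * of_real ((-1) * \<phi> x + k * x)) + B * exp (\<i> * of_real ((-1) * \<phi> x + (-k) * x)))"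
    by (simp add: fun_eq_iff gauged_wave_def algebra_simps exp_add exp_diff exp_minus divide_inverse)
  have "(wave A B has_vector_derivative A * (\<i> * of_real ((-1) * b x + k) * exp (\<i> * of_real ((-1) * \<phi> x + k * x))) +
      B * (\<i> * of_real ((-1) * b x + (-k)) * exp (\<i> * of_real ((-1) * \<phi> x + (-k) * x)))) (at x within {0..l})"
    unfolding eq by (intro has_vector_derivative_add has_vector_derivative_mult_right exp_deriv x)
  also have "A * (\<i> * of_real ((-1) * b x + k) * exp (\<i> * of_real ((-1) * \<phi> x + k * x))) +
      B * (\<i> * of_real ((-1) * b x + (-k)) * exp (\<i> * of_real ((-1) * \<phi> x + (-k) * x))) =
      dwave A B x - \<i> * of_real (b x) * wave A B x"
    by (simp add: gauged_dwave_def gauged_wave_def algebra_simps exp_add exp_diff exp_minus divide_inverse)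
  finally show ?thesis .
qed

lemma dwave_eq_wave: "dwave A B = wave (\<i> * of_real k * A) (- (\<i> * of_real k * B))"
  by (simp add: fun_eq_iff gauged_wave_def gauged_dwave_def algebra_simps)

lemma dwave_deriv:
  assumes x: "x \<in> {0..l}"
  shows "(dwave A B has_vector_derivative - (of_real (k\<^sup>2) * wave A B x) - \<i> * of_real (b x) * dwave A B x) (at x within {0..l})"
proof -
  have "dwave (\<i> * of_real k * A) (- (\<i> * of_real k * B)) x = - (of_real (k\<^sup>2) * wave A B x)"
    by (simp add: gauged_wave_def gauged_dwave_def power2_eq_square algebra_simps)
  then show ?thesis
    using wave_deriv[OF x, of "\<i> * of_real k * A" "- (\<i> * of_real k * B)"] by (simp add: dwave_eq_wave[of A B])
qed

lemma cont_wave: "continuous_on {0..l} (wave A B)" "continuous_on {0..l} (dwave A B)"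
  unfolding gauged_wave_def gauged_dwave_def by (intro continuous_intros cont_\<phi>)+

text \<open>
  The function in the second statement is the ordinary derivative of the wave; the Laplacian is defined on
  functions that have a second derivative in this sense.
\<close>
lemma wave_sobolev:
  shows "sobolev_deriv l (wave A B) (\<lambda>x. dwave A B x - \<i> * of_real (b x) * wave A B x)"
    and "\<exists>f''. sobolev_deriv l (\<lambda>x. dwave A B x - \<i> * of_real (b x) * wave A B x) f''"
    and "sobolev_deriv l (dwave A B) (\<lambda>x. - (of_real (k\<^sup>2) * wave A B x) - \<i> * of_real (b x) * dwave A B x)"
proof -
  let ?f' = "\<lambda>x. dwave A B x - \<i> * of_real (b x) * wave A B x"
  let ?g' = "\<lambda>x. - (of_real (k\<^sup>2) * wave A B x) - \<i> * of_real (b x) * dwave A B x"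
  show "sobolev_deriv l (wave A B) ?f'" "sobolev_deriv l (dwave A B) ?g'"
    by (intro sobolev_deriv_of_C1 wave_deriv dwave_deriv continuous_intros cont_wave cont_b; assumption)+
  have "(?f' has_vector_derivative ?g' x - (\<i> * of_real (b x) * ?f' x + \<i> * of_real (b' x) * wave A B x)) (at x within {0..l})"
    if x: "x \<in> {0..l}" for x
  proof -
    have "((\<lambda>x. \<i> * of_real (b x)) has_vector_derivative \<i> * of_real (b' x)) (at x within {0..l})"
      by (intro has_vector_derivative_mult_right has_vector_derivative_of_real deriv_b x)
    then show ?thesis
      by (intro has_vector_derivative_diff has_vector_derivative_mult dwave_deriv wave_deriv x)
  qed
  then have "sobolev_deriv l ?f' (\<lambda>x. ?g' x - (\<i> * of_real (b x) * ?f' x + \<i> * of_real (b' x) * wave A B x))"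
    by (intro sobolev_deriv_of_C1 continuous_intros cont_wave cont_b cont_b')
  then show "\<exists>f''. sobolev_deriv l ?f' f''" by blast
qed

text \<open>
  The two combinations \<open>g + \<i> k f\<close> and \<open>g - \<i> k f\<close> decouple the equation: multiplied by
  \<open>exp (\<i> (\<phi> x - k x))\<close> and \<open>exp (\<i> (\<phi> x + k x))\<close> they have derivative zero.
\<close>
lemma eigenfunction_is_wave:
  assumes f: "\<And>x. x \<in> {0..l} \<Longrightarrow> (f has_vector_derivative g x - \<i> * of_real (b x) * f x) (at x within {0..l})"
    and g: "\<And>x. x \<in> {0..l} \<Longrightarrow> (g has_vector_derivative - (of_real (k\<^sup>2) * f x) - \<i> * of_real (b x) * g x) (at x within {0..l})"
  obtains A B where "\<And>x. x \<in> {0..l} \<Longrightarrow> f x = wave A B x" "\<And>x. x \<in> {0..l} \<Longrightarrow> g x = dwave A B x"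
proof -
  have conserved: "\<exists>C. \<forall>x\<in>{0..l}. (g x + \<i> * of_real q * f x) * exp (\<i> * of_real (\<phi> x + (-q) * x)) = C" if q: "q\<^sup>2 = k\<^sup>2" for q
  proof -
    let ?P = "\<lambda>x. (g x + \<i> * of_real q * f x) * exp (\<i> * of_real (1 * \<phi> x + (-q) * x))"
    have "(?P has_vector_derivative 0) (at x within {0..l})" if x: "x \<in> {0..l}" for x
    proof -
      let ?e = "exp (\<i> * of_real (1 * \<phi> x + (-q) * x))"
      have "(?P has_vector_derivative (g x + \<i> * of_real q * f x) * (\<i> * of_real (1 * b x + (-q)) * ?e) +
          ((- (of_real (k\<^sup>2) * f x) - \<i> * of_real (b x) * g x) + \<i> * of_real q * (g x - \<i> * of_real (b x) * f x)) * ?e)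
          (at x within {0..l})"
        by (intro has_vector_derivative_mult has_vector_derivative_add has_vector_derivative_mult_right f g exp_deriv x)
      moreover have "(g x + \<i> * of_real q * f x) * (\<i> * of_real (1 * b x + (-q)) * ?e) +
          ((- (of_real (k\<^sup>2) * f x) - \<i> * of_real (b x) * g x) + \<i> * of_real q * (g x - \<i> * of_real (b x) * f x)) * ?e = 0"
        unfolding q[symmetric] by (simp add: algebra_simps power2_eq_square)
      ultimately show ?thesis by simp
    qed
    then have "\<exists>C. \<forall>x\<in>{0..l}. ?P x = C"
      by (intro has_derivative_zero_constant) (simp_all add: has_vector_derivative_def)
    then show ?thesis
      by (simp only: mult_1_left)
  qed
  obtain C where C: "\<And>x. x \<in> {0..l} \<Longrightarrow> (g x + \<i> * of_real k * f x) * exp (\<i> * of_real (\<phi> x + (-k) * x)) = C"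
    using conserved[of k] by blast
  obtain D where D: "\<And>x. x \<in> {0..l} \<Longrightarrow> (g x + \<i> * of_real (-k) * f x) * exp (\<i> * of_real (\<phi> x + (-(-k)) * x)) = D"
    using conserved[of "-k"] by auto
  define A where "A = C / (2 * \<i> * of_real k)"
  define B where "B = - D / (2 * \<i> * of_real k)"
  have plus: "g x + \<i> * of_real k * f x = C * (exp (- (\<i> * of_real (\<phi> x))) * exp (\<i> * of_real (k * x)))" if "x \<in> {0..l}" for x
  proof -
    have "C * (exp (- (\<i> * of_real (\<phi> x))) * exp (\<i> * of_real (k * x))) = C * exp (- (\<i> * of_real (\<phi> x + (-k) * x)))"
      by (simp add: exp_add[symmetric] algebra_simps)
    also have "\<dots> = g x + \<i> * of_real k * f x"
      unfolding C[OF that, symmetric] by (simp only: mult.assoc exp_minus_inverse mult_1_right)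
    finally show ?thesis
      by (rule sym)
  qed
  have minus: "g x - \<i> * of_real k * f x = D * (exp (- (\<i> * of_real (\<phi> x))) * exp (- (\<i> * of_real (k * x))))" if "x \<in> {0..l}" for x
  proof -
    have "D * (exp (- (\<i> * of_real (\<phi> x))) * exp (- (\<i> * of_real (k * x)))) = D * exp (- (\<i> * of_real (\<phi> x + (-(-k)) * x)))"
      by (simp add: exp_add[symmetric] algebra_simps)
    also have "\<dots> = g x + \<i> * of_real (- k) * f x"
      unfolding D[OF that, symmetric] by (simp only: mult.assoc exp_minus_inverse mult_1_right)
    finally show ?thesis
      by simp
  qed
  show thesis
  proof (rule that[of A B])
    fix x assume x: "x \<in> {0..l}"
    have C': "C = 2 * \<i> * of_real k * A" and D': "D = - (2 * \<i> * of_real k * B)"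
      using k by (simp_all add: A_def B_def)
    have "2 * \<i> * of_real k * f x = (g x + \<i> * of_real k * f x) - (g x - \<i> * of_real k * f x)"
      by simp
    also have "\<dots> = 2 * \<i> * of_real k * wave A B x"
      unfolding plus[OF x] minus[OF x] C' D' by (simp add: gauged_wave_def algebra_simps)
    finally show "f x = wave A B x"
      using k by simp
    have "2 * g x = (g x + \<i> * of_real k * f x) + (g x - \<i> * of_real k * f x)"
      by simp
    also have "\<dots> = 2 * dwave A B x"
      unfolding plus[OF x] minus[OF x] C' D' by (simp add: gauged_dwave_def algebra_simps)
    finally show "g x = dwave A B x"
      by simp
  qed
qed

end

section \<open>Quantum graphs as scattering systems\<close>

text \<open>\<open>2 P - 1\<close> is an isometry if \<open>P\<close> is the projection onto the constants.\<close>
lemma reflection_in_constants_isometry: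
  fixes y :: "'d \<Rightarrow> complex"
  assumes "finite D"
  shows "(\<Sum>d\<in>D. (cmod (2 / of_nat (card D) * (\<Sum>d\<in>D. y d) - y d))\<^sup>2) = (\<Sum>d\<in>D. (cmod (y d))\<^sup>2)"
proof (cases "D = {}")
  case False
  define s where "s = (\<Sum>d\<in>D. y d)"
  define c where "c = 2 / of_nat (card D) * s"
  have n: "card D > 0"
    using assms False by (simp add: card_gt_0_iff)
  have s: "s = (real (card D) / 2) *\<^sub>R c"
    using n by (simp add: c_def scaleR_conv_of_real)
  have "(cmod (c - y d))\<^sup>2 = (cmod c)\<^sup>2 - 2 * inner c (y d) + (cmod (y d))\<^sup>2" for d
    unfolding power2_norm_eq_inner by (simp add: inner_diff inner_commute)
  then have "(\<Sum>d\<in>D. (cmod (c - y d))\<^sup>2) = real (card D) * (cmod c)\<^sup>2 - 2 * inner c s + (\<Sum>d\<in>D. (cmod (y d))\<^sup>2)"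
    by (simp add: sum.distrib sum_subtractf sum_distrib_left[symmetric] inner_sum_right s_def)
  also have "2 * inner c s = real (card D) * (cmod c)\<^sup>2"
    unfolding s by (simp add: power2_norm_eq_inner)
  finally show ?thesis
    by (simp add: c_def s_def)
qed simp

definition fscale :: "complex \<Rightarrow> ('e \<Rightarrow> real \<Rightarrow> complex) \<Rightarrow> 'e \<Rightarrow> real \<Rightarrow> complex" where
  "fscale c f = (\<lambda>e x. c * f e x)"

interpretation ffun: vector_space fscale
  by unfold_locales (simp_all add: fscale_def fun_eq_iff algebra_simps)

lemma dim_image_of_injective:
  assumes "Vector_Spaces.linear cscale fscale \<Phi>" "cfun.subspace K" "inj_on \<Phi> K"
  shows "ffun.dim (\<Phi> ` K) = cfun.dim K"
proof -
  interpret \<Phi>: Vector_Spaces.linear cscale fscale \<Phi> by fact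
  obtain B where B: "B \<subseteq> K" "cfun.independent B" "K \<subseteq> cfun.span B" "card B = cfun.dim K"
    by (rule cfun.basis_exists)
  have span: "cfun.span B = K"
    using B cfun.span_minimal[OF B(1) assms(2)] by blast
  have inj: "inj_on \<Phi> (cfun.span B)"
    unfolding span by (rule assms(3))
  have s1: "ffun.span (\<Phi> ` B) = \<Phi> ` K"
    using \<Phi>.span_image[of B] by (simp only: span)
  have s2: "ffun.span (\<Phi> ` K) = \<Phi> ` K"
    using \<Phi>.subspace_image[OF assms(2)] by (simp only: ffun.span_eq_iff)
  have indep: "ffun.independent (\<Phi> ` B)"
    using \<Phi>.independent_injective_image[OF B(2) inj] .
  have "ffun.dim (\<Phi> ` K) = card (\<Phi> ` B)"
    using ffun.dim_eq_card[OF trans[OF s1 s2[symmetric]] indep] .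
  also have "\<dots> = card B"
    by (rule card_image[OF inj_on_subset[OF assms(3) B(1)]])
  finally show ?thesis
    using B(4) by simp
qed

context quantum_graph
begin

definition bonds :: "('e \<times> bool) set" where
  "bonds = arcs G \<times> UNIV"

definition rev_bond :: "'e \<times> bool \<Rightarrow> 'e \<times> bool" where
  "rev_bond d = (fst d, \<not> snd d)"

definition degree :: "'v \<Rightarrow> nat" where
  "degree v = in_degree G v + out_degree G v"

definition outgoing :: "'v \<Rightarrow> ('e \<times> bool) set" where
  "outgoing v = {d \<in> bonds. start_vertex d = v}"

text \<open>
  The solution of the vertex conditions for given incoming amplitudes: every outgoing bond receives
  the value \<open>2 / deg v\<close> times the sum of the incoming amplitudes at its start vertex \<open>v\<close>, minus the
  amplitude arriving along its own reversal.
\<close>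
definition vertex_scattering :: "'e \<times> bool \<Rightarrow> 'e \<times> bool \<Rightarrow> complex" where
  "vertex_scattering d d' =
     (if end_vertex d' = start_vertex d then 2 / of_nat (degree (start_vertex d)) else 0) -
     (if d' = rev_bond d then 1 else 0)"

definition bond_len :: "'e \<times> bool \<Rightarrow> real" where
  "bond_len d = L (fst d)"

text \<open>
  Parallel transport for \<open>d/dx + 2 \<pi> \<i> \<beta>\<close> multiplies by \<open>exp (- 2 \<pi> \<i> \<integral>\<beta>)\<close>, which accounts for the sign.
\<close>
definition bond_flux :: "('e \<Rightarrow> real \<Rightarrow> real) \<Rightarrow> 'e \<times> bool \<Rightarrow> real" where
  "bond_flux \<beta> d = - (2 * pi * ((if snd d then 1 else -1) * integral {0..L (fst d)} (\<beta> (fst d))))"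

lemma finite_bonds: "finite bonds"
  by (simp add: bonds_def)

lemma rev_bond_simps [simp]:
  "rev_bond (rev_bond d) = d" "start_vertex (rev_bond d) = end_vertex d"
  "end_vertex (rev_bond d) = start_vertex d" "rev_bond d \<in> bonds \<longleftrightarrow> d \<in> bonds" "fst (rev_bond d) = fst d"
  by (simp_all add: rev_bond_def start_vertex_def end_vertex_def bonds_def mem_Times_iff)

lemma start_vertex_in_verts: "d \<in> bonds \<Longrightarrow> start_vertex d \<in> verts G"
  by (auto simp: bonds_def start_vertex_def)

lemma outgoing_eq: "outgoing v = (\<lambda>e. (e, True)) ` out_arcs G v \<union> (\<lambda>e. (e, False)) ` in_arcs G v"
  by (auto simp: outgoing_def bonds_def start_vertex_def image_iff)

lemma finite_outgoing [simp]: "finite (outgoing v)"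
  by (simp add: outgoing_def finite_bonds)

lemma sum_outgoing:
  "(\<Sum>d\<in>outgoing v. F d) = (\<Sum>e\<in>out_arcs G v. F (e, True)) + (\<Sum>e\<in>in_arcs G v. F (e, False))"
  unfolding outgoing_eq
  by (subst sum.union_disjoint) (auto simp: finite_in_arcs finite_out_arcs sum.reindex inj_on_def)

lemma card_outgoing: "card (outgoing v) = degree v"
  using sum_outgoing[of "\<lambda>_. 1 :: nat" v] by (simp add: degree_def in_degree_def out_degree_def)

lemma sum_incoming:
  "(\<Sum>d\<in>{d\<in>bonds. end_vertex d = v}. F d) = (\<Sum>d\<in>outgoing v. F (rev_bond d))"
  by (rule sum.reindex_bij_witness[of _ rev_bond rev_bond]) (auto simp: outgoing_def)

lemma vertex_scattering_apply:
  fixes x :: "'e \<times> bool \<Rightarrow> complex"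
  assumes d: "d \<in> bonds"
  shows "(\<Sum>d'\<in>bonds. vertex_scattering d d' * x d') =
    2 / of_nat (degree (start_vertex d)) * (\<Sum>d'\<in>outgoing (start_vertex d). x (rev_bond d')) - x (rev_bond d)"
proof -
  have "(\<Sum>d'\<in>bonds. vertex_scattering d d' * x d') =
      (\<Sum>d'\<in>bonds. if end_vertex d' = start_vertex d then 2 / of_nat (degree (start_vertex d)) * x d' else 0) -
      (\<Sum>d'\<in>bonds. if d' = rev_bond d then x d' else 0)"
    unfolding sum_subtractf[symmetric] by (intro sum.cong) (auto simp: vertex_scattering_def algebra_simps)
  also have "(\<Sum>d'\<in>bonds. if d' = rev_bond d then x d' else 0) = x (rev_bond d)"
    using d finite_bonds by simp
  also have "(\<Sum>d'\<in>bonds. if end_vertex d' = start_vertex d then 2 / of_nat (degree (start_vertex d)) * x d' else 0) =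
      2 / of_nat (degree (start_vertex d)) * (\<Sum>d'\<in>{d'\<in>bonds. end_vertex d' = start_vertex d}. x d')"
    using finite_bonds by (simp add: sum.inter_filter[symmetric] sum_distrib_left)
  finally show ?thesis
    by (simp add: sum_incoming)
qed

lemma sum_bonds_by_vertex: "(\<Sum>d\<in>bonds. F d) = (\<Sum>v\<in>verts G. \<Sum>d\<in>outgoing v. F d)"
  unfolding outgoing_def
  by (rule sum.group[symmetric]) (auto simp: finite_bonds start_vertex_in_verts)

lemma scattering_bonds: "scattering bonds vertex_scattering bond_len"
proof
  fix x :: "'e \<times> bool \<Rightarrow> complex"
  have "(\<Sum>d\<in>bonds. (cmod (\<Sum>d'\<in>bonds. vertex_scattering d d' * x d'))\<^sup>2) =
      (\<Sum>v\<in>verts G. \<Sum>d\<in>outgoing v.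
        (cmod (2 / of_nat (card (outgoing v)) * (\<Sum>d\<in>outgoing v. x (rev_bond d)) - x (rev_bond d)))\<^sup>2)"
  proof (subst sum_bonds_by_vertex, intro sum.cong refl)
    fix v d assume "d \<in> outgoing v"
    then have "d \<in> bonds" "start_vertex d = v"
      by (auto simp: outgoing_def)
    then show "(cmod (\<Sum>d'\<in>bonds. vertex_scattering d d' * x d'))\<^sup>2 =
        (cmod (2 / of_nat (card (outgoing v)) * (\<Sum>d\<in>outgoing v. x (rev_bond d)) - x (rev_bond d)))\<^sup>2"
      by (simp add: vertex_scattering_apply card_outgoing)
  qed
  also have "\<dots> = (\<Sum>v\<in>verts G. \<Sum>d\<in>outgoing v. (cmod (x (rev_bond d)))\<^sup>2)"
    by (simp only: reflection_in_constants_isometry[OF finite_outgoing])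
  also have "\<dots> = (\<Sum>d\<in>bonds. (cmod (x (rev_bond d)))\<^sup>2)"
    by (rule sum_bonds_by_vertex[symmetric])
  also have "\<dots> = (\<Sum>d\<in>bonds. (cmod (x d))\<^sup>2)"
    by (rule sum.reindex_bij_witness[of _ rev_bond rev_bond]) auto
  finally show "l2_norm bonds (\<lambda>i. \<Sum>j\<in>bonds. vertex_scattering i j * x j) = l2_norm bonds x"
    by (simp add: l2_norm_def L2_set_def)
qed (auto simp: finite_bonds bond_len_def bonds_def length_pos)

text \<open>
  \<open>out d\<close> is the amplitude of the wave leaving along \<open>d\<close>, and \<open>inn d\<close> that of the wave arriving
  along \<open>d\<close>. Their sum is the value of the function at the vertex, and their difference is its
  normal derivative up to a factor.
\<close>
lemma vertex_conditions_iff_scattering: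
  fixes out inn :: "'e \<times> bool \<Rightarrow> complex"
  shows "(\<exists>\<nu>. \<forall>d\<in>bonds. out d + inn (rev_bond d) = \<nu> (start_vertex d)) \<and>
      (\<forall>v\<in>verts G. (\<Sum>d\<in>outgoing v. out d - inn (rev_bond d)) = 0) \<longleftrightarrow>
    (\<forall>d\<in>bonds. out d = (\<Sum>d'\<in>bonds. vertex_scattering d d' * inn d'))"
proof -
  define c where "c v = 2 / of_nat (degree v) * (\<Sum>d\<in>outgoing v. inn (rev_bond d))" for v
  have rhs: "(\<Sum>d'\<in>bonds. vertex_scattering d d' * inn d') = c (start_vertex d) - inn (rev_bond d)" if "d \<in> bonds" for d
    by (simp add: vertex_scattering_apply that c_def)
  show ?thesis
  proof (intro iffI conjI ballI)
    fix d assume d: "d \<in> bonds"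
    assume "(\<exists>\<nu>. \<forall>d\<in>bonds. out d + inn (rev_bond d) = \<nu> (start_vertex d)) \<and>
      (\<forall>v\<in>verts G. (\<Sum>d\<in>outgoing v. out d - inn (rev_bond d)) = 0)"
    then obtain \<nu> where \<nu>: "\<And>d. d \<in> bonds \<Longrightarrow> out d + inn (rev_bond d) = \<nu> (start_vertex d)"
      and K: "\<And>v. v \<in> verts G \<Longrightarrow> (\<Sum>d\<in>outgoing v. out d - inn (rev_bond d)) = 0"
      by blast
    define v where "v = start_vertex d"
    have "d \<in> outgoing v"
      using d by (simp add: outgoing_def v_def)
    then have deg: "degree v \<noteq> 0"
      by (auto simp flip: card_outgoing)
    have "of_nat (degree v) * \<nu> v = (\<Sum>d\<in>outgoing v. out d + inn (rev_bond d))"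
      using \<nu> by (simp add: outgoing_def card_outgoing[unfolded outgoing_def])
    also have "\<dots> = (\<Sum>d\<in>outgoing v. (out d - inn (rev_bond d)) + 2 * inn (rev_bond d))"
      by (intro sum.cong) auto
    also have "\<dots> = 2 * (\<Sum>d\<in>outgoing v. inn (rev_bond d))"
      unfolding sum.distrib using K[of v] start_vertex_in_verts[OF d] by (simp add: v_def sum_distrib_left)
    finally have "\<nu> v = c v"
      using deg by (simp add: c_def field_simps)
    then have "out d = c v - inn (rev_bond d)"
      using \<nu>[OF d] by (simp add: v_def eq_diff_eq)
    then show "out d = (\<Sum>d'\<in>bonds. vertex_scattering d d' * inn d')"
      using rhs[OF d] by (simp add: v_def)
  next
    assume *: "\<forall>d\<in>bonds. out d = (\<Sum>d'\<in>bonds. vertex_scattering d d' * inn d')"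
    then have out: "out d = c (start_vertex d) - inn (rev_bond d)" if "d \<in> bonds" for d
      using rhs[OF that] that by simp
    then show "\<exists>\<nu>. \<forall>d\<in>bonds. out d + inn (rev_bond d) = \<nu> (start_vertex d)"
      by (intro exI[of _ c]) simp
    fix v assume "v \<in> verts G"
    have "(\<Sum>d\<in>outgoing v. out d - inn (rev_bond d)) = (\<Sum>d\<in>outgoing v. c v - 2 * inn (rev_bond d))"
      using out by (intro sum.cong) (auto simp: outgoing_def)
    also have "\<dots> = of_nat (degree v) * c v - 2 * (\<Sum>d\<in>outgoing v. inn (rev_bond d))"
      by (simp add: sum_subtractf sum_distrib_left card_outgoing)
    also have "\<dots> = 0"
    proof (cases "degree v = 0")
      case True
      then have "outgoing v = {}"
        using card_outgoing[of v] by simp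
      with True show ?thesis by simp
    qed (simp add: c_def)
    finally show "(\<Sum>d\<in>outgoing v. out d - inn (rev_bond d)) = 0" .
  qed
qed

text \<open>
  The value of a family at the vertex from which the bond starts. Together with \<open>direction\<close> it gives the
  inward normal derivative at the end of an edge.
\<close>
definition at_start :: "('e \<Rightarrow> real \<Rightarrow> complex) \<Rightarrow> 'e \<times> bool \<Rightarrow> complex" where
  "at_start F d = (if snd d then F (fst d) 0 else F (fst d) (L (fst d)))"

definition direction :: "'e \<times> bool \<Rightarrow> complex" where
  "direction d = (if snd d then 1 else -1)"

lemma continuous_at_vertices_iff:
  "continuous_at_vertices F \<longleftrightarrow> (\<exists>\<nu>. \<forall>d\<in>bonds. at_start F d = \<nu> (start_vertex d))"
  unfolding continuous_at_vertices_def
  by (auto simp: bonds_def at_start_def start_vertex_def)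

lemma kirchhoff_iff:
  fixes F :: "'e \<Rightarrow> real \<Rightarrow> complex"
  shows "kirchhoff F \<longleftrightarrow> (\<forall>v\<in>verts G. (\<Sum>d\<in>outgoing v. direction d * at_start F d) = 0)"
proof -
  have "(\<Sum>e\<in>in_arcs G v. F e (L e)) + (\<Sum>e\<in>out_arcs G v. - F e 0) =
      - (\<Sum>d\<in>outgoing v. direction d * at_start F d)" for v
    by (simp add: sum_outgoing at_start_def direction_def sum_negf)
  then show ?thesis
    unfolding kirchhoff_def by simp
qed

lemma kirchhoff_of_real:
  "kirchhoff (\<beta> :: 'e \<Rightarrow> real \<Rightarrow> real) \<Longrightarrow> kirchhoff (\<lambda>e x. complex_of_real (\<beta> e x))"
  unfolding kirchhoff_def
proof
  fix v assume "v \<in> verts G" and "\<forall>v\<in>verts G. (\<Sum>e\<in>in_arcs G v. \<beta> e (L e)) + (\<Sum>e\<in>out_arcs G v. - \<beta> e 0) = 0"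
  then have "complex_of_real ((\<Sum>e\<in>in_arcs G v. \<beta> e (L e)) + (\<Sum>e\<in>out_arcs G v. - \<beta> e 0)) = 0"
    by simp
  then show "(\<Sum>e\<in>in_arcs G v. complex_of_real (\<beta> e (L e))) + (\<Sum>e\<in>out_arcs G v. - complex_of_real (\<beta> e 0)) = 0"
    by simp
qed

definition primitive :: "('e \<Rightarrow> real \<Rightarrow> real) \<Rightarrow> 'e \<Rightarrow> real \<Rightarrow> real" where
  "primitive \<beta> e x = 2 * pi * integral {0..x} (\<beta> e)"

text \<open>
  The amplitude at the far end of the bond \<open>d\<close> of a wave that has amplitude \<open>a d\<close> at its start.
\<close>
definition arriving :: "('e \<Rightarrow> real \<Rightarrow> real) \<Rightarrow> real \<Rightarrow> ('e \<times> bool \<Rightarrow> complex) \<Rightarrow> 'e \<times> bool \<Rightarrow> complex" where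
  "arriving \<beta> k a d = scattering.propagation bond_len (bond_flux \<beta>) (of_real k) d * a d"

abbreviation edge_wave :: "('e \<Rightarrow> real \<Rightarrow> real) \<Rightarrow> real \<Rightarrow> ('e \<times> bool \<Rightarrow> complex) \<Rightarrow> 'e \<Rightarrow> real \<Rightarrow> complex" where
  "edge_wave \<beta> k a e \<equiv> gauged_wave (primitive \<beta> e) k (a (e, True)) (arriving \<beta> k a (e, False))"

abbreviation edge_dwave :: "('e \<Rightarrow> real \<Rightarrow> real) \<Rightarrow> real \<Rightarrow> ('e \<times> bool \<Rightarrow> complex) \<Rightarrow> 'e \<Rightarrow> real \<Rightarrow> complex" where
  "edge_dwave \<beta> k a e \<equiv> gauged_dwave (primitive \<beta> e) k (a (e, True)) (arriving \<beta> k a (e, False))"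

text \<open>
  On the edge \<open>e\<close>, with coordinate \<open>x\<close>, both waves are described by their amplitudes at \<open>x = 0\<close>: the wave
  on \<open>(e, True)\<close> starts there, and the wave on \<open>(e, False)\<close> arrives there.
\<close>
definition standing_wave :: "('e \<Rightarrow> real \<Rightarrow> real) \<Rightarrow> real \<Rightarrow> ('e \<times> bool \<Rightarrow> complex) \<Rightarrow> 'e \<Rightarrow> real \<Rightarrow> complex" where
  "standing_wave \<beta> k a = (\<lambda>e x. if e \<in> arcs G \<and> x \<in> {0..L e} then edge_wave \<beta> k a e x else 0)"

definition wave_space :: "('e \<Rightarrow> real \<Rightarrow> real) \<Rightarrow> real \<Rightarrow> ('e \<times> bool \<Rightarrow> complex) set" where
  "wave_space \<beta> k = scattering.bound_states bonds vertex_scattering bond_len (bond_flux \<beta>) (of_real k)"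

lemma wave_space_iff:
  "a \<in> wave_space \<beta> k \<longleftrightarrow> (\<forall>d. d \<notin> bonds \<longrightarrow> a d = 0) \<and>
    (\<forall>d\<in>bonds. a d = (\<Sum>d'\<in>bonds. vertex_scattering d d' * arriving \<beta> k a d'))"
proof -
  interpret scattering bonds vertex_scattering bond_len "bond_flux \<beta>" by (rule scattering_bonds)
  show ?thesis
    by (simp add: wave_space_def bound_states_def U_def arriving_def mult.assoc)
qed

lemma edge_potential_exists:
  assumes \<beta>: "\<beta> \<in> one_forms" and e: "e \<in> arcs G" and k: "k \<noteq> 0"
  shows "\<exists>b'. edge_potential (L e) (\<lambda>x. 2 * pi * \<beta> e x) b' (primitive \<beta> e) k"
proof -
  obtain D where D: "\<forall>x\<in>{0..L e}. D 0 x = \<beta> e x"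
    "\<forall>n. \<forall>x\<in>{0..L e}. (D n has_real_derivative D (Suc n) x) (at x within {0..L e})"
    using \<beta> e unfolding one_forms_def smooth_on_interval_def by blast
  have der: "(\<beta> e has_real_derivative D 1 x) (at x within {0..L e})" if x: "x \<in> {0..L e}" for x
    using has_field_derivative_transform_within[of "D 0" "D 1 x" x "{0..L e}" 1 "\<beta> e"] D x by simp
  have cont: "continuous_on {0..L e} (\<beta> e)"
    using der by (rule DERIV_continuous_on)
  have "continuous_on {0..L e} (D 1)"
    using D(2) by (intro DERIV_continuous_on[of _ "D 1" "D (Suc 1)"]) blast
  then have "edge_potential (L e) (\<lambda>x. 2 * pi * \<beta> e x) (\<lambda>x. 2 * pi * D 1 x) (primitive \<beta> e) k"
    unfolding primitive_def
    by unfold_locales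
      (intro length_pos e k DERIV_cmult integral_has_real_derivative cont der continuous_intros; assumption)+
  then show ?thesis by blast
qed

lemma edge_wave_boundary:
  assumes e: "e \<in> arcs G"
  shows "edge_wave \<beta> k a e 0 = a (e, True) + arriving \<beta> k a (e, False)"
    and "edge_wave \<beta> k a e (L e) = arriving \<beta> k a (e, True) + a (e, False)"
    and "edge_dwave \<beta> k a e 0 = \<i> * of_real k * (a (e, True) - arriving \<beta> k a (e, False))"
    and "edge_dwave \<beta> k a e (L e) = \<i> * of_real k * (arriving \<beta> k a (e, True) - a (e, False))"
proof -
  interpret scattering bonds vertex_scattering bond_len "bond_flux \<beta>" by (rule scattering_bonds)
  define E where "E = exp (\<i> * of_real (k * L e))"
  define P where "P = exp (- (\<i> * of_real (primitive \<beta> e (L e))))"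
  have nz: "E \<noteq> 0" "P \<noteq> 0"
    by (simp_all add: E_def P_def)
  have "propagation (of_real k) (e, True) = exp (- (\<i> * of_real (primitive \<beta> e (L e))) + \<i> * of_real (k * L e))"
    unfolding propagation_def bond_len_def bond_flux_def primitive_def by (simp add: algebra_simps)
  then have T: "arriving \<beta> k a (e, True) = P * (a (e, True) * E)"
    by (simp only: arriving_def exp_add P_def E_def mult_ac)
  have "propagation (of_real k) (e, False) = exp (\<i> * of_real (primitive \<beta> e (L e)) + \<i> * of_real (k * L e))"
    unfolding propagation_def bond_len_def bond_flux_def primitive_def by (simp add: algebra_simps)
  then have F: "arriving \<beta> k a (e, False) = inverse P * (a (e, False) * E)"
    by (simp only: arriving_def exp_add P_def E_def mult_ac exp_minus inverse_inverse_eq)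
  have E': "exp (- (\<i> * of_real (k * L e))) = inverse E"
    by (simp only: E_def exp_minus)
  have prim0: "primitive \<beta> e 0 = 0"
    by (simp add: primitive_def)
  show "edge_wave \<beta> k a e 0 = a (e, True) + arriving \<beta> k a (e, False)"
    "edge_dwave \<beta> k a e 0 = \<i> * of_real k * (a (e, True) - arriving \<beta> k a (e, False))"
    unfolding gauged_wave_def gauged_dwave_def prim0 by simp_all
  show "edge_wave \<beta> k a e (L e) = arriving \<beta> k a (e, True) + a (e, False)"
    "edge_dwave \<beta> k a e (L e) = \<i> * of_real k * (arriving \<beta> k a (e, True) - a (e, False))"
    unfolding gauged_wave_def gauged_dwave_def E' E_def[symmetric] P_def[symmetric] T F
    using nz by (simp_all add: field_simps)
qed

lemma standing_wave_at_start:
  assumes d: "d \<in> bonds"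
  shows "at_start (standing_wave \<beta> k a) d = a d + arriving \<beta> k a (rev_bond d)"
    and "at_start (edge_wave \<beta> k a) d = a d + arriving \<beta> k a (rev_bond d)"
    and "direction d * at_start (edge_dwave \<beta> k a) d = \<i> * of_real k * (a d - arriving \<beta> k a (rev_bond d))"
proof -
  obtain e s where d': "d = (e, s)" "e \<in> arcs G"
    using d by (auto simp: bonds_def)
  have "0 \<le> L e"
    using length_pos[OF d'(2)] by simp
  then show "at_start (standing_wave \<beta> k a) d = a d + arriving \<beta> k a (rev_bond d)"
    using d' by (auto simp: at_start_def standing_wave_def rev_bond_def edge_wave_boundary)
  show "at_start (edge_wave \<beta> k a) d = a d + arriving \<beta> k a (rev_bond d)"
    using d' by (auto simp: at_start_def rev_bond_def edge_wave_boundary)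
  show "direction d * at_start (edge_dwave \<beta> k a) d = \<i> * of_real k * (a d - arriving \<beta> k a (rev_bond d))"
    using d' by (cases s) (simp_all add: at_start_def direction_def rev_bond_def edge_wave_boundary algebra_simps)
qed

text \<open>
  The derivative \<open>p\<close> of a continuous function differs from its covariant derivative by a multiple of \<open>\<beta>\<close>
  that is the same at all the ends of edges at a vertex. Since \<open>\<beta>\<close> satisfies the Kirchhoff condition, the
  conditions for the two derivatives are equivalent.
\<close>
lemma standing_wave_vertex_conditions:
  assumes \<beta>: "\<beta> \<in> one_forms" and k: "k \<noteq> 0"
    and p: "\<And>e x. e \<in> arcs G \<Longrightarrow> x \<in> {0..L e} \<Longrightarrow>
      p e x = edge_dwave \<beta> k a e x - \<i> * of_real (2 * pi * \<beta> e x) * edge_wave \<beta> k a e x"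
  shows "continuous_at_vertices (standing_wave \<beta> k a) \<and> kirchhoff p \<longleftrightarrow>
    (\<forall>d\<in>bonds. a d = (\<Sum>d'\<in>bonds. vertex_scattering d d' * arriving \<beta> k a d'))"
proof -
  define W where "W d = a d + arriving \<beta> k a (rev_bond d)" for d
  have cont: "continuous_at_vertices (standing_wave \<beta> k a) \<longleftrightarrow> (\<exists>\<nu>. \<forall>d\<in>bonds. W d = \<nu> (start_vertex d))"
    unfolding continuous_at_vertices_iff by (simp add: standing_wave_at_start W_def)
  have kir: "kirchhoff p \<longleftrightarrow> (\<forall>v\<in>verts G. (\<Sum>d\<in>outgoing v. a d - arriving \<beta> k a (rev_bond d)) = 0)"
    if \<nu>: "\<And>d. d \<in> bonds \<Longrightarrow> W d = \<nu> (start_vertex d)" for \<nu>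
  proof -
    have "(\<Sum>d\<in>outgoing v. direction d * at_start p d) =
        \<i> * of_real k * (\<Sum>d\<in>outgoing v. a d - arriving \<beta> k a (rev_bond d))" if v: "v \<in> verts G" for v
    proof -
      have "direction d * at_start p d = \<i> * of_real k * (a d - arriving \<beta> k a (rev_bond d)) -
          \<i> * of_real (2 * pi) * \<nu> v * (direction d * at_start (\<lambda>e x. of_real (\<beta> e x)) d)"
        if "d \<in> outgoing v" for d
      proof -
        have d: "d \<in> bonds" "start_vertex d = v"
          using that by (auto simp: outgoing_def)
        then have "fst d \<in> arcs G"
          by (auto simp: bonds_def)
        then have "at_start p d = at_start (edge_dwave \<beta> k a) d -
            \<i> * of_real (2 * pi) * at_start (\<lambda>e x. of_real (\<beta> e x)) d * at_start (edge_wave \<beta> k a) d"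
          using length_pos[of "fst d"] by (simp add: at_start_def p)
        then have "direction d * at_start p d = direction d * at_start (edge_dwave \<beta> k a) d -
            \<i> * of_real (2 * pi) * at_start (edge_wave \<beta> k a) d * (direction d * at_start (\<lambda>e x. of_real (\<beta> e x)) d)"
          by (simp only: right_diff_distrib mult_ac)
        also have "at_start (edge_wave \<beta> k a) d = \<nu> v"
          using \<nu>[OF d(1)] d by (simp add: standing_wave_at_start W_def)
        finally show ?thesis
          by (simp only: standing_wave_at_start(3)[OF d(1)])
      qed
      then have "(\<Sum>d\<in>outgoing v. direction d * at_start p d) =
          \<i> * of_real k * (\<Sum>d\<in>outgoing v. a d - arriving \<beta> k a (rev_bond d)) -
          \<i> * of_real (2 * pi) * \<nu> v * (\<Sum>d\<in>outgoing v. direction d * at_start (\<lambda>e x. of_real (\<beta> e x)) d)"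
        unfolding sum_distrib_left sum_subtractf[symmetric] by (intro sum.cong) auto
      moreover have "(\<Sum>d\<in>outgoing v. direction d * at_start (\<lambda>e x. of_real (\<beta> e x)) d) = 0"
        using \<beta> kirchhoff_of_real[of \<beta>] v unfolding one_forms_def kirchhoff_iff by blast
      ultimately show ?thesis by simp
    qed
    then show ?thesis
      using k unfolding kirchhoff_iff by simp
  qed
  show ?thesis
    unfolding vertex_conditions_iff_scattering[symmetric] W_def[symmetric]
    using cont kir by blast
qed

definition eigenspace :: "('e \<Rightarrow> real \<Rightarrow> real) \<Rightarrow> complex \<Rightarrow> ('e \<Rightarrow> real \<Rightarrow> complex) set" where
  "eigenspace \<beta> z = {f \<in> laplacian_domain. is_laplacian \<beta> f (\<lambda>e x. z * f e x)}"

lemma standing_wave_eigenfunction: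
  assumes \<beta>: "\<beta> \<in> one_forms" and k: "k \<noteq> 0" and a: "a \<in> wave_space \<beta> k"
  shows "standing_wave \<beta> k a \<in> eigenspace \<beta> (of_real (k\<^sup>2))"
proof -
  define p where "p e x = edge_dwave \<beta> k a e x - \<i> * of_real (2 * pi * \<beta> e x) * edge_wave \<beta> k a e x" for e x
  have vertex: "continuous_at_vertices (standing_wave \<beta> k a)" "kirchhoff p"
    using standing_wave_vertex_conditions[OF \<beta> k, of p a] a unfolding wave_space_iff p_def by auto
  have edge: "sobolev_deriv (L e) (standing_wave \<beta> k a e) (p e)" "\<exists>p'. sobolev_deriv (L e) (p e) p'"
      "sobolev_deriv (L e) (edge_dwave \<beta> k a e)
        (\<lambda>x. - (of_real (k\<^sup>2) * edge_wave \<beta> k a e x) - \<i> * of_real (2 * pi * \<beta> e x) * edge_dwave \<beta> k a e x)"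
    if e: "e \<in> arcs G" for e
  proof -
    obtain b' where "edge_potential (L e) (\<lambda>x. 2 * pi * \<beta> e x) b' (primitive \<beta> e) k"
      using edge_potential_exists[OF \<beta> e k] by blast
    then interpret E: edge_potential "L e" "\<lambda>x. 2 * pi * \<beta> e x" b' "primitive \<beta> e" k .
    have p_eq: "p e = (\<lambda>x. edge_dwave \<beta> k a e x - \<i> * of_real (2 * pi * \<beta> e x) * edge_wave \<beta> k a e x)"
      by (simp add: fun_eq_iff p_def)
    have sw: "edge_wave \<beta> k a e x = standing_wave \<beta> k a e x" if "x \<in> {0..L e}" for x
      using e that by (simp add: standing_wave_def)
    show "sobolev_deriv (L e) (standing_wave \<beta> k a e) (p e)"
      by (rule sobolev_deriv_cong[OF _ sw _ E.wave_sobolev(1)[of "a (e, True)" "arriving \<beta> k a (e, False)"]])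
        (use E.l in \<open>simp_all add: p_eq\<close>)
    show "\<exists>p'. sobolev_deriv (L e) (p e) p'"
      unfolding p_eq by (rule E.wave_sobolev(2))
    show "sobolev_deriv (L e) (edge_dwave \<beta> k a e)
        (\<lambda>x. - (of_real (k\<^sup>2) * edge_wave \<beta> k a e x) - \<i> * of_real (2 * pi * \<beta> e x) * edge_dwave \<beta> k a e x)"
      by (rule E.wave_sobolev(3))
  qed
  have "standing_wave \<beta> k a \<in> laplacian_domain"
  proof -
    have "\<forall>e\<in>arcs G. \<exists>p'. sobolev_deriv (L e) (p e) p'"
      using edge(2) by blast
    then obtain p' where "\<forall>e\<in>arcs G. sobolev_deriv (L e) (p e) (p' e)"
      by (rule bchoice[elim_format]) blast
    then show ?thesis
      using vertex edge(1) unfolding laplacian_domain_def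
      by (intro CollectI conjI exI[of _ p] exI[of _ p']) (auto simp: standing_wave_def)
  qed
  moreover have "is_laplacian \<beta> (standing_wave \<beta> k a) (\<lambda>e x. of_real (k\<^sup>2) * standing_wave \<beta> k a e x)"
    unfolding is_laplacian_def
  proof
    fix e assume e: "e \<in> arcs G"
    let ?g' = "\<lambda>x. - (of_real (k\<^sup>2) * edge_wave \<beta> k a e x) - \<i> * of_real (2 * pi * \<beta> e x) * edge_dwave \<beta> k a e x"
    show "\<exists>f' g g'. sobolev_deriv (L e) (standing_wave \<beta> k a e) f' \<and>
        (\<forall>x\<in>{0..L e}. g x = f' x + 2 * of_real pi * \<i> * of_real (\<beta> e x) * standing_wave \<beta> k a e x) \<and>
        sobolev_deriv (L e) g g' \<and>
        (AE x in lborel. x \<in> {0..L e} \<longrightarrow> of_real (k\<^sup>2) * standing_wave \<beta> k a e x =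
           - (g' x + 2 * of_real pi * \<i> * of_real (\<beta> e x) * g x))"
      using edge(1,3)[OF e] e
      by (intro exI[of _ "p e"] exI[of _ "edge_dwave \<beta> k a e"] exI[of _ ?g'] conjI)
        (auto simp: p_def standing_wave_def algebra_simps)
  qed
  ultimately show ?thesis
    by (simp add: eigenspace_def)
qed

text \<open>
  The weak equation makes \<open>f\<close> and its covariant derivative \<open>g\<close> continuously differentiable, so they solve
  the equation classically on every edge. The derivative \<open>p\<close> in the Kirchhoff condition of the domain
  and the one in the definition of the Laplacian agree everywhere, as both are continuous.
\<close>
lemma eigenfunction_is_standing_wave:
  assumes \<beta>: "\<beta> \<in> one_forms" and k: "k \<noteq> 0" and f: "f \<in> eigenspace \<beta> (of_real (k\<^sup>2))"
  shows "\<exists>a\<in>wave_space \<beta> k. f = standing_wave \<beta> k a"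
proof -
  from f obtain p p' where dom: "\<And>e x. \<not> (e \<in> arcs G \<and> x \<in> {0..L e}) \<Longrightarrow> f e x = 0"
    "continuous_at_vertices f" "kirchhoff p"
    "\<And>e. e \<in> arcs G \<Longrightarrow> sobolev_deriv (L e) (f e) (p e) \<and> sobolev_deriv (L e) (p e) (p' e)"
    unfolding eigenspace_def laplacian_domain_def by blast
  have lap: "is_laplacian \<beta> f (\<lambda>e x. of_real (k\<^sup>2) * f e x)"
    using f by (simp add: eigenspace_def)
  have edge: "\<exists>A B. \<forall>x\<in>{0..L e}. f e x = gauged_wave (primitive \<beta> e) k A B x \<and>
      p e x = gauged_dwave (primitive \<beta> e) k A B x - \<i> * of_real (2 * pi * \<beta> e x) * f e x"
    if e: "e \<in> arcs G" for e
  proof -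
    obtain b' where "edge_potential (L e) (\<lambda>x. 2 * pi * \<beta> e x) b' (primitive \<beta> e) k"
      using edge_potential_exists[OF \<beta> e k] by blast
    then interpret E: edge_potential "L e" "\<lambda>x. 2 * pi * \<beta> e x" b' "primitive \<beta> e" k .
    have l0: "0 \<le> L e"
      using E.l by simp
    obtain f' g g' where lapl: "sobolev_deriv (L e) (f e) f'"
      "\<forall>x\<in>{0..L e}. g x = f' x + 2 * of_real pi * \<i> * of_real (\<beta> e x) * f e x"
      "sobolev_deriv (L e) g g'"
      "AE x in lborel. x \<in> {0..L e} \<longrightarrow> of_real (k\<^sup>2) * f e x = - (g' x + 2 * of_real pi * \<i> * of_real (\<beta> e x) * g x)"
      using lap e unfolding is_laplacian_def by blast
    note cont = sobolev_continuous[OF lapl(1) l0] sobolev_continuous[OF lapl(3) l0]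
    have f_der: "(f e has_vector_derivative g x - \<i> * of_real (2 * pi * \<beta> e x) * f e x) (at x within {0..L e})"
      if x: "x \<in> {0..L e}" for x
    proof (rule sobolev_deriv_classical[OF lapl(1) _ _ x])
      show "continuous_on {0..L e} (\<lambda>x. g x - \<i> * of_real (2 * pi * \<beta> e x) * f e x)"
        by (intro continuous_intros cont E.cont_b)
      show "AE x in lborel. x \<in> {0..L e} \<longrightarrow> f' x = g x - \<i> * of_real (2 * pi * \<beta> e x) * f e x"
        using lapl(2) by (intro always_eventually allI impI) simp
    qed
    have g_der: "(g has_vector_derivative - (of_real (k\<^sup>2) * f e x) - \<i> * of_real (2 * pi * \<beta> e x) * g x) (at x within {0..L e})"
      if x: "x \<in> {0..L e}" for x
    proof (rule sobolev_deriv_classical[OF lapl(3) _ _ x])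
      show "continuous_on {0..L e} (\<lambda>x. - (of_real (k\<^sup>2) * f e x) - \<i> * of_real (2 * pi * \<beta> e x) * g x)"
        by (intro continuous_intros cont E.cont_b)
      show "AE x in lborel. x \<in> {0..L e} \<longrightarrow> g' x = - (of_real (k\<^sup>2) * f e x) - \<i> * of_real (2 * pi * \<beta> e x) * g x"
        using lapl(4) by eventually_elim auto
    qed
    obtain A B where AB: "\<And>x. x \<in> {0..L e} \<Longrightarrow> f e x = gauged_wave (primitive \<beta> e) k A B x"
      "\<And>x. x \<in> {0..L e} \<Longrightarrow> g x = gauged_dwave (primitive \<beta> e) k A B x"
      by (rule E.eigenfunction_is_wave[OF f_der g_der]) (assumption | rule that)+
    have "p e x = g x - \<i> * of_real (2 * pi * \<beta> e x) * f e x" if x: "x \<in> {0..L e}" for x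
    proof (rule has_vector_derivative_unique_Icc[OF E.l x _ f_der[OF x]])
      show "(f e has_vector_derivative p e x) (at x within {0..L e})"
        using dom(4)[OF e] sobolev_continuous[OF _ l0, of "p e" "p' e"]
        by (intro sobolev_deriv_classical[of "L e" "f e" "p e", OF _ _ _ x]) auto
    qed
    then show ?thesis
      using AB by (intro exI[of _ A] exI[of _ B]) simp
  qed
  then obtain A B where AB: "\<And>e x. e \<in> arcs G \<Longrightarrow> x \<in> {0..L e} \<Longrightarrow> f e x = gauged_wave (primitive \<beta> e) k (A e) (B e) x"
    "\<And>e x. e \<in> arcs G \<Longrightarrow> x \<in> {0..L e} \<Longrightarrow>
      p e x = gauged_dwave (primitive \<beta> e) k (A e) (B e) x - \<i> * of_real (2 * pi * \<beta> e x) * f e x"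
    by metis
  define P where "P d = scattering.propagation bond_len (bond_flux \<beta>) (of_real k) d" for d
  have P: "P d \<noteq> 0" for d
    unfolding P_def scattering.propagation_def[OF scattering_bonds] by simp
  define a where "a d = (if d \<in> bonds then if snd d then A (fst d) else B (fst d) / P d else 0)" for d
  have a: "a (e, True) = A e" "arriving \<beta> k a (e, False) = B e" if "e \<in> arcs G" for e
    using that P[of "(e, False)"] by (simp_all add: a_def bonds_def arriving_def P_def[symmetric])
  have f_eq: "f = standing_wave \<beta> k a"
    using dom(1) AB(1) a by (auto simp: fun_eq_iff standing_wave_def)
  have "\<forall>d\<in>bonds. a d = (\<Sum>d'\<in>bonds. vertex_scattering d d' * arriving \<beta> k a d')"
  proof (subst standing_wave_vertex_conditions[OF \<beta> k, symmetric])
    show "p e x = edge_dwave \<beta> k a e x - \<i> * of_real (2 * pi * \<beta> e x) * edge_wave \<beta> k a e x"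
      if "e \<in> arcs G" "x \<in> {0..L e}" for e x
      using AB[OF that] a[OF that(1)] by simp
    show "continuous_at_vertices (standing_wave \<beta> k a) \<and> kirchhoff p"
      using dom f_eq by simp
  qed
  then have "a \<in> wave_space \<beta> k"
    unfolding wave_space_iff by (simp add: a_def)
  with f_eq show ?thesis by blast
qed

text \<open>
  The value and the covariant derivative of a wave at one end of an edge determine the sum and the
  difference of its two amplitudes there.
\<close>
lemma standing_wave_injective:
  assumes \<beta>: "\<beta> \<in> one_forms" and k: "k \<noteq> 0"
  shows "inj_on (standing_wave \<beta> k) (wave_space \<beta> k)"
proof (rule inj_onI)
  fix a1 a2 assume a12: "a1 \<in> wave_space \<beta> k" "a2 \<in> wave_space \<beta> k"
    and eq: "standing_wave \<beta> k a1 = standing_wave \<beta> k a2"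
  have "a1 (e, s) = a2 (e, s)" if e: "e \<in> arcs G" for e s
  proof -
    obtain b' where "edge_potential (L e) (\<lambda>x. 2 * pi * \<beta> e x) b' (primitive \<beta> e) k"
      using edge_potential_exists[OF \<beta> e k] by blast
    then interpret E: edge_potential "L e" "\<lambda>x. 2 * pi * \<beta> e x" b' "primitive \<beta> e" k .
    have w: "edge_wave \<beta> k a1 e x = edge_wave \<beta> k a2 e x" if "x \<in> {0..L e}" for x
      using fun_cong[OF fun_cong[OF eq, of e], of x] e that by (simp add: standing_wave_def)
    have dw: "edge_dwave \<beta> k a1 e x = edge_dwave \<beta> k a2 e x" if x: "x \<in> {0..L e}" for x
    proof -
      have "(edge_wave \<beta> k a2 e has_vector_derivative
          edge_dwave \<beta> k a1 e x - \<i> * of_real (2 * pi * \<beta> e x) * edge_wave \<beta> k a1 e x) (at x within {0..L e})"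
        by (rule has_vector_derivative_transform[OF x _ E.wave_deriv[OF x]]) (simp add: w)
      from has_vector_derivative_unique_Icc[OF E.l x this E.wave_deriv[OF x]] show ?thesis
        using w[OF x] by simp
    qed
    have ends: "0 \<in> {0..L e}" "L e \<in> {0..L e}"
      using E.l by auto
    show ?thesis
    proof (cases s)
      case True
      have "a1 (e, True) - arriving \<beta> k a1 (e, False) = a2 (e, True) - arriving \<beta> k a2 (e, False)"
        using dw[OF ends(1)] k unfolding edge_wave_boundary[OF e] by simp
      from arg_cong2[OF w[OF ends(1), unfolded edge_wave_boundary[OF e]] this, of "(+)"]
      have "2 * a1 (e, True) = 2 * a2 (e, True)"
        by simp
      with True show ?thesis by simp
    next
      case False
      have "arriving \<beta> k a1 (e, True) - a1 (e, False) = arriving \<beta> k a2 (e, True) - a2 (e, False)"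
        using dw[OF ends(2)] k unfolding edge_wave_boundary[OF e] by simp
      from arg_cong2[OF w[OF ends(2), unfolded edge_wave_boundary[OF e]] this, of "(-)"]
      have "2 * a1 (e, False) = 2 * a2 (e, False)"
        by simp
      with False show ?thesis by simp
    qed
  qed
  moreover have "a1 d = a2 d" if "d \<notin> bonds" for d
    using a12 that by (simp add: wave_space_iff del: split_paired_All)
  ultimately show "a1 = a2"
    by (auto simp: fun_eq_iff bonds_def)
qed

lemma standing_wave_linear: "Vector_Spaces.linear cscale fscale (standing_wave \<beta> k)"
  by (intro Vector_Spaces.linear_iff[THEN iffD2] conjI allI cfun.vector_space_axioms ffun.vector_space_axioms)
    (auto simp: fun_eq_iff standing_wave_def fscale_def gauged_wave_def arriving_def algebra_simps)

theorem multiplicity_eq_dim_wave_space: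
  assumes \<beta>: "\<beta> \<in> one_forms" and k: "k \<noteq> 0"
  shows "multiplicity \<beta> (of_real (k\<^sup>2)) = cfun.dim (wave_space \<beta> k)"
proof -
  interpret scattering bonds vertex_scattering bond_len "bond_flux \<beta>" by (rule scattering_bonds)
  have "eigenspace \<beta> (of_real (k\<^sup>2)) = standing_wave \<beta> k ` wave_space \<beta> k"
    using standing_wave_eigenfunction[OF \<beta> k] eigenfunction_is_standing_wave[OF \<beta> k] by blast
  moreover have "cfun.subspace (wave_space \<beta> k)"
    unfolding wave_space_def by (rule subspace_bound_states)
  ultimately have "ffun.dim (eigenspace \<beta> (of_real (k\<^sup>2))) = cfun.dim (wave_space \<beta> k)"
    using dim_image_of_injective[OF standing_wave_linear _ standing_wave_injective[OF \<beta> k]] by simp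
  moreover have "fscale = (\<lambda>(c::complex) f (e::'e) x. c * f e x)"
    by (simp add: fun_eq_iff fscale_def)
  ultimately show ?thesis
    unfolding multiplicity_def eigenspace_def by simp
qed

text \<open>
  For an eigenvalue the equation with right-hand side \<open>0\<close> has two solutions.
\<close>
lemma multiplicity_pos_imp_in_Spec:
  assumes "multiplicity \<beta> z \<noteq> 0"
  shows "(z, multiplicity \<beta> z) \<in> Spec \<beta>"
proof -
  have fs: "fscale = (\<lambda>(c::complex) f (e::'e) x. c * f e x)"
    by (simp add: fun_eq_iff fscale_def)
  have zero_sob: "sobolev_deriv l (\<lambda>x. 0) (\<lambda>x. 0)" for l
    by (intro sobolev_deriv_of_C1) auto
  define Z where "Z = (\<lambda>(e::'e) (x::real). 0 :: complex)"
  have Z: "Z \<in> eigenspace \<beta> z"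
    unfolding eigenspace_def laplacian_domain_def is_laplacian_def continuous_at_vertices_def kirchhoff_def Z_def
  proof (intro CollectI conjI exI[of _ "\<lambda>_ _. 0"] exI[of _ "\<lambda>_. 0"] ballI allI impI zero_sob)
  qed auto
  have "eigenspace \<beta> z \<noteq> {Z}"
  proof
    assume "eigenspace \<beta> z = {Z}"
    moreover have "Z = 0"
      by (simp add: Z_def fun_eq_iff)
    moreover have "multiplicity \<beta> z = ffun.dim (eigenspace \<beta> z)"
      by (simp only: multiplicity_def eigenspace_def fs)
    ultimately have "multiplicity \<beta> z = ffun.dim {0 :: 'e \<Rightarrow> real \<Rightarrow> complex}"
      by simp
    also have "ffun.dim {0 :: 'e \<Rightarrow> real \<Rightarrow> complex} = card ({} :: ('e \<Rightarrow> real \<Rightarrow> complex) set)"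
      by (rule ffun.dim_eq_card) (auto simp: ffun.span_empty ffun.independent_empty ffun.span_insert_0)
    finally show False
      using assms by simp
  qed
  then obtain f where f: "f \<in> eigenspace \<beta> z" "f \<noteq> Z"
    using Z by blast
  have "z \<notin> resolvent_set \<beta>"
  proof
    assume "z \<in> resolvent_set \<beta>"
    then have "\<forall>g\<in>L2_functions. \<exists>!f. f \<in> laplacian_domain \<and> is_laplacian \<beta> f (\<lambda>e x. z * f e x + g e x)"
      unfolding resolvent_set_def mem_Collect_eq by (rule conjunct1)
    moreover have "Z \<in> L2_functions"
      using zero_sob by (simp add: L2_functions_def Z_def sobolev_deriv_def)
    ultimately have ex1: "\<exists>!f. f \<in> laplacian_domain \<and> is_laplacian \<beta> f (\<lambda>e x. z * f e x + Z e x)"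
      by (rule bspec)
    have "(\<lambda>e x. z * h e x + Z e x) = (\<lambda>e x. z * h e x)" for h :: "'e \<Rightarrow> real \<Rightarrow> complex"
      by (simp only: Z_def add_0_right)
    with ex1 have "\<exists>!f. f \<in> eigenspace \<beta> z"
      by (simp only: eigenspace_def mem_Collect_eq)
    with f Z show False
      by (elim ex1E) metis
  qed
  then show ?thesis
    unfolding Spec_def by blast
qed

end

text \<open>
  The spectrum records the multiplicity only at its own points, but outside of it all multiplicities are
  zero.
\<close>
lemma Spec_eq_imp_multiplicity_eq:
  assumes G: "quantum_graph G L" and G': "quantum_graph G' L'"
    and eq: "quantum_graph.Spec G L \<beta> = quantum_graph.Spec G' L' \<beta>'"
  shows "quantum_graph.multiplicity G L \<beta> z = quantum_graph.multiplicity G' L' \<beta>' z"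
proof -
  interpret A: quantum_graph G L by fact
  interpret B: quantum_graph G' L' by fact
  have A: "B.multiplicity \<beta>' z = A.multiplicity \<beta> z" if "A.multiplicity \<beta> z \<noteq> 0"
  proof -
    have "(z, A.multiplicity \<beta> z) \<in> B.Spec \<beta>'"
      using A.multiplicity_pos_imp_in_Spec[OF that] by (simp only: eq)
    then show ?thesis
      unfolding B.Spec_def by auto
  qed
  have B: "A.multiplicity \<beta> z = B.multiplicity \<beta>' z" if "B.multiplicity \<beta>' z \<noteq> 0"
  proof -
    have "(z, B.multiplicity \<beta>' z) \<in> A.Spec \<beta>"
      using B.multiplicity_pos_imp_in_Spec[OF that] by (simp only: eq)
    then show ?thesis
      unfolding A.Spec_def by auto
  qed
  show ?thesis
  proof (cases "A.multiplicity \<beta> z = 0")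
    case True
    show ?thesis
    proof (rule ccontr)
      assume ne: "\<not> ?thesis"
      then have "B.multiplicity \<beta>' z \<noteq> 0"
        unfolding True by (rule not_sym)
      from B[OF this] ne show False by (rule notE[rotated])
    qed
  next
    case False
    from A[OF this] show ?thesis by (rule sym)
  qed
qed

section \<open>Closed walks and homology\<close>

context quantum_graph
begin

fun walk_from :: "'v \<Rightarrow> ('e \<times> bool) list \<Rightarrow> 'v \<Rightarrow> bool" where
  "walk_from u [] v \<longleftrightarrow> u = v"
| "walk_from u (d # w) v \<longleftrightarrow> d \<in> bonds \<and> start_vertex d = u \<and> walk_from (end_vertex d) w v"

lemma walk_from_append: "walk_from u (w @ w') v \<longleftrightarrow> (\<exists>x. walk_from u w x \<and> walk_from x w' v)"
  by (induction w arbitrary: u) auto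

definition reverse_walk :: "('e \<times> bool) list \<Rightarrow> ('e \<times> bool) list" where
  "reverse_walk w = rev (map rev_bond w)"

lemma walk_from_reverse: "walk_from u w v \<Longrightarrow> walk_from v (reverse_walk w) u"
  by (induction w arbitrary: u) (auto simp: reverse_walk_def walk_from_append)

lemma walk_from_set: "walk_from u w v \<Longrightarrow> set w \<subseteq> bonds"
  by (induction w arbitrary: u) auto

lemma closed_walk_Nil [simp]: "closed_walk []"
  by (simp add: closed_walk_def)

lemma bonds_iff: "d \<in> bonds \<longleftrightarrow> fst d \<in> arcs G"
  by (simp add: bonds_def mem_Times_iff)

lemma set_bonds_iff: "fst ` set w \<subseteq> arcs G \<longleftrightarrow> set w \<subseteq> bonds"
  by (auto simp: bonds_def)

lemma walk_from_iff:
  "walk_from u (d # w) v \<longleftrightarrow> set (d # w) \<subseteq> bonds \<and> start_vertex d = u \<and> end_vertex (last (d # w)) = v \<and>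
    (\<forall>i < length w. end_vertex ((d # w) ! i) = start_vertex (w ! i))"
proof (induction w arbitrary: u d)
  case (Cons d' w)
  have "(\<forall>i < Suc (length w). end_vertex ((d # d' # w) ! i) = start_vertex ((d' # w) ! i)) \<longleftrightarrow>
      end_vertex d = start_vertex d' \<and> (\<forall>i < length w. end_vertex ((d' # w) ! i) = start_vertex (w ! i))"
    by (simp add: All_less_Suc2)
  then show ?case
    unfolding walk_from.simps(2)[of u d "d' # w"] Cons.IH[of "end_vertex d" d'] length_Cons by auto
qed auto

lemma closed_walk_iff_walk_from: "closed_walk w \<longleftrightarrow> (\<exists>u. walk_from u w u)"
proof (cases w)
  case (Cons d w')
  have "(\<forall>i < length w. end_vertex (w ! i) = start_vertex (w ! (Suc i mod length w))) \<longleftrightarrow>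
      (\<forall>i < length w'. end_vertex (w ! i) = start_vertex (w' ! i)) \<and> end_vertex (last w) = start_vertex d"
  proof -
    have "(\<forall>i < Suc (length w'). end_vertex (w ! i) = start_vertex (w ! (Suc i mod Suc (length w')))) \<longleftrightarrow>
        (\<forall>i < length w'. end_vertex (w ! i) = start_vertex (w ! (Suc i mod Suc (length w')))) \<and>
        end_vertex (w ! length w') = start_vertex (w ! (Suc (length w') mod Suc (length w')))"
      by (auto simp: less_Suc_eq)
    moreover have "w ! length w' = last w"
      using Cons by (simp add: last_conv_nth)
    ultimately show ?thesis
      using Cons by simp
  qed
  then show ?thesis
    using Cons by (auto simp: closed_walk_def set_bonds_iff walk_from_iff bonds_iff[symmetric] simp del: walk_from.simps)
qed auto

subsection \<open>Additivity\<close>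

lemma walk_class_simps [simp]:
  "walk_class [] = (\<lambda>e. 0)"
  "walk_class (d # w) = (\<lambda>e. (if fst d = e then if snd d then 1 else -1 else 0) + walk_class w e)"
  by (simp_all add: walk_class_def)

lemma walk_class_append: "walk_class (w @ w') = (\<lambda>e. walk_class w e + walk_class w' e)"
  by (simp add: walk_class_def fun_eq_iff)

lemma walk_class_reverse: "walk_class (reverse_walk w) = (\<lambda>e. - walk_class w e)"
  by (induction w) (auto simp: reverse_walk_def walk_class_append rev_bond_def fun_eq_iff)

lemma class_integral_walk_class:
  "set w \<subseteq> bonds \<Longrightarrow> class_integral \<beta> (walk_class w) = walk_integral \<beta> w"
proof (induction w)
  case Nil
  then show ?case by (simp add: class_integral_def walk_integral_def)
next
  case (Cons d w)
  have d: "fst d \<in> arcs G"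
    using Cons.prems by (auto simp: bonds_def)
  have "class_integral \<beta> (walk_class (d # w)) =
      (\<Sum>e\<in>arcs G. (if fst d = e then (if snd d then 1 else -1) * integral {0..L e} (\<beta> e) else 0)) + class_integral \<beta> (walk_class w)"
    unfolding class_integral_def sum.distrib[symmetric] by (intro sum.cong) (auto simp: algebra_simps)
  also have "(\<Sum>e\<in>arcs G. (if fst d = e then (if snd d then 1 else -1) * integral {0..L e} (\<beta> e) else 0)) =
      (if snd d then 1 else -1) * integral {0..L (fst d)} (\<beta> (fst d))"
    using d by simp
  finally show ?case
    using Cons by (simp add: walk_integral_def)
qed

lemma walk_length_nonneg: "set w \<subseteq> bonds \<Longrightarrow> 0 \<le> walk_length w"
  unfolding walk_length_def
  by (intro sum_list_nonneg) (auto simp: bonds_iff subset_iff intro!: less_imp_le length_pos)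

lemma walk_boundary:
  assumes "walk_from u w v"
  shows "(\<Sum>e\<in>in_arcs G x. walk_class w e) - (\<Sum>e\<in>out_arcs G x. walk_class w e) =
    (if x = v then 1 else 0) - (if x = u then 1 else 0)"
  using assms
proof (induction w arbitrary: u)
  case (Cons d w)
  then have d: "fst d \<in> arcs G" "start_vertex d = u" and w: "walk_from (end_vertex d) w v"
    by (auto simp: bonds_def)
  have "(\<Sum>e\<in>in_arcs G x. if fst d = e then if snd d then 1 else -1 else 0 :: int) =
      (if head G (fst d) = x then if snd d then 1 else -1 else 0)"
    "(\<Sum>e\<in>out_arcs G x. if fst d = e then if snd d then 1 else -1 else 0 :: int) =
      (if tail G (fst d) = x then if snd d then 1 else -1 else 0)"
    using d(1) by (simp_all add: finite_in_arcs finite_out_arcs)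
  then show ?case
    using Cons.IH[OF w] d(2) by (cases "snd d") (auto simp: sum.distrib start_vertex_def end_vertex_def)
qed simp

lemma walk_class_outside: "set w \<subseteq> bonds \<Longrightarrow> e \<notin> arcs G \<Longrightarrow> walk_class w e = 0"
  by (induction w) (auto simp: bonds_def)

lemma closed_walk_class_in_H1: "closed_walk w \<Longrightarrow> walk_class w \<in> carrier H1"
proof -
  assume "closed_walk w"
  then obtain u where u: "walk_from u w u"
    unfolding closed_walk_iff_walk_from by blast
  show ?thesis
    using walk_boundary[OF u] walk_class_outside[OF walk_from_set[OF u]] by (simp add: H1_def)
qed

subsection \<open>Every homology class is the class of a closed walk\<close>

lemma walk_between:
  assumes "u \<in> verts G" "v \<in> verts G"
  shows "\<exists>w. walk_from u w v"
proof -
  have "u \<rightarrow>\<^sup>*\<^bsub>with_proj (mk_symmetric G)\<^esub> v"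
    using connected assms unfolding Digraph_Component.connected_def strongly_connected_def by simp
  then have "(u, v) \<in> rtrancl_on (verts G) (parcs (mk_symmetric G))"
    by (simp add: reachable_def)
  then show ?thesis
  proof (induction rule: rtrancl_on.induct)
    case (rtrancl_on_refl a)
    then show ?case by (auto intro: exI[of _ "[]"])
  next
    case (rtrancl_on_into_rtrancl_on a b c)
    then obtain w where w: "walk_from a w b" by blast
    from rtrancl_on_into_rtrancl_on obtain e where e: "e \<in> arcs G"
      "(b, c) = (tail G e, head G e) \<or> (b, c) = (head G e, tail G e)"
      by (auto simp: parcs_mk_symmetric)
    then have "\<exists>s. walk_from b [(e, s)] c"
      by (auto simp: bonds_def start_vertex_def end_vertex_def intro: exI[of _ True] exI[of _ False])
    then obtain s where "walk_from b [(e, s)] c" by blast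
    with w have "walk_from a (w @ [(e, s)]) c"
      unfolding walk_from_append by blast
    then show ?case by blast
  qed
qed

lemma sum_arcs_by_head: "(\<Sum>e\<in>arcs G. F (head G e) e) = (\<Sum>v\<in>verts G. \<Sum>e\<in>in_arcs G v. F v e)" for F :: "'v \<Rightarrow> 'e \<Rightarrow> 'c::comm_monoid_add"
proof -
  have "(\<Sum>v\<in>verts G. \<Sum>e\<in>{e \<in> arcs G. head G e = v}. F (head G e) e) = (\<Sum>e\<in>arcs G. F (head G e) e)"
    by (rule sum.group) auto
  then show ?thesis
    by (simp add: in_arcs_def)
qed

lemma sum_arcs_by_tail: "(\<Sum>e\<in>arcs G. F (tail G e) e) = (\<Sum>v\<in>verts G. \<Sum>e\<in>out_arcs G v. F v e)" for F :: "'v \<Rightarrow> 'e \<Rightarrow> 'c::comm_monoid_add"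
proof -
  have "(\<Sum>v\<in>verts G. \<Sum>e\<in>{e \<in> arcs G. tail G e = v}. F (tail G e) e) = (\<Sum>e\<in>arcs G. F (tail G e) e)"
    by (rule sum.group) auto
  then show ?thesis
    by (simp add: out_arcs_def)
qed

text \<open>
  Summation by parts: the sum is the pairing of the function \<open>P\<close> on the vertices with the boundary of \<open>c\<close>.
\<close>
lemma cycle_pairing:
  fixes P :: "'v \<Rightarrow> 'c::comm_ring_1"
  assumes c: "c \<in> carrier H1"
  shows "(\<Sum>e\<in>arcs G. of_int (c e) * (P (head G e) - P (tail G e))) = 0"
proof -
  have "(\<Sum>e\<in>arcs G. of_int (c e) * (P (head G e) - P (tail G e))) =
      (\<Sum>e\<in>arcs G. of_int (c e) * P (head G e)) - (\<Sum>e\<in>arcs G. of_int (c e) * P (tail G e))"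
    by (simp add: right_diff_distrib sum_subtractf)
  also have "\<dots> = (\<Sum>v\<in>verts G. of_int ((\<Sum>e\<in>in_arcs G v. c e) - (\<Sum>e\<in>out_arcs G v. c e)) * P v)"
    by (simp add: sum_arcs_by_head[of "\<lambda>v e. of_int (c e) * P v"] sum_arcs_by_tail[of "\<lambda>v e. of_int (c e) * P v"]
        sum_subtractf[symmetric] sum_distrib_right left_diff_distrib)
  also have "\<dots> = 0"
    using c by (intro sum.neutral) (simp add: H1_def)
  finally show ?thesis .
qed

text \<open>
  Fix a vertex \<open>v\<^sub>0\<close> and walks from it to all vertices. Every arc \<open>e\<close> closes up to a walk \<open>\<gamma> e\<close> based at
  \<open>v\<^sub>0\<close>. In the combination of the \<open>\<gamma> e\<close> with the coefficients of a cycle \<open>c\<close> the auxiliary walks cancel, and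
  such combinations are classes of walks, since walks based at \<open>v\<^sub>0\<close> can be concatenated and reversed.
\<close>
lemma homology_class_is_walk_class:
  assumes c: "c \<in> carrier H1"
  shows "\<exists>w. closed_walk w \<and> walk_class w = c"
proof -
  obtain v0 where v0: "v0 \<in> verts G"
    using connected unfolding Digraph_Component.connected_def strongly_connected_def by auto
  define Z where "Z = {z. \<exists>w. walk_from v0 w v0 \<and> walk_class w = z}"
  have Z0: "(\<lambda>e. 0) \<in> Z"
    unfolding Z_def by (intro CollectI exI[of _ "[]"]) simp
  have Zadd: "(\<lambda>e. z e + z' e) \<in> Z" if "z \<in> Z" "z' \<in> Z" for z z'
  proof -
    obtain w w' where "walk_from v0 w v0" "walk_class w = z" "walk_from v0 w' v0" "walk_class w' = z'"
      using \<open>z \<in> Z\<close> \<open>z' \<in> Z\<close> unfolding Z_def by blast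
    then show ?thesis
      unfolding Z_def by (intro CollectI exI[of _ "w @ w'"]) (auto simp: walk_from_append walk_class_append)
  qed
  have Zminus: "(\<lambda>e. - z e) \<in> Z" if "z \<in> Z" for z
  proof -
    obtain w where "walk_from v0 w v0" "walk_class w = z"
      using \<open>z \<in> Z\<close> unfolding Z_def by blast
    then show ?thesis
      unfolding Z_def
      by (intro CollectI exI[of _ "reverse_walk w"]) (auto simp: walk_from_reverse walk_class_reverse)
  qed
  have Znat: "(\<lambda>e. int n * z e) \<in> Z" if "z \<in> Z" for z n
  proof (induction n)
    case (Suc n)
    from Zadd[OF \<open>z \<in> Z\<close> this] show ?case
      by (simp add: algebra_simps)
  qed (simp add: Z0)
  have Zint: "(\<lambda>e. k * z e) \<in> Z" if "z \<in> Z" for z k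
  proof (cases "k \<ge> 0")
    case True
    then show ?thesis
      using Znat[OF that, of "nat k"] by simp
  next
    case False
    then show ?thesis
      using Zminus[OF Znat[OF that, of "nat (- k)"]] by simp
  qed
  have Zsum: "(\<lambda>f. \<Sum>e\<in>A. k e * z e f) \<in> Z" if "finite A" "\<And>e. e \<in> A \<Longrightarrow> z e \<in> Z" for A :: "'e set" and k z
    using that
  proof (induction A)
    case (insert a A)
    have "(\<lambda>f. k a * z a f + (\<Sum>e\<in>A. k e * z e f)) \<in> Z"
      using insert by (intro Zadd Zint) auto
    then show ?case
      using insert.hyps by simp
  qed (simp add: Z0)
  have "\<forall>v\<in>verts G. \<exists>w. walk_from v0 w v"
    using walk_between[OF v0] by blast
  then obtain p where p: "\<And>v. v \<in> verts G \<Longrightarrow> walk_from v0 (p v) v"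
    by metis
  define \<gamma> where "\<gamma> e = p (tail G e) @ [(e, True)] @ reverse_walk (p (head G e))" for e
  have \<gamma>: "walk_class (\<gamma> e) \<in> Z" if e: "e \<in> arcs G" for e
  proof -
    have "walk_from (tail G e) [(e, True)] (head G e)"
      using e by (simp add: bonds_def start_vertex_def end_vertex_def)
    moreover have "walk_from v0 (p (tail G e)) (tail G e)"
      using e by (intro p) simp
    moreover have "walk_from (head G e) (reverse_walk (p (head G e))) v0"
      using e by (intro walk_from_reverse p) simp
    ultimately have "walk_from v0 (\<gamma> e) v0"
      unfolding \<gamma>_def walk_from_append by blast
    then show ?thesis
      unfolding Z_def by blast
  qed
  have "c f = (\<Sum>e\<in>arcs G. c e * walk_class (\<gamma> e) f)" for f
  proof -
    have "(\<Sum>e\<in>arcs G. c e * walk_class (\<gamma> e) f) =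
        (\<Sum>e\<in>arcs G. (if e = f then c e else 0) -
          of_int (c e) * (walk_class (p (head G e)) f - walk_class (p (tail G e)) f))"
      by (intro sum.cong) (auto simp: \<gamma>_def walk_class_append walk_class_reverse algebra_simps)
    also have "\<dots> = (\<Sum>e\<in>arcs G. if e = f then c e else 0)"
      using cycle_pairing[OF c, of "\<lambda>v. walk_class (p v) f"] by (simp add: sum_subtractf)
    also have "\<dots> = c f"
      using c by (simp add: H1_def)
    finally show ?thesis by simp
  qed
  then have "c = (\<lambda>f. \<Sum>e\<in>arcs G. c e * walk_class (\<gamma> e) f)"
    by (intro ext)
  also have "\<dots> \<in> Z"
    using \<gamma> by (intro Zsum) auto
  finally show ?thesis
    unfolding Z_def closed_walk_iff_walk_from by blast
qed

subsection \<open>Minimal periodic orbits\<close>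

lemma loop_len_eq: "scattering.loop_len bond_len (i, xs) = walk_length (i # xs)"
  unfolding scattering.loop_len_def[OF scattering_bonds] walk_length_def bond_len_def by simp

lemma finite_short_walks: "finite {w. set w \<subseteq> bonds \<and> walk_length w \<le> X}"
proof -
  interpret scattering bonds vertex_scattering bond_len by (rule scattering_bonds)
  have "{w. set w \<subseteq> bonds \<and> walk_length w \<le> X} \<subseteq> insert [] ((\<lambda>(i, xs). i # xs) ` {w \<in> loops. loop_len w \<le> X})"
  proof
    fix w assume w: "w \<in> {w. set w \<subseteq> bonds \<and> walk_length w \<le> X}"
    show "w \<in> insert [] ((\<lambda>(i, xs). i # xs) ` {w \<in> loops. loop_len w \<le> X})"
    proof (cases w)
      case (Cons i xs)
      have "(i, xs) \<in> {w \<in> loops. loop_len w \<le> X}"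
        using w Cons by (auto simp: loops_def loop_len_eq)
      then have "(\<lambda>(i, xs). i # xs) (i, xs) \<in> (\<lambda>(i, xs). i # xs) ` {w \<in> loops. loop_len w \<le> X}"
        by (rule imageI)
      then show ?thesis
        using Cons by simp
    qed simp
  qed
  then show ?thesis
    by (rule finite_subset) (intro finite.insertI finite_imageI finite_short_loops)
qed

text \<open>
  There are only finitely many walks below a given length.
\<close>
lemma minimal_orbit_exists:
  assumes "c \<in> carrier H1"
  shows "\<exists>w. minimal_periodic_orbit w \<and> walk_class w = c"
proof -
  obtain w0 where w0: "closed_walk w0" "walk_class w0 = c"
    using homology_class_is_walk_class[OF assms] by blast
  define A where "A = {w. closed_walk w \<and> walk_class w = c \<and> walk_length w \<le> walk_length w0}"
  have "finite A"
    by (rule finite_subset[OF _ finite_short_walks[of "walk_length w0"]])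
      (auto simp: A_def closed_walk_def set_bonds_iff)
  moreover have "w0 \<in> A"
    using w0 by (simp add: A_def)
  ultimately obtain w where w: "w \<in> A" "\<And>w'. w' \<in> A \<Longrightarrow> walk_length w \<le> walk_length w'"
    using arg_min_if_finite[of A walk_length] by (metis empty_iff not_le)
  have "walk_length w \<le> walk_length w'" if "closed_walk w'" "walk_class w' = c" for w'
  proof (cases "walk_length w' \<le> walk_length w0")
    case True
    then show ?thesis
      using w(2)[of w'] that by (simp add: A_def)
  next
    case False
    then show ?thesis
      using w(1) by (simp add: A_def)
  qed
  then show ?thesis
    using w(1) by (intro exI[of _ w]) (auto simp: A_def minimal_periodic_orbit_def)
qed

lemma minimal_length_eq:
  assumes "minimal_periodic_orbit w"
  shows "minimal_length (walk_class w) = walk_length w"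
  unfolding minimal_length_def
proof (rule the_equality)
  show "\<exists>w'. minimal_periodic_orbit w' \<and> walk_class w' = walk_class w \<and> walk_length w' = walk_length w"
    using assms by blast
  fix l assume "\<exists>w'. minimal_periodic_orbit w' \<and> walk_class w' = walk_class w \<and> walk_length w' = l"
  then obtain w' where "minimal_periodic_orbit w'" "walk_class w' = walk_class w" "walk_length w' = l"
    by blast
  then show "l = walk_length w"
    using assms unfolding minimal_periodic_orbit_def by (metis order_antisym)
qed

lemma minimal_length_le:
  assumes "closed_walk w"
  shows "minimal_length (walk_class w) \<le> walk_length w"
proof -
  obtain w' where "minimal_periodic_orbit w'" "walk_class w' = walk_class w"
    using minimal_orbit_exists[OF closed_walk_class_in_H1[OF assms]] by blast
  then show ?thesis
    using minimal_length_eq[of w'] assms unfolding minimal_periodic_orbit_def by metis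
qed

lemma minimal_length_0: "minimal_length (\<lambda>e. 0) = 0"
proof -
  have "minimal_periodic_orbit []"
    unfolding minimal_periodic_orbit_def
    using walk_length_nonneg by (auto simp: closed_walk_def set_bonds_iff walk_length_def[of "[]"])
  from minimal_length_eq[OF this] show ?thesis
    by (simp add: walk_length_def)
qed

lemma closed_walk_rotate:
  assumes "closed_walk w"
  shows "closed_walk (rotate k w)"
proof (cases "w = []")
  case False
  have "end_vertex (rotate k w ! i) = start_vertex (rotate k w ! (Suc i mod length w))" if i: "i < length w" for i
  proof -
    have "(k + Suc i mod length w) mod length w = Suc ((k + i) mod length w) mod length w"
      by (simp add: mod_simps)
    moreover have "Suc i mod length w < length w" "(k + i) mod length w < length w"
      using False by auto
    ultimately show ?thesis
      using assms i by (simp add: nth_rotate closed_walk_def)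
  qed
  then show ?thesis
    using assms by (simp add: closed_walk_def)
qed simp

end

context quantum_graph
begin

text \<open>
  A backtracking pair of bonds can be rotated to the front and removed. This leaves a shorter closed walk
  in the same class.
\<close>
lemma minimal_orbit_no_backtracking:
  assumes w: "minimal_periodic_orbit w" and i: "i < length w"
  shows "w ! (Suc i mod length w) \<noteq> rev_bond (w ! i)"
proof
  assume bt: "w ! (Suc i mod length w) = rev_bond (w ! i)"
  define a where "a = w ! i"
  define w' where "w' = rotate i w"
  have "length w \<noteq> Suc 0"
    using bt i by (auto simp: rev_bond_def prod_eq_iff)
  then have len: "length w' \<ge> 2"
    using i by (simp add: w'_def)
  then obtain x y u where xy: "w' = x # y # u"
    unfolding numeral_2_eq_2 Suc_le_length_iff by blast
  have "x = w' ! 0" "y = w' ! 1"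
    by (simp_all add: xy)
  moreover have "w \<noteq> []"
    using i by auto
  ultimately have xa: "x = a" "y = rev_bond a"
    using i len bt nth_rotate[of 0 w i] nth_rotate[of 1 w i] by (simp_all add: w'_def a_def)
  have "closed_walk w'"
    using w by (simp add: w'_def closed_walk_rotate minimal_periodic_orbit_def)
  then have cu: "closed_walk u" and a: "a \<in> bonds"
    unfolding closed_walk_iff_walk_from xy xa by auto
  have mset: "mset w = mset w'"
    unfolding w'_def rotate_drop_take
    by (metis append_take_drop_id mset_append add.commute)
  have sums: "walk_class w = walk_class w'" "walk_length w = walk_length w'"
    unfolding walk_class_def walk_length_def sum_mset_sum_list[symmetric] mset_map mset by (rule refl)+
  have "walk_class u = walk_class w"
    unfolding sums xy xa by (auto simp: fun_eq_iff rev_bond_def)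
  then have "walk_length w \<le> walk_length u"
    using w cu by (simp add: minimal_periodic_orbit_def)
  moreover have "walk_length w = 2 * L (fst a) + walk_length u"
    unfolding sums xy xa by (simp add: walk_length_def)
  ultimately show False
    using length_pos[of "fst a"] a by (auto simp: bonds_def)
qed

end

section \<open>Generic forms\<close>

lemma smooth_on_interval_const: "smooth_on_interval l (\<lambda>x. c)"
  unfolding smooth_on_interval_def
  by (intro exI[of _ "\<lambda>n x. if n = 0 then c else 0"]) (auto intro!: derivative_eq_intros)

lemma smooth_on_interval_linear_combination:
  assumes "smooth_on_interval l f" "smooth_on_interval l g"
  shows "smooth_on_interval l (\<lambda>x. s * f x + t * g x)"
proof -
  obtain D where D: "\<forall>x\<in>{0..l}. D 0 x = f x"
    "\<forall>n. \<forall>x\<in>{0..l}. (D n has_real_derivative D (Suc n) x) (at x within {0..l})"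
    using assms(1) unfolding smooth_on_interval_def by blast
  obtain E where E: "\<forall>x\<in>{0..l}. E 0 x = g x"
    "\<forall>n. \<forall>x\<in>{0..l}. (E n has_real_derivative E (Suc n) x) (at x within {0..l})"
    using assms(2) unfolding smooth_on_interval_def by blast
  show ?thesis
    unfolding smooth_on_interval_def
  proof (intro exI[of _ "\<lambda>n x. s * D n x + t * E n x"] conjI allI ballI)
    show "((\<lambda>x. s * D n x + t * E n x) has_real_derivative s * D (Suc n) x + t * E (Suc n) x) (at x within {0..l})"
      if "x \<in> {0..l}" for n x
      using D(2) E(2) that by (intro DERIV_add DERIV_cmult) auto
  qed (use D(1) E(1) in auto)
qed

context quantum_graph
begin

lemma one_form_continuous:
  assumes "\<beta> \<in> one_forms" "e \<in> arcs G"
  shows "continuous_on {0..L e} (\<beta> e)"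
proof -
  obtain D where D: "\<forall>x\<in>{0..L e}. D 0 x = \<beta> e x"
    "\<forall>n. \<forall>x\<in>{0..L e}. (D n has_real_derivative D (Suc n) x) (at x within {0..L e})"
    using assms unfolding one_forms_def smooth_on_interval_def by blast
  have "continuous_on {0..L e} (D 0)"
    using D(2) by (intro DERIV_continuous_on[of _ "D 0" "D (Suc 0)"]) blast
  then show ?thesis
    by (rule continuous_on_eq) (use D(1) in blast)
qed

lemma one_forms_linear_combination:
  assumes "\<beta> \<in> one_forms" "\<gamma> \<in> one_forms"
  shows "(\<lambda>e x. s * \<beta> e x + t * \<gamma> e x) \<in> one_forms"
proof -
  have "kirchhoff (\<lambda>e x. s * \<beta> e x + t * \<gamma> e x)"
    unfolding kirchhoff_def
  proof
    fix v assume v: "v \<in> verts G"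
    let ?K = "\<lambda>\<beta>. (\<Sum>e\<in>in_arcs G v. \<beta> e (L e)) + (\<Sum>e\<in>out_arcs G v. - \<beta> e 0)"
    have "?K (\<lambda>e x. s * \<beta> e x + t * \<gamma> e x) = s * ?K \<beta> + t * ?K \<gamma>"
      by (simp add: sum.distrib sum_negf sum_subtractf sum_distrib_left algebra_simps)
    also have "\<dots> = 0"
      using assms v by (simp add: one_forms_def kirchhoff_def)
    finally show "?K (\<lambda>e x. s * \<beta> e x + t * \<gamma> e x) = 0" .
  qed
  then show ?thesis
    using assms by (simp add: one_forms_def smooth_on_interval_linear_combination)
qed

lemma one_forms_scale: "\<beta> \<in> one_forms \<Longrightarrow> (\<lambda>e x. t * \<beta> e x) \<in> one_forms"
  using one_forms_linear_combination[of \<beta> \<beta> t 0] by simp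

lemma one_forms_diff: "\<beta> \<in> one_forms \<Longrightarrow> \<gamma> \<in> one_forms \<Longrightarrow> (\<lambda>e x. \<beta> e x - \<gamma> e x) \<in> one_forms"
  using one_forms_linear_combination[of \<beta> \<gamma> 1 "-1"] by simp

lemma class_integral_linear_combination:
  assumes "\<beta> \<in> one_forms" "\<gamma> \<in> one_forms"
  shows "class_integral (\<lambda>e x. s * \<beta> e x + t * \<gamma> e x) c = s * class_integral \<beta> c + t * class_integral \<gamma> c"
proof -
  have "integral {0..L e} (\<lambda>x. s * \<beta> e x + t * \<gamma> e x) = s * integral {0..L e} (\<beta> e) + t * integral {0..L e} (\<gamma> e)"
    if e: "e \<in> arcs G" for e
  proof -
    have "(\<lambda>x. s * \<beta> e x) integrable_on {0..L e}" "(\<lambda>x. t * \<gamma> e x) integrable_on {0..L e}"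
      using one_form_continuous assms e by (auto intro!: integrable_continuous_real continuous_intros)
    from Henstock_Kurzweil_Integration.integral_add[OF this] show ?thesis
      by simp
  qed
  then show ?thesis
    by (simp add: class_integral_def sum.distrib sum_distrib_left algebra_simps)
qed

lemma class_integral_diff:
  assumes "\<beta> \<in> one_forms" "\<gamma> \<in> one_forms"
  shows "class_integral (\<lambda>e x. \<beta> e x - \<gamma> e x) c = class_integral \<beta> c - class_integral \<gamma> c"
  using class_integral_linear_combination[OF assms, of 1 "-1"] by simp

lemma cohomologous_refl: "\<beta> \<in> one_forms \<Longrightarrow> (\<beta>, \<beta>) \<in> cohomologous"
proof -
  assume \<beta>: "\<beta> \<in> one_forms"
  have d: "is_differential (\<lambda>e x. 0) (\<lambda>e x. 0)"
    by (simp add: is_differential_def)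
  have "kirchhoff (\<lambda>e x. 0 :: real)"
    by (simp add: kirchhoff_def)
  with d have "(\<lambda>e x. 0) \<in> zero_forms"
    unfolding zero_forms_def using smooth_on_interval_const[of _ 0]
    by (auto simp: continuous_at_vertices_def)
  then show ?thesis
    using \<beta> d unfolding cohomologous_def by auto
qed

lemma class_integral_cohomologous:
  assumes c: "c \<in> carrier H1" and \<beta>\<gamma>: "(\<beta>, \<gamma>) \<in> cohomologous"
  shows "class_integral \<beta> c = class_integral \<gamma> c"
proof -
  obtain f where forms: "\<beta> \<in> one_forms" "\<gamma> \<in> one_forms" and f: "f \<in> zero_forms"
    and df: "is_differential f (\<lambda>e x. \<beta> e x - \<gamma> e x)"
    using \<beta>\<gamma> unfolding cohomologous_def by blast
  obtain val where val: "\<forall>e\<in>arcs G. f e 0 = val (tail G e) \<and> f e (L e) = val (head G e)"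
    using f unfolding zero_forms_def continuous_at_vertices_def by blast
  have int: "integral {0..L e} (\<lambda>x. \<beta> e x - \<gamma> e x) = val (head G e) - val (tail G e)" if e: "e \<in> arcs G" for e
  proof -
    have "((\<lambda>x. \<beta> e x - \<gamma> e x) has_integral f e (L e) - f e 0) {0..L e}"
      using df e length_pos[OF e] unfolding is_differential_def
      by (intro fundamental_theorem_of_calculus) (auto simp: has_real_derivative_iff_has_vector_derivative)
    then show ?thesis
      using val e by (auto dest: integral_unique)
  qed
  have "class_integral (\<lambda>e x. \<beta> e x - \<gamma> e x) c = (\<Sum>e\<in>arcs G. of_int (c e) * (val (head G e) - val (tail G e)))"
    unfolding class_integral_def by (intro sum.cong) (auto simp: int)
  also have "\<dots> = 0"
    by (rule cycle_pairing[OF c])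
  finally show ?thesis
    using class_integral_diff[OF forms, of c] by simp
qed

text \<open>
  The integral depends only on the cohomology class, so any representative will do.
\<close>
definition class_functional :: "('e \<Rightarrow> int) \<Rightarrow> ('e \<Rightarrow> real \<Rightarrow> real) set \<Rightarrow> real" where
  "class_functional c C = class_integral (SOME \<beta>. \<beta> \<in> C) c"

lemma class_functional_eq:
  assumes c: "c \<in> carrier H1" and \<beta>: "\<beta> \<in> one_forms"
  shows "class_functional c (dR_class \<beta>) = class_integral \<beta> c"
proof -
  have "\<beta> \<in> dR_class \<beta>"
    using cohomologous_refl[OF \<beta>] by (simp add: dR_class_def)
  then have "(SOME \<gamma>. \<gamma> \<in> dR_class \<beta>) \<in> dR_class \<beta>"
    by (rule someI[of "\<lambda>\<gamma>. \<gamma> \<in> dR_class \<beta>"])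
  then have "(\<beta>, SOME \<gamma>. \<gamma> \<in> dR_class \<beta>) \<in> cohomologous"
    by (simp add: dR_class_def)
  from class_integral_cohomologous[OF c this] show ?thesis
    by (simp add: class_functional_def)
qed

lemma linear_functional_class_functional:
  assumes "c \<in> carrier H1"
  shows "linear_functional (class_functional c)"
  unfolding linear_functional_def
  using assms by (simp add: class_functional_eq one_forms_linear_combination class_integral_linear_combination)

lemma dR_class_in_H1dR: "\<beta> \<in> one_forms \<Longrightarrow> dR_class \<beta> \<in> H1dR"
  unfolding H1dR_def dR_class_def by (rule quotientI)

lemma H1dR_cases:
  assumes "C \<in> H1dR"
  obtains \<beta> where "\<beta> \<in> one_forms" "C = dR_class \<beta>"
  using assms unfolding H1dR_def dR_class_def quotient_def by blast

lemma torus_rel_refl: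
  assumes "\<beta> \<in> one_forms"
  shows "(dR_class \<beta>, dR_class \<beta>) \<in> torus_rel"
proof -
  have zero: "(\<lambda>e x. \<beta> e x - \<beta> e x) \<in> one_forms"
    by (intro one_forms_diff assms)
  have "walk_integral \<gamma> w \<in> \<int>" if "\<gamma> \<in> dR_class (\<lambda>e x. \<beta> e x - \<beta> e x)" "closed_walk w" for \<gamma> w
  proof -
    have w: "set w \<subseteq> bonds"
      using that(2) by (simp add: closed_walk_def set_bonds_iff)
    have "((\<lambda>e x. \<beta> e x - \<beta> e x), \<gamma>) \<in> cohomologous"
      using that(1) by (simp add: dR_class_def)
    from class_integral_cohomologous[OF closed_walk_class_in_H1[OF that(2)] this]
    have "class_integral \<gamma> (walk_class w) = 0"
      unfolding class_integral_diff[OF assms assms] by simp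
    then show ?thesis
      by (simp add: class_integral_walk_class[OF w])
  qed
  then have "dR_class (\<lambda>e x. \<beta> e x - \<beta> e x) \<in> H1dR_int"
    using dR_class_in_H1dR[OF zero] by (simp add: H1dR_int_def)
  then show ?thesis
    unfolding torus_rel_def using assms by blast
qed

text \<open>
  Integration over a homology class is well defined modulo the integers on the torus, because the class
  is represented by a closed walk.
\<close>
lemma torus_proj_eq_imp:
  assumes c: "c \<in> carrier H1" and C: "C \<in> H1dR" and C': "C' \<in> H1dR" and eq: "torus_proj C = torus_proj C'"
  shows "class_functional c C' - class_functional c C \<in> \<int>"
proof -
  obtain w where w: "closed_walk w" "walk_class w = c"
    using homology_class_is_walk_class[OF c] by blast
  have "C \<in> torus_proj C"
    using C torus_rel_refl unfolding torus_proj_def by (auto elim: H1dR_cases)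
  then have "(C', C) \<in> torus_rel"
    using eq unfolding torus_proj_def by blast
  then obtain \<beta> \<gamma> where *: "C' = dR_class \<beta>" "C = dR_class \<gamma>" "\<beta> \<in> one_forms" "\<gamma> \<in> one_forms"
    "dR_class (\<lambda>e x. \<beta> e x - \<gamma> e x) \<in> H1dR_int"
    unfolding torus_rel_def by blast
  have "(\<lambda>e x. \<beta> e x - \<gamma> e x) \<in> dR_class (\<lambda>e x. \<beta> e x - \<gamma> e x)"
    using cohomologous_refl[OF one_forms_diff[OF *(3,4)]] by (simp add: dR_class_def)
  then have "walk_integral (\<lambda>e x. \<beta> e x - \<gamma> e x) w \<in> \<int>"
    using *(5) w(1) unfolding H1dR_int_def by blast
  moreover have "walk_integral (\<lambda>e x. \<beta> e x - \<gamma> e x) w = class_integral \<beta> c - class_integral \<gamma> c"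
    using class_integral_walk_class[of w "\<lambda>e x. \<beta> e x - \<gamma> e x"] w class_integral_diff[OF *(3,4), of c]
    by (simp add: closed_walk_def set_bonds_iff)
  ultimately show ?thesis
    using class_functional_eq[OF c] * by simp
qed

text \<open>
  The cycle \<open>c\<close>, read as a form that is constant on every edge, satisfies the Kirchhoff condition, and
  its integral over \<open>c\<close> is a combination of squares with positive coefficients.
\<close>
lemma exists_form_with_period:
  assumes c: "c \<in> carrier H1" "c \<noteq> (\<lambda>e. 0)"
  shows "\<exists>\<beta>\<in>one_forms. class_integral \<beta> c = r"
proof -
  define \<beta> :: "'e \<Rightarrow> real \<Rightarrow> real" where "\<beta> = (\<lambda>e x. of_int (c e))"
  have "kirchhoff \<beta>"
    unfolding kirchhoff_def
  proof
    fix v assume "v \<in> verts G"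
    then have "real_of_int ((\<Sum>e\<in>in_arcs G v. c e) - (\<Sum>e\<in>out_arcs G v. c e)) = 0"
      using c by (simp add: H1_def)
    then show "(\<Sum>e\<in>in_arcs G v. \<beta> e (L e)) + (\<Sum>e\<in>out_arcs G v. - \<beta> e 0) = 0"
      by (simp add: \<beta>_def sum_negf)
  qed
  then have \<beta>: "\<beta> \<in> one_forms"
    by (simp add: one_forms_def \<beta>_def smooth_on_interval_const)
  have sq: "class_integral \<beta> c = (\<Sum>e\<in>arcs G. (of_int (c e))\<^sup>2 * L e)"
    unfolding class_integral_def \<beta>_def using length_pos
    by (intro sum.cong) (auto simp: power2_eq_square less_imp_le)
  obtain e where e: "c e \<noteq> 0"
    using c(2) by auto
  then have "e \<in> arcs G"
    using c(1) by (auto simp: H1_def)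
  then have "class_integral \<beta> c > 0"
    unfolding sq using e length_pos by (intro sum_pos2[of _ e]) (auto simp: less_imp_le)
  then have "class_integral (\<lambda>e x. (r / class_integral \<beta> c) * \<beta> e x) c = r"
    using class_integral_linear_combination[OF \<beta> \<beta>, of "r / class_integral \<beta> c" 0 c] by simp
  then show ?thesis
    using one_forms_scale[OF \<beta>] by blast
qed

text \<open>
  If \<open>\<alpha>\<close> had integral zero over a nonzero class \<open>c\<close>, then integration over \<open>c\<close> would be a nonconstant
  continuous function from the torus to the circle that is trivial on the ray; so the ray would miss
  the open set where the real part of this function is negative.
\<close>
lemma generic_imp_period_nonzero:
  assumes gen: "generic \<alpha>" and c: "c \<in> carrier H1" and zero: "class_integral \<alpha> c = 0"
  shows "c = (\<lambda>e. 0)"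
proof (rule ccontr)
  assume ne: "c \<noteq> (\<lambda>e. 0)"
  have \<alpha>: "\<alpha> \<in> one_forms"
    using gen by (simp add: generic_def)
  define Q where "Q = {x :: real. cos (2 * pi * x) < 0}"
  have Q_open: "open Q"
    unfolding Q_def by (intro open_Collect_less continuous_intros)
  have Q_periodic: "x \<in> Q \<longleftrightarrow> y \<in> Q" if int: "x - y \<in> \<int>" for x y
  proof -
    obtain n where "x - y = of_int n"
      using int unfolding Ints_def by blast
    then have "x = y + of_int n"
      by simp
    then have "cos (2 * pi * x) = cos (2 * pi * y)"
      using cos_int_2pin[of n] sin_int_2pin[of n] by (simp add: distrib_left cos_add)
    then show ?thesis
      by (simp add: Q_def)
  qed
  define V where "V = {C \<in> H1dR. class_functional c C \<in> Q}"
  define Y where "Y = torus_proj ` V"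
  have saturated: "{C \<in> H1dR. torus_proj C \<in> Y} = V"
  proof -
    have "C \<in> V" if C: "C \<in> H1dR" "torus_proj C \<in> Y" for C
    proof -
      obtain C' where C': "C' \<in> V" "torus_proj C = torus_proj C'"
        using C(2) unfolding Y_def by blast
      then have "class_functional c C' - class_functional c C \<in> \<int>"
        using torus_proj_eq_imp[OF c C(1)] by (simp add: V_def)
      from Q_periodic[OF this] show ?thesis
        using C' C(1) by (simp add: V_def)
    qed
    then show ?thesis
      by (auto simp: Y_def V_def)
  qed
  have "openin H1dR_topology V"
    unfolding H1dR_topology_def
    by (rule topology_generated_by_Basis)
      (use linear_functional_class_functional[OF c] Q_open in \<open>auto simp: V_def\<close>)
  moreover have Y_sub: "Y \<subseteq> torus"
    unfolding Y_def V_def torus_def torus_proj_def quotient_def by blast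
  ultimately have Y_open: "openin torus_topology Y"
    unfolding openin_torus_topology saturated by blast
  obtain \<beta> where \<beta>: "\<beta> \<in> one_forms" "class_integral \<beta> c = 1 / 2"
    using exists_form_with_period[OF c ne] by blast
  have "class_functional c (dR_class \<beta>) = 1 / 2"
    using class_functional_eq[OF c \<beta>(1)] \<beta>(2) by (rule trans)
  then have "2 * pi * class_functional c (dR_class \<beta>) = pi"
    by simp
  then have "dR_class \<beta> \<in> V"
    using dR_class_in_H1dR[OF \<beta>(1)] by (simp only: V_def Q_def mem_Collect_eq cos_pi) simp
  then have in_Y: "torus_proj (dR_class \<beta>) \<in> Y"
    by (simp add: Y_def)
  define R where "R = {torus_proj (dR_class (\<lambda>e x. t * \<alpha> e x)) | t. t \<ge> 0}"
  have "torus_topology closure_of R = torus"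
    using gen unfolding generic_def R_def by (rule conjunct2)
  then have "torus_proj (dR_class \<beta>) \<in> torus_topology closure_of R"
    using subsetD[OF Y_sub in_Y] by (simp only:)
  then obtain y where "y \<in> R" "y \<in> Y"
    unfolding in_closure_of using Y_open in_Y by blast
  then obtain t where "torus_proj (dR_class (\<lambda>e x. t * \<alpha> e x)) \<in> Y"
    unfolding R_def by blast
  then have "dR_class (\<lambda>e x. t * \<alpha> e x) \<in> V"
    using saturated dR_class_in_H1dR[OF one_forms_scale[OF \<alpha>]] by blast
  then have "class_integral (\<lambda>e x. t * \<alpha> e x) c \<in> Q"
    using class_functional_eq[OF c one_forms_scale[OF \<alpha>], of t] by (simp add: V_def)
  moreover have "class_integral (\<lambda>e x. t * \<alpha> e x) c = 0"
    using class_integral_linear_combination[OF \<alpha> \<alpha>, of t 0 c] zero by simp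
  ultimately show False
    by (simp add: Q_def)
qed

lemma class_integral_add:
  "class_integral \<beta> (\<lambda>e. c e + d e) = class_integral \<beta> c + class_integral \<beta> d"
  by (simp add: class_integral_def algebra_simps sum.distrib)

lemma generic_periods_injective:
  assumes gen: "generic \<alpha>" and c: "c \<in> carrier H1" and d: "d \<in> carrier H1"
    and eq: "class_integral \<alpha> c = class_integral \<alpha> d"
  shows "c = d"
proof -
  have diff: "(\<lambda>e. c e - d e) \<in> carrier H1"
    using c d by (simp add: H1_def sum_subtractf)
  have "class_integral \<alpha> c = class_integral \<alpha> (\<lambda>e. c e - d e) + class_integral \<alpha> d"
    using class_integral_add[of \<alpha> "\<lambda>e. c e - d e" d] by (simp only: diff_add_cancel)
  then have "class_integral \<alpha> (\<lambda>e. c e - d e) = 0"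
    using eq by linarith
  note eq0 = generic_imp_period_nonzero[OF gen diff this]
  show ?thesis
  proof
    fix e
    show "c e = d e"
      using fun_cong[OF eq0, of e] by simp
  qed
qed

end

section \<open>The lengths of minimal periodic orbits\<close>

lemma prod_list_pos_real:
  "(\<And>x. x \<in> set l \<Longrightarrow> \<exists>r>0. x = complex_of_real r) \<Longrightarrow> \<exists>r>0. prod_list l = complex_of_real r"
proof (induction l)
  case Nil
  show ?case by (intro exI[of _ 1]) simp
next
  case (Cons x l)
  then obtain r s where "r > 0" "x = complex_of_real r" "s > 0" "prod_list l = complex_of_real s"
    by (metis list.set_intros)
  then show ?case
    by (intro exI[of _ "r * s"]) simp
qed

context quantum_graph
begin

text \<open>
  The total weight of the closed walks of length \<open>x\<close> along which the integral of \<open>\<alpha>\<close> is \<open>- v / (2 \<pi>)\<close>.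
\<close>
definition orbit_sum :: "('e \<Rightarrow> real \<Rightarrow> real) \<Rightarrow> real \<Rightarrow> real \<Rightarrow> complex" where
  "orbit_sum \<alpha> x v = (\<Sum>w\<in>{w \<in> scattering.loops bonds. scattering.loop_len bond_len w = x \<and>
      scattering.loop_phase (bond_flux \<alpha>) w = v}. scattering.loop_coeff vertex_scattering bond_len w)"

lemma sum_list_bond_flux: "(\<Sum>a\<leftarrow>w. bond_flux \<alpha> a) = - (2 * pi * walk_integral \<alpha> w)"
  by (induction w) (simp_all add: bond_flux_def walk_integral_def algebra_simps)

lemma loop_phase_eq: "scattering.loop_phase (bond_flux \<alpha>) (i, xs) = - (2 * pi * walk_integral \<alpha> (i # xs))"
  unfolding scattering.loop_phase_def[OF scattering_bonds] case_prod_conv sum_list_bond_flux ..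

lemma bond_flux_scale: "bond_flux (\<lambda>e x. t * \<alpha> e x) d = t * bond_flux \<alpha> d"
  by (simp add: bond_flux_def)

lemma closed_walk_iff_corners:
  "closed_walk w \<longleftrightarrow> set w \<subseteq> bonds \<and> (\<forall>(a, b)\<in>set (zip w (rotate1 w)). end_vertex a = start_vertex b)"
proof -
  have "(\<forall>i<length w. end_vertex (w ! i) = start_vertex (w ! (Suc i mod length w))) \<longleftrightarrow>
      (\<forall>(a, b)\<in>set (zip w (rotate1 w)). end_vertex a = start_vertex b)"
  proof
    assume *: "\<forall>i<length w. end_vertex (w ! i) = start_vertex (w ! (Suc i mod length w))"
    show "\<forall>(a, b)\<in>set (zip w (rotate1 w)). end_vertex a = start_vertex b"
    proof
      fix p assume "p \<in> set (zip w (rotate1 w))"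
      then obtain n where n: "n < length w" "w ! n = fst p" "rotate1 w ! n = snd p"
        unfolding in_set_zip by blast
      then have "snd p = w ! (Suc n mod length w)"
        using nth_rotate1[OF n(1)] by simp
      with *[rule_format, OF n(1)] n(2) show "case p of (a, b) \<Rightarrow> end_vertex a = start_vertex b"
        by (simp add: case_prod_unfold)
    qed
  next
    assume *: "\<forall>(a, b)\<in>set (zip w (rotate1 w)). end_vertex a = start_vertex b"
    show "\<forall>i<length w. end_vertex (w ! i) = start_vertex (w ! (Suc i mod length w))"
    proof (intro allI impI)
      fix i assume i: "i < length w"
      then have "(w ! i, w ! (Suc i mod length w)) \<in> set (zip w (rotate1 w))"
        unfolding in_set_zip by (intro exI[of _ i]) (simp add: nth_rotate1)
      from bspec[OF * this] show "end_vertex (w ! i) = start_vertex (w ! (Suc i mod length w))"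
        by simp
    qed
  qed
  then show ?thesis
    by (simp add: closed_walk_def set_bonds_iff)
qed

lemma loop_amplitude_eq:
  "scattering.path_amplitude vertex_scattering i xs i =
     (\<Prod>(a, b)\<leftarrow>zip (i # xs) (rotate1 (i # xs)). vertex_scattering b a)"
  unfolding scattering.path_amplitude_def[OF scattering_bonds] by simp

lemma loop_amplitude_nonzero_imp_closed:
  assumes "set (i # xs) \<subseteq> bonds" "scattering.path_amplitude vertex_scattering i xs i \<noteq> 0"
  shows "closed_walk (i # xs)"
  unfolding closed_walk_iff_corners
proof (intro conjI ballI, rule assms(1))
  fix p assume p: "p \<in> set (zip (i # xs) (rotate1 (i # xs)))"
  obtain a b where ab: "p = (a, b)" by (cases p)
  have "0 \<notin> (\<lambda>(a, b). vertex_scattering b a) ` set (zip (i # xs) (rotate1 (i # xs)))"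
    using assms(2) unfolding loop_amplitude_eq prod_list_zero_iff set_map .
  moreover have "vertex_scattering b a \<in> (\<lambda>(a, b). vertex_scattering b a) ` set (zip (i # xs) (rotate1 (i # xs)))"
    using imageI[OF p, of "\<lambda>(a, b). vertex_scattering b a"] unfolding ab case_prod_conv .
  ultimately have "vertex_scattering b a \<noteq> 0"
    by metis
  then have "end_vertex a = start_vertex b \<or> a = rev_bond b"
    by (auto simp: ab vertex_scattering_def split: if_splits)
  then show "case p of (a, b) \<Rightarrow> end_vertex a = start_vertex b"
    by (auto simp: ab)
qed

text \<open>
  Without backtracking all the factors are transmission amplitudes \<open>2 / deg v\<close>.
\<close>
lemma loop_amplitude_pos:
  assumes w: "minimal_periodic_orbit (i # xs)"
  shows "\<exists>r>0. scattering.path_amplitude vertex_scattering i xs i = complex_of_real r"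
  unfolding loop_amplitude_eq
proof (rule prod_list_pos_real)
  define w where "w = i # xs"
  fix x assume "x \<in> set (map (\<lambda>(a, b). vertex_scattering b a) (zip (i # xs) (rotate1 (i # xs))))"
  then obtain a b where ab: "(a, b) \<in> set (zip w (rotate1 w))" "x = vertex_scattering b a"
    by (auto simp: w_def)
  have closed: "closed_walk w"
    using assms by (simp add: minimal_periodic_orbit_def w_def)
  then have meet: "end_vertex a = start_vertex b"
    using ab(1) unfolding closed_walk_iff_corners by blast
  obtain n where n: "n < length w" "a = w ! n" "b = rotate1 w ! n"
    using ab(1) by (auto simp: in_set_zip)
  then have "b = w ! (Suc n mod length w)"
    by (simp add: nth_rotate1)
  then have "b \<noteq> rev_bond a"
    using minimal_orbit_no_backtracking[of w n] assms n by (simp add: w_def)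
  then have "a \<noteq> rev_bond b"
    by auto
  then have x: "x = 2 / of_nat (degree (start_vertex b))"
    using ab(2) meet by (simp add: vertex_scattering_def)
  have "b \<in> bonds"
    using ab(1) closed set_zip_rightD[OF ab(1)] by (auto simp: closed_walk_iff_corners)
  then have "b \<in> outgoing (start_vertex b)"
    by (simp add: outgoing_def)
  then have "degree (start_vertex b) > 0"
    by (auto simp: card_gt_0_iff simp flip: card_outgoing)
  then show "\<exists>r>0. x = complex_of_real r"
    unfolding x by (intro exI[of _ "2 / real (degree (start_vertex b))"]) simp
qed

text \<open>
  A loop with nonzero amplitude is a closed walk. For this length and this integral it lies in the class
  \<open>c\<close> and is minimal, so its amplitude is positive.
\<close>
lemma orbit_sum_minimal_nonzero:
  assumes gen: "generic \<alpha>" and c: "c \<in> carrier H1" "c \<noteq> (\<lambda>e. 0)"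
  shows "orbit_sum \<alpha> (minimal_length c) (- (2 * pi * class_integral \<alpha> c)) \<noteq> 0"
proof -
  interpret scattering bonds vertex_scattering bond_len "bond_flux \<alpha>" by (rule scattering_bonds)
  obtain w where w: "minimal_periodic_orbit w" "walk_class w = c"
    using minimal_orbit_exists[OF c(1)] by blast
  define E where "E = {w \<in> loops. loop_len w = minimal_length c \<and> loop_phase w = - (2 * pi * class_integral \<alpha> c)}"
  have finE: "finite E"
    by (rule finite_subset[OF _ finite_short_loops[of "minimal_length c"]]) (auto simp: E_def)
  have pos: "loop_coeff p = 0 \<or> (\<exists>r>0. loop_coeff p = of_real r)" if p: "p \<in> E" for p
  proof (cases "loop_coeff p = 0")
    case False
    obtain i xs where ixs: "p = (i, xs)" by (cases p)
    have set: "set (i # xs) \<subseteq> bonds" "i \<in> bonds"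
      using p by (auto simp: E_def loops_def ixs)
    have "path_amplitude i xs i \<noteq> 0"
      using False by (auto simp: ixs loop_coeff_def)
    then have closed: "closed_walk (i # xs)"
      by (rule loop_amplitude_nonzero_imp_closed[OF set(1)])
    have "class_integral \<alpha> (walk_class (i # xs)) = class_integral \<alpha> c"
      unfolding class_integral_walk_class[OF set(1)] using p by (simp add: E_def ixs loop_phase_eq)
    then have cls: "walk_class (i # xs) = c"
      by (rule generic_periods_injective[OF gen closed_walk_class_in_H1[OF closed] c(1)])
    have "walk_length (i # xs) = minimal_length c"
      using p by (simp add: E_def ixs loop_len_eq)
    then have "minimal_periodic_orbit (i # xs)"
      unfolding minimal_periodic_orbit_def using closed cls minimal_length_le by metis
    then obtain r where "r > 0" "path_amplitude i xs i = of_real r"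
      using loop_amplitude_pos by blast
    then show ?thesis
      using len_pos[OF set(2)] by (intro disjI2 exI[of _ "bond_len i * r"]) (simp add: ixs loop_coeff_def)
  qed simp
  obtain i xs where ixs: "w = i # xs"
    using w c(2) by (cases w) auto
  have closed: "closed_walk (i # xs)"
    using w(1) by (simp add: minimal_periodic_orbit_def ixs)
  then have set: "set (i # xs) \<subseteq> bonds"
    by (simp add: closed_walk_iff_corners)
  have "(i, xs) \<in> E"
    using set w minimal_length_eq[OF w(1)] class_integral_walk_class[OF set, of \<alpha>]
    by (auto simp: E_def loops_def loop_len_eq loop_phase_eq ixs)
  moreover obtain r where r: "r > 0" "path_amplitude i xs i = of_real r"
    using loop_amplitude_pos w(1) unfolding ixs by blast
  moreover have "bond_len i > 0"
    using set by (intro len_pos) simp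
  ultimately have ne: "\<exists>p\<in>E. loop_coeff p \<noteq> 0"
    by (intro bexI[of _ "(i, xs)"]) (auto simp: loop_coeff_def)
  have "(\<Sum>p\<in>E. Re (loop_coeff p)) > 0"
  proof -
    obtain p where "p \<in> E" "loop_coeff p \<noteq> 0"
      using ne by blast
    moreover have "0 \<le> Re (loop_coeff q)" if "q \<in> E" for q
      using pos[OF that] by auto
    moreover from calculation have "0 < Re (loop_coeff p)"
      using pos[of p] by auto
    ultimately show ?thesis
      by (intro sum_pos2[OF finE]) auto
  qed
  then have "Re (\<Sum>p\<in>E. loop_coeff p) \<noteq> 0"
    by simp
  then have "(\<Sum>p\<in>E. loop_coeff p) \<noteq> 0"
    by (metis zero_complex.simps(1))
  then show ?thesis
    unfolding orbit_sum_def E_def[symmetric] .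
qed

lemma orbit_sum_nonzero_imp:
  assumes "orbit_sum \<alpha> x (- (2 * pi * v)) \<noteq> 0"
  shows "\<exists>c\<in>carrier H1. class_integral \<alpha> c = v \<and> minimal_length c \<le> x"
proof -
  interpret scattering bonds vertex_scattering bond_len "bond_flux \<alpha>" by (rule scattering_bonds)
  have "\<exists>p\<in>{p \<in> loops. loop_len p = x \<and> loop_phase p = - (2 * pi * v)}. loop_coeff p \<noteq> 0"
    using assms unfolding orbit_sum_def by (meson sum.neutral)
  then obtain p where p: "p \<in> loops" "loop_len p = x" "loop_phase p = - (2 * pi * v)" "loop_coeff p \<noteq> 0"
    by blast
  obtain i xs where ixs: "p = (i, xs)" by (cases p)
  have set: "set (i # xs) \<subseteq> bonds"
    using p by (auto simp: loops_def ixs)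
  have "path_amplitude i xs i \<noteq> 0"
    using p(4) by (auto simp: ixs loop_coeff_def)
  then have closed: "closed_walk (i # xs)"
    by (rule loop_amplitude_nonzero_imp_closed[OF set])
  have "class_integral \<alpha> (walk_class (i # xs)) = v"
    unfolding class_integral_walk_class[OF set] using p(3) by (simp add: ixs loop_phase_eq)
  moreover have "minimal_length (walk_class (i # xs)) \<le> x"
    using minimal_length_le[OF closed] p(2) by (simp add: ixs loop_len_eq)
  ultimately show ?thesis
    using closed_walk_class_in_H1[OF closed] by blast
qed

end

text \<open>
  The spectra determine the multiplicities and thus the dimensions of the spaces of bound states.
\<close>
lemma orbit_sum_determined:
  fixes G :: "('v, 'e) pre_digraph" and G' :: "('w, 'f) pre_digraph"
  assumes G: "quantum_graph G L" and G': "quantum_graph G' L'"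
    and \<alpha>: "\<alpha> \<in> quantum_graph.one_forms G L" and \<alpha>': "\<alpha>' \<in> quantum_graph.one_forms G' L'" and "\<epsilon> > 0"
    and spec: "\<forall>t\<in>{0..<\<epsilon>}. quantum_graph.Spec G L (\<lambda>e x. t * \<alpha> e x) = quantum_graph.Spec G' L' (\<lambda>e x. t * \<alpha>' e x)"
  shows "quantum_graph.orbit_sum G L \<alpha> x v = quantum_graph.orbit_sum G' L' \<alpha>' x v"
proof -
  interpret A: quantum_graph G L by fact
  interpret B: quantum_graph G' L' by fact
  have dims: "cfun.dim (scattering.bound_states A.bonds A.vertex_scattering A.bond_len (\<lambda>d. t * A.bond_flux \<alpha> d) (of_real k)) =
      cfun.dim (scattering.bound_states B.bonds B.vertex_scattering B.bond_len (\<lambda>d. t * B.bond_flux \<alpha>' d) (of_real k))"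
    if t: "0 \<le> t" "t < \<epsilon>" and k: "k \<noteq> 0" for t k
  proof -
    have "A.multiplicity (\<lambda>e x. t * \<alpha> e x) (of_real (k\<^sup>2)) = B.multiplicity (\<lambda>e x. t * \<alpha>' e x) (of_real (k\<^sup>2))"
      using spec t by (intro Spec_eq_imp_multiplicity_eq G G') auto
    then show ?thesis
      using A.multiplicity_eq_dim_wave_space[OF A.one_forms_scale[OF \<alpha>] k]
        B.multiplicity_eq_dim_wave_space[OF B.one_forms_scale[OF \<alpha>'] k]
      by (simp add: A.wave_space_def B.wave_space_def A.bond_flux_scale[abs_def] B.bond_flux_scale[abs_def])
  qed
  show ?thesis
    unfolding A.orbit_sum_def B.orbit_sum_def
    by (rule loop_sums_determined[OF A.scattering_bonds B.scattering_bonds \<open>\<epsilon> > 0\<close> dims])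
qed

text \<open>
  A nonzero class is visible in the sums at its minimal length. The trivial class is treated separately:
  its minimal orbit is the empty walk, which is not a loop in the sense of the trace formula.
\<close>
lemma minimal_lengths_transfer:
  fixes G :: "('v, 'e) pre_digraph" and G' :: "('w, 'f) pre_digraph"
  assumes G: "quantum_graph G L" and G': "quantum_graph G' L'"
    and gen: "quantum_graph.generic G L \<alpha>"
    and sums: "\<And>x v. quantum_graph.orbit_sum G L \<alpha> x v = quantum_graph.orbit_sum G' L' \<alpha>' x v"
    and c: "c \<in> carrier (quantum_graph.H1 G)"
  shows "\<exists>c'\<in>carrier (quantum_graph.H1 G').
    quantum_graph.class_integral G' L' \<alpha>' c' = quantum_graph.class_integral G L \<alpha> c \<and>
    quantum_graph.minimal_length G' L' c' \<le> quantum_graph.minimal_length G L c"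
proof -
  interpret A: quantum_graph G L by fact
  interpret B: quantum_graph G' L' by fact
  show ?thesis
  proof (cases "c = (\<lambda>e. 0)")
    case True
    have "(\<lambda>e. 0) \<in> carrier B.H1"
      by (simp add: B.H1_def)
    then show ?thesis
      using True A.minimal_length_0 B.minimal_length_0
      by (intro bexI[of _ "\<lambda>e. 0"]) (simp_all add: A.class_integral_def B.class_integral_def)
  next
    case False
    from A.orbit_sum_minimal_nonzero[OF gen c False]
    show ?thesis
      unfolding sums by (rule B.orbit_sum_nonzero_imp)
  qed
qed

theorem theorem7p7:
  fixes G :: "('v, 'e) pre_digraph" and L :: "'e \<Rightarrow> real"
    and G' :: "('w, 'f) pre_digraph" and L' :: "'f \<Rightarrow> real"
    and \<alpha> :: "'e \<Rightarrow> real \<Rightarrow> real" and \<alpha>' :: "'f \<Rightarrow> real \<Rightarrow> real"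
    and \<epsilon> :: real
  assumes "quantum_graph G L" and "quantum_graph G' L'"
    and "quantum_graph.generic G L \<alpha>" and "quantum_graph.generic G' L' \<alpha>'"
    and "\<epsilon> > 0"
    and "\<forall>t\<in>{0..<\<epsilon>}. quantum_graph.Spec G L (\<lambda>e x. t * \<alpha> e x) =
                      quantum_graph.Spec G' L' (\<lambda>e x. t * \<alpha>' e x)"
  shows "\<exists>\<phi> \<in> iso (quantum_graph.H1 G) (quantum_graph.H1 G').
           \<forall>c \<in> carrier (quantum_graph.H1 G).
             quantum_graph.class_integral G' L' \<alpha>' (\<phi> c) = quantum_graph.class_integral G L \<alpha> c \<and>
             quantum_graph.minimal_length G' L' (\<phi> c) = quantum_graph.minimal_length G L c"
proof -
  interpret A: quantum_graph G L by fact
  interpret B: quantum_graph G' L' by fact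
  have forms: "\<alpha> \<in> A.one_forms" "\<alpha>' \<in> B.one_forms"
    using assms(3,4) by (simp_all add: A.generic_def B.generic_def)
  have sums: "A.orbit_sum \<alpha> x v = B.orbit_sum \<alpha>' x v" for x v
    by (rule orbit_sum_determined[OF assms(1,2) forms assms(5,6)])
  have to: "\<exists>c'\<in>carrier B.H1. B.class_integral \<alpha>' c' = A.class_integral \<alpha> c \<and> B.minimal_length c' \<le> A.minimal_length c"
    if "c \<in> carrier A.H1" for c
    by (rule minimal_lengths_transfer[OF assms(1,2,3) sums that])
  have from': "\<exists>c\<in>carrier A.H1. A.class_integral \<alpha> c = B.class_integral \<alpha>' c' \<and> A.minimal_length c \<le> B.minimal_length c'"
    if "c' \<in> carrier B.H1" for c'
    by (rule minimal_lengths_transfer[OF assms(2,1,4) sums[symmetric] that])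
  note inj = A.generic_periods_injective[OF assms(3)] B.generic_periods_injective[OF assms(4)]
  define \<phi> where "\<phi> c = (SOME c'. c' \<in> carrier B.H1 \<and> B.class_integral \<alpha>' c' = A.class_integral \<alpha> c)" for c
  have \<phi>: "\<phi> c \<in> carrier B.H1" "B.class_integral \<alpha>' (\<phi> c) = A.class_integral \<alpha> c" if "c \<in> carrier A.H1" for c
  proof -
    have "\<exists>c'. c' \<in> carrier B.H1 \<and> B.class_integral \<alpha>' c' = A.class_integral \<alpha> c"
      using to[OF that] by blast
    from someI_ex[OF this] show "\<phi> c \<in> carrier B.H1" "B.class_integral \<alpha>' (\<phi> c) = A.class_integral \<alpha> c"
      unfolding \<phi>_def by blast+
  qed
  have lengths: "B.minimal_length (\<phi> c) = A.minimal_length c" if c: "c \<in> carrier A.H1" for c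
  proof (rule antisym)
    obtain c' where c': "c' \<in> carrier B.H1" "B.class_integral \<alpha>' c' = A.class_integral \<alpha> c"
      "B.minimal_length c' \<le> A.minimal_length c"
      using to[OF c] by blast
    moreover have "c' = \<phi> c"
      using c' \<phi>[OF c] by (intro inj(2)) auto
    ultimately show "B.minimal_length (\<phi> c) \<le> A.minimal_length c"
      by simp
    obtain d where d: "d \<in> carrier A.H1" "A.class_integral \<alpha> d = B.class_integral \<alpha>' (\<phi> c)"
      "A.minimal_length d \<le> B.minimal_length (\<phi> c)"
      using from'[OF \<phi>(1)[OF c]] by blast
    moreover have "d = c"
      using d c \<phi>(2)[OF c] by (intro inj(1)) auto
    ultimately show "A.minimal_length c \<le> B.minimal_length (\<phi> c)"
      by simp
  qed
  have "\<phi> \<in> hom A.H1 B.H1"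
  proof (rule homI)
    fix c d assume cd: "c \<in> carrier A.H1" "d \<in> carrier A.H1"
    have mult: "c \<otimes>\<^bsub>A.H1\<^esub> d = (\<lambda>e. c e + d e)" "\<phi> c \<otimes>\<^bsub>B.H1\<^esub> \<phi> d = (\<lambda>e. \<phi> c e + \<phi> d e)"
      by (simp_all add: A.H1_def B.H1_def)
    have in_A: "(\<lambda>e. c e + d e) \<in> carrier A.H1"
      using cd by (auto simp: A.H1_def sum.distrib algebra_simps)
    have in_B: "(\<lambda>e. \<phi> c e + \<phi> d e) \<in> carrier B.H1"
      using \<phi>(1)[OF cd(1)] \<phi>(1)[OF cd(2)] by (auto simp: B.H1_def sum.distrib algebra_simps)
    show "\<phi> (c \<otimes>\<^bsub>A.H1\<^esub> d) = \<phi> c \<otimes>\<^bsub>B.H1\<^esub> \<phi> d"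
      unfolding mult
      by (rule inj(2)[OF \<phi>(1)[OF in_A] in_B])
        (simp add: \<phi>(2)[OF in_A] \<phi>(2)[OF cd(1)] \<phi>(2)[OF cd(2)] A.class_integral_add B.class_integral_add)
  qed (rule \<phi>(1))
  moreover have "bij_betw \<phi> (carrier A.H1) (carrier B.H1)"
  proof (rule bij_betw_imageI)
    show "inj_on \<phi> (carrier A.H1)"
      by (rule inj_onI) (metis inj(1) \<phi>(2))
    show "\<phi> ` carrier A.H1 = carrier B.H1"
    proof (intro subset_antisym subsetI)
      fix c' assume c': "c' \<in> carrier B.H1"
      obtain c where c: "c \<in> carrier A.H1" "A.class_integral \<alpha> c = B.class_integral \<alpha>' c'"
        using from'[OF c'] by blast
      have "c' = \<phi> c"
        using c c' \<phi>[OF c(1)] by (intro inj(2)) auto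
      with c(1) show "c' \<in> \<phi> ` carrier A.H1"
        by blast
    qed (use \<phi>(1) in blast)
  qed
  ultimately have "\<phi> \<in> iso A.H1 B.H1"
    by (rule isoI)
  then show ?thesis
    using \<phi>(2) lengths by blast
qed

end
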